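(* Let $p\geq 2$, $d\geq 1$, and let $u\in W^{1,p}_{O}(\mathbb{R}^d)$. Then $$ \int_{\mathbb{R}^d}|\nabla u(x)|^p\,dx\geq D_H(d,p)\int_{\mathbb{R}^d}\frac{|u(x)|^p}{|x|^p}\,dx, $$ where $$ D_H(d,p)=\left(\frac{4(p-2)}{p^2}+\left(\frac{d-p+2}{p}\right)^2\right)^{\frac{p}{2}}. $$
   Context: A function $u$ on $\mathbb{R}^d$ is odd if $u(-x)=-u(x)$. $W^{k,p}(\mathbb{R}^d)$ is the usual Sobolev space, and $W^{k,p}_{O}(\mathbb{R}^d)=\{u\in W^{k,p}(\mathbb{R}^d): u \text{ is odd}\}$. $|\cdot|$ denotes the Euclidean norm. *)

theory Defs
  imports "HOL-Analysis.Analysis"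
begin

definition partial_deriv ::
    "'n \<Rightarrow> (real^'n::finite \<Rightarrow> real) \<Rightarrow> real^'n \<Rightarrow> real" where
  "partial_deriv i f x = frechet_derivative f (at x) (axis i 1)"

primrec C_k :: "nat \<Rightarrow> (real^'n::finite \<Rightarrow> real) \<Rightarrow> bool" where
  "C_k 0 f \<longleftrightarrow> continuous_on UNIV f"
| "C_k (Suc k) f \<longleftrightarrow> (\<forall>x. f differentiable at x) \<and> (\<forall>i. C_k k (partial_deriv i f))"

definition test_function :: "(real^'n::finite \<Rightarrow> real) \<Rightarrow> bool" where
  "test_function \<phi> \<longleftrightarrow> (\<forall>k. C_k k \<phi>) \<and> compact (closure {x. \<phi> x \<noteq> 0})"

definition locally_integrable ::
    "(real^'n::finite \<Rightarrow> 'b::euclidean_space) \<Rightarrow> bool" where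
  "locally_integrable f \<longleftrightarrow> (\<forall>K. compact K \<longrightarrow> set_integrable lebesgue K f)"

text \<open>
  Functions are representatives of their almost-everywhere classes. With 'b being the real or the
  complex numbers, a gradient takes values in 'b^'n, whose norm is the Euclidean norm
  (the square root of the sum of the squared moduli of the components). Real-valued test functions
  suffice also for complex-valued functions, by linearity.
\<close>

definition has_weak_gradient ::
    "(real^'n::finite \<Rightarrow> 'b::euclidean_space) \<Rightarrow> (real^'n \<Rightarrow> 'b^'n) \<Rightarrow> bool" where
  "has_weak_gradient u g \<longleftrightarrow> locally_integrable u \<and> locally_integrable g \<and>
     (\<forall>\<phi> i. test_function \<phi> \<longrightarrow>
        (LINT x|lebesgue. partial_deriv i \<phi> x *\<^sub>R u x) = - (LINT x|lebesgue. \<phi> x *\<^sub>R (g x $ i)))"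

definition Lp :: "real \<Rightarrow> (real^'n::finite \<Rightarrow> 'b::euclidean_space) set" where
  "Lp p = {f. f \<in> borel_measurable lebesgue \<and> integrable lebesgue (\<lambda>x. norm (f x) powr p)}"

definition sobolev_W1 :: "real \<Rightarrow> (real^'n::finite \<Rightarrow> 'b::euclidean_space) set" where
  "sobolev_W1 p = {u. u \<in> Lp p \<and> (\<exists>g. has_weak_gradient u g \<and> g \<in> Lp p)}"

text \<open>Oddness is required almost everywhere, so that it is a property of the class of the function.\<close>

definition sobolev_W1_odd :: "real \<Rightarrow> (real^'n::finite \<Rightarrow> 'b::euclidean_space) set" where
  "sobolev_W1_odd p = {u \<in> sobolev_W1 p. AE x in lebesgue. u (- x) = - u x}"

definition D_H :: "nat \<Rightarrow> real \<Rightarrow> real" where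
  "D_H d p = (4 * (p - 2) / p\<^sup>2 + ((real d - p + 2) / p)\<^sup>2) powr (p / 2)"

end

theory Submission
  imports Defs
begin

text \<open>
The theorem reduces to a quadratic inequality, and that one to a half space. Put
C = ((d - p + 2)/2)^2 + (p - 2), so that the constant is (4 C / p^2)^(p/2). The heart of the proof
is the quadratic inequality

    \<integral> |dv|^2 |x|^(2-p) \<ge> C \<integral> |v|^2 |x|^(-p)      for odd v,

which is \<open>odd_weighted_hardy\<close> (written there with \<alpha> = p/2 - 1). Both integrals are invariant under
the reflections x_i \<mapsto> - x_i, so splitting v into its even and odd part with respect to one
coordinate splits both of them (\<open>parity_split_integral\<close>). Doing this for one coordinate after the
other writes an odd v as a sum of pieces each of which is odd in some single coordinate x_i: what
is left over at the end is even in every coordinate, hence even, and also odd, hence zero.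
A piece that is odd in x_i vanishes on the hyperplane x_i = 0, and on that half space
h = x_i |x|^(-s) with s = (d - p + 2)/2 is a positive ground state: expanding
|dv - v dh/h|^2 \<ge> 0 and integrating by parts gives exactly the constant C
(\<open>half_space_hardy\<close>). Since C = ((d - p)/2)^2 + (d - 1), the gain over the constant for general
functions is d - 1, the first eigenvalue of the sphere on odd functions.

To reach the exponent p, apply this to v = |u|^(p/2-1) u, for which
|dv| \<le> (p/2) |u|^(p/2-1) |du|. With a = |u|/|x|, b = |du| and \<kappa> = 4 C / p^2, convexity of
t \<mapsto> t^(p/2) gives the pointwise bound
b^p \<ge> \<kappa>^(p/2) a^p + (p/2) (\<kappa> a^2)^(p/2-1) (b^2 - \<kappa> a^2), and the quadratic inequality says that
the last term has a nonnegative integral (\<open>smooth_odd_hardy\<close>).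

This works for functions with bounded partial derivatives and compact support. A general u is
approximated by cut-off mollifications. Mollifying keeps oddness, turns the weak gradient into a
classical one, and increases neither integral of p-th powers by Jensen's inequality; the cut-off
costs an error that tends to zero. On the side of u, the limit is taken with Fatou's lemma along an
almost everywhere convergent subsequence (\<open>mollify_AE_subsequence\<close>).
\<close>

section \<open>Convexity of powers\<close>

lemma powr_above_tangent:
  fixes q s t :: real
  assumes q: "q \<ge> 1" and s: "s \<ge> 0" and t: "t \<ge> 0"
  shows "t powr q \<ge> s powr q + q * s powr (q - 1) * (t - s)"
proof (cases "s = 0 \<or> t = 0")
  case True
  then show ?thesis
  proof
    assume "t = 0"
    have "s powr q = s powr (q - 1) * s"
      using s by (cases "s = 0") (auto simp: powr_diff)
    moreover have "s powr q \<le> q * s powr q"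
      using q by (metis mult_le_cancel_right1 powr_ge_zero not_less)
    ultimately show ?thesis
      using \<open>t = 0\<close> q by (simp add: algebra_simps)
  qed simp
next
  case False
  then have s: "s > 0" and t: "t > 0" using assms by auto
  have "convex_on {0<..} (\<lambda>x. x powr q)" 
    using powr_convex[OF q] by (rule convex_on_subset) auto
  moreover have "((\<lambda>x. x powr q) has_real_derivative q * s powr (q - 1)) (at s within {0<..})"
    using s by (auto intro!: derivative_eq_intros)
  ultimately have "t powr q - s powr q \<ge> q * s powr (q - 1) * (t - s)"
    using s t by (intro convex_on_imp_above_tangent[where A = "{0<..}"]) (auto simp: interior_open)
  then show ?thesis by simp
qed

text \<open>A substitute for Minkowski's inequality: write a + b as the convex combination of a/(1-l) and
b/l. For small l the coefficient of the main term a^p is close to 1, and the error b is paid for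
with a large constant.\<close>

lemma powr_add_le_weighted:
  fixes a b l p :: real
  assumes "p \<ge> 1" "a \<ge> 0" "b \<ge> 0" "0 < l" "l < 1"
  shows "(a + b) powr p \<le> (1 - l) powr (1 - p) * a powr p + l powr (1 - p) * b powr p"
proof (cases "a = 0 \<or> b = 0")
  case True
  have "1 \<le> l powr (1 - p)" "1 \<le> (1 - l) powr (1 - p)"
    using assms powr_mono2'[of "1-p" l 1] powr_mono2'[of "1-p" "1-l" 1]  by auto
  then show ?thesis using True assms
    by (auto simp: mult_le_cancel_right1)
next
  case False
  then have ab: "a > 0" "b > 0" using assms by auto
  have "((1 - l) *\<^sub>R (a / (1 - l)) + l *\<^sub>R (b / l)) powr p
        \<le> (1 - l) * (a / (1 - l)) powr p + l * (b / l) powr p"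
    using assms ab by (intro convex_onD[OF powr_convex]) auto
  moreover have "(1 - l) * (a / (1 - l)) powr p = (1 - l) powr (1 - p) * a powr p"
    using assms ab by (simp add: powr_divide powr_diff)
  moreover have "l * (b / l) powr p = l powr (1 - p) * b powr p"
    using assms ab by (simp add: powr_divide powr_diff)
  ultimately show ?thesis using assms by simp
qed

section \<open>The map z \<mapsto> |z|^\<alpha> z\<close>

definition pow_map :: "real \<Rightarrow> 'b::real_inner \<Rightarrow> 'b" where
  "pow_map \<alpha> z = norm z powr \<alpha> *\<^sub>R z"

text \<open>The derivative of \<open>pow_map \<alpha>\<close> at z in direction h. At z = 0 both summands vanish, because
0 powr y = 0 for every y; this is the right value for \<alpha> > 0.\<close>

definition pow_deriv :: "real \<Rightarrow> 'b::real_inner \<Rightarrow> 'b \<Rightarrow> 'b" where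
  "pow_deriv \<alpha> z h = norm z powr \<alpha> *\<^sub>R h + (\<alpha> * norm z powr (\<alpha> - 2) * (z \<bullet> h)) *\<^sub>R z"

lemma pow_map_minus: "pow_map \<alpha> (- z) = - pow_map \<alpha> z"
  by (simp add: pow_map_def)

lemma norm_pow_map: "norm (pow_map \<alpha> z) = norm z powr (\<alpha> + 1)"
  by (simp add: pow_map_def powr_add)

text \<open>The second summand is at most \<alpha> |z|^\<alpha> |h| by the Cauchy-Schwarz inequality.\<close>

lemma norm_pow_deriv_le:
  assumes "\<alpha> \<ge> 0"
  shows "norm (pow_deriv \<alpha> z h) \<le> (\<alpha> + 1) * norm z powr \<alpha> * norm h"
proof (cases "z = 0")
  case False
  have "norm (pow_deriv \<alpha> z h) \<le> norm z powr \<alpha> * norm h + \<alpha> * norm z powr (\<alpha> - 2) * \<bar>z \<bullet> h\<bar> * norm z"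
    unfolding pow_deriv_def by (rule order.trans[OF norm_triangle_ineq]) (use assms in \<open>simp add: abs_mult\<close>)
  also have "\<dots> \<le> norm z powr \<alpha> * norm h + \<alpha> * norm z powr (\<alpha> - 2) * (norm z * norm h) * norm z"
    using assms by (intro add_left_mono mult_right_mono mult_left_mono Cauchy_Schwarz_ineq2) auto
  also have "\<dots> = (\<alpha> + 1) * norm z powr \<alpha> * norm h"
    using False by (simp add: powr_diff powr_numeral power2_eq_square field_simps)
  finally show ?thesis .
qed (simp add: pow_deriv_def)

lemma has_vector_derivative_iff_quotient:
  fixes f :: "real \<Rightarrow> 'a::real_normed_vector"
  shows "(f has_vector_derivative f') (at t) \<longleftrightarrow> ((\<lambda>s. (f s - f t) /\<^sub>R (s - t)) \<longlongrightarrow> f') (at t)"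
proof -
  have "(f has_vector_derivative f') (at t) \<longleftrightarrow>
        ((\<lambda>s. norm (f s - f t - (s - t) *\<^sub>R f') / norm (s - t)) \<longlongrightarrow> 0) (at t)"
    by (auto simp: has_vector_derivative_def has_derivative_iff_norm bounded_linear_scaleR_left)
  also have "\<dots> \<longleftrightarrow> ((\<lambda>s. norm ((f s - f t) /\<^sub>R (s - t) - f')) \<longlongrightarrow> 0) (at t)"
  proof (rule filterlim_cong[OF refl refl])
    show "\<forall>\<^sub>F s in at t. norm (f s - f t - (s - t) *\<^sub>R f') / norm (s - t)
            = norm ((f s - f t) /\<^sub>R (s - t) - f')"
    proof (rule eventually_at_topological[THEN iffD2, OF exI[of _ UNIV]], safe)
      fix s assume "s \<noteq> t"
      then have "(f s - f t) /\<^sub>R (s - t) - f' = (f s - f t - (s - t) *\<^sub>R f') /\<^sub>R (s - t)"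
        by (simp add: scaleR_diff_right)
      then show "norm (f s - f t - (s - t) *\<^sub>R f') / norm (s - t) = norm ((f s - f t) /\<^sub>R (s - t) - f')"
        by (simp add: divide_inverse)
    qed auto
  qed
  also have "\<dots> \<longleftrightarrow> ((\<lambda>s. (f s - f t) /\<^sub>R (s - t)) \<longlongrightarrow> f') (at t)"
    by (simp only: tendsto_norm_zero_iff LIM_zero_iff)
  finally show ?thesis .
qed

text \<open>Away from zeros of f this is the product rule. At a zero the difference quotient of the
composition is |f|^\<alpha> times that of f, and the first factor tends to 0.\<close>

lemma pow_map_has_vector_derivative:
  assumes a: "\<alpha> > 0" and f: "(f has_vector_derivative f') (at t)"
  shows "((\<lambda>s. pow_map \<alpha> (f s)) has_vector_derivative pow_deriv \<alpha> (f t) f') (at t)"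
proof (cases "f t = 0")
  case False
  have fd: "(f has_derivative (\<lambda>h. h *\<^sub>R f')) (at t)" using f by (simp add: has_vector_derivative_def)
  have n: "((\<lambda>s. norm (f s)) has_real_derivative (f t \<bullet> f') / norm (f t)) (at t)"
    unfolding has_field_derivative_def
    by (rule has_derivative_eq_rhs[OF has_derivative_compose[OF fd has_derivative_norm[OF False]]])
       (auto simp: fun_eq_iff sgn_div_norm divide_inverse inner_commute)
  have "((\<lambda>s. norm (f s) powr \<alpha>) has_real_derivative
         \<alpha> * norm (f t) powr (\<alpha> - 1) * ((f t \<bullet> f') / norm (f t))) (at t)"
    using False by (intro DERIV_fun_powr[THEN DERIV_cong, OF n]) auto
  moreover have "norm (f t) powr (\<alpha> - 1) * ((f t \<bullet> f') / norm (f t)) = norm (f t) powr (\<alpha> - 2) * (f t \<bullet> f')"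
  proof -
    have "norm (f t) powr (\<alpha> - 1) = norm (f t) powr (\<alpha> - 2) * norm (f t)"
      using False powr_add[of "norm (f t)" "\<alpha> - 2" 1] by simp
    then show ?thesis using False by simp
  qed
  ultimately have "((\<lambda>s. norm (f s) powr \<alpha>) has_real_derivative
         \<alpha> * norm (f t) powr (\<alpha> - 2) * (f t \<bullet> f')) (at t)"
    by (simp only: mult.assoc)
  from has_vector_derivative_scaleR[OF this f] show ?thesis
    unfolding pow_map_def pow_deriv_def .
next
  case True
  have c: "isCont f t" using f has_vector_derivative_continuous by blast
  have "((\<lambda>s. norm (f s) powr \<alpha>) \<longlongrightarrow> norm (f t) powr \<alpha>) (at t)"
    using a c True by (intro tendsto_powr2 tendsto_norm) (auto simp: isCont_def)
  then have 1: "((\<lambda>s. norm (f s) powr \<alpha>) \<longlongrightarrow> 0) (at t)" using a True by simp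
  have 2: "((\<lambda>s. (f s - f t) /\<^sub>R (s - t)) \<longlongrightarrow> f') (at t)"
    using f by (simp add: has_vector_derivative_iff_quotient)
  have "((\<lambda>s. norm (f s) powr \<alpha> *\<^sub>R ((f s - f t) /\<^sub>R (s - t))) \<longlongrightarrow> 0 *\<^sub>R f') (at t)"
    by (intro tendsto_scaleR 1 2)
  then show ?thesis using True a
    by (simp add: has_vector_derivative_iff_quotient pow_map_def pow_deriv_def mult.commute)
qed

section \<open>Partial derivatives and integration by parts\<close>

text \<open>Derivatives along the coordinate lines are all that integration by parts uses. They are
immediate for a mollification, whose gradient is only known through test functions, and they are stable
under reflections and products.\<close>

definition has_partials :: "(real^'n \<Rightarrow> 'b) \<Rightarrow> (real^'n \<Rightarrow> 'b::real_normed_vector^'n) \<Rightarrow> bool" where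
  "has_partials v dv \<longleftrightarrow>
     (\<forall>x j. ((\<lambda>t. v (x + t *\<^sub>R axis j 1)) has_vector_derivative dv x $ j) (at 0))"

lemma has_partials_line:
  assumes "has_partials v dv"
  shows "((\<lambda>t. v (x + t *\<^sub>R axis j 1)) has_vector_derivative dv (x + t *\<^sub>R axis j 1) $ j) (at t)"
proof -
  have "((\<lambda>h. v ((x + t *\<^sub>R axis j 1) + h *\<^sub>R axis j 1)) has_vector_derivative
          dv (x + t *\<^sub>R axis j 1) $ j) (at 0)"
    using assms by (simp add: has_partials_def)
  then have "((\<lambda>h. v (x + (t + h) *\<^sub>R axis j 1)) \<circ> (\<lambda>s. s - t) has_vector_derivative
          1 *\<^sub>R (dv (x + t *\<^sub>R axis j 1) $ j)) (at t)"
    by (intro vector_diff_chain_at)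
       (auto intro!: derivative_eq_intros simp: algebra_simps has_real_derivative_iff_has_vector_derivative[symmetric])
  then show ?thesis by (simp add: o_def)
qed

text \<open>Finitely many exceptional points are allowed because the functions below are singular on a
hyperplane or at the origin, which the lines in question meet in at most one point.\<close>

lemma lipschitz_off_finite:
  fixes \<phi> :: "real \<Rightarrow> 'a::euclidean_space"
  assumes "finite S" "B \<ge> 0" and cont: "continuous_on UNIV \<phi>"
    and d: "\<And>t. t \<in> {min a b..max a b} - S \<Longrightarrow> (\<phi> has_vector_derivative \<phi>' t) (at t) \<and> norm (\<phi>' t) \<le> B"
  shows "norm (\<phi> b - \<phi> a) \<le> B * \<bar>b - a\<bar>"
proof -
  have "norm (\<phi> y - \<phi> x) \<le> B * (y - x)" if "x = min a b" "y = max a b" for x y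
  proof -
    have "(\<phi>' has_integral (\<phi> y - \<phi> x)) (cbox x y)"
      unfolding cbox_interval using assms that
      by (intro fundamental_theorem_of_calculus_strong[of S]) (auto intro: continuous_on_subset)
    from has_integral_bound_spike_finite[OF \<open>B \<ge> 0\<close> \<open>finite S\<close> this] show ?thesis
      using d that by (auto simp: max_def min_def split: if_splits)
  qed
  from this[OF refl refl] show ?thesis
    by (cases "a \<le> b") (auto simp: norm_minus_commute)
qed

lemma lborel_integral_shift:
  fixes f :: "'a::euclidean_space \<Rightarrow> 'b::{banach, second_countable_topology}"
  assumes [measurable]: "f \<in> borel_measurable borel"
  shows "(LINT x|lborel. f (x + c)) = (LINT x|lborel. f x)"
  by (subst (2) lborel_distr_plus[of c, symmetric], subst integral_distr) (auto simp: add.commute)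

lemma integrable_continuous_bounded_support:
  fixes f :: "'a::euclidean_space \<Rightarrow> 'b::{banach, second_countable_topology}"
  assumes c: "continuous_on UNIV f" and R: "\<And>x. norm x > R \<Longrightarrow> f x = 0"
  shows "integrable lborel f"
proof -
  have "integrable lborel (\<lambda>x. indicator (cball 0 R) x *\<^sub>R f x)"
    using borel_integrable_compact[of "cball 0 R" f] continuous_on_subset[OF c] by (auto simp: set_integrable_def)
  also have "(\<lambda>x. indicator (cball 0 R) x *\<^sub>R f x) = f"
    using R by (auto simp: fun_eq_iff indicator_def not_le)
  finally show ?thesis .
qed

text \<open>The difference quotients of G in direction j have integral zero, because Lebesgue measure is
invariant under translations. They are bounded by the bound on \<open>G'\<close>, so dominated convergence
yields the claim. Here E is the singular set of G.\<close>

lemma integral_partial_derivative_eq_0: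
  fixes G G' :: "real^'n::finite \<Rightarrow> real"
  assumes cont: "continuous_on UNIV G" and [measurable]: "G' \<in> borel_measurable borel"
    and bound: "\<And>x. x \<notin> E \<Longrightarrow> \<bar>G' x\<bar> \<le> B"
    and supp: "\<And>x. norm x > R \<Longrightarrow> G x = 0"
    and E: "E \<in> null_sets lborel" "\<And>x. finite {t. x + t *\<^sub>R axis j 1 \<in> E}"
    and deriv: "\<And>x. x \<notin> E \<Longrightarrow> ((\<lambda>t. G (x + t *\<^sub>R axis j 1)) has_real_derivative G' x) (at 0)"
  shows "integrable lborel G' \<and> (LINT x|lborel. G' x) = 0"
proof -
  have [measurable]: "G \<in> borel_measurable borel"
    using cont by (rule borel_measurable_continuous_onI)
  define B' where "B' = max B 0"
  define e where "e = (axis j 1 :: real^'n)"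
  have [simp]: "norm e = 1" by (simp add: e_def)
  define \<delta> where "\<delta> n = 1 / real (Suc n)" for n
  have \<delta>: "\<delta> n > 0" "\<delta> n \<le> 1" for n by (auto simp: \<delta>_def)
  define q where "q n x = (G (x + \<delta> n *\<^sub>R e) - G x) /\<^sub>R \<delta> n" for n x
  have [measurable]: "q n \<in> borel_measurable borel" for n unfolding q_def by measurable
  have "norm (q n x) \<le> B' * indicator (cball 0 (R + 1)) x" for n x
  proof (cases "norm x \<le> R + 1")
    case True
    have "norm (G (x + \<delta> n *\<^sub>R e) - G (x + 0 *\<^sub>R e)) \<le> B' * \<bar>\<delta> n - 0\<bar>"
    proof (rule lipschitz_off_finite[where \<phi>' = "\<lambda>t. G' (x + t *\<^sub>R e)"])
      show "finite {t. x + t *\<^sub>R e \<in> E}" using E(2) by (simp add: e_def)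
      show "continuous_on UNIV (\<lambda>t. G (x + t *\<^sub>R e))"
        by (rule continuous_on_compose2[OF cont]) (auto intro!: continuous_intros)
      fix t assume "t \<in> {min 0 (\<delta> n)..max 0 (\<delta> n)} - {t. x + t *\<^sub>R e \<in> E}"
      then have t: "x + t *\<^sub>R e \<notin> E" by auto
      have "((\<lambda>h. G (x + (t + h) *\<^sub>R e)) has_real_derivative G' (x + t *\<^sub>R e)) (at 0)"
        using deriv[OF t] by (simp add: e_def algebra_simps)
      then have "((\<lambda>h. G (x + h *\<^sub>R e)) has_real_derivative G' (x + t *\<^sub>R e)) (at (0 + t))"
        by (subst DERIV_shift) (simp add: add.commute)
      then show "((\<lambda>t. G (x + t *\<^sub>R e)) has_vector_derivative G' (x + t *\<^sub>R e)) (at t) \<and> norm (G' (x + t *\<^sub>R e)) \<le> B'"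
        using bound[OF t] by (auto simp: has_real_derivative_iff_has_vector_derivative B'_def)
    qed (simp add: B'_def)
    then show ?thesis using True \<delta>[of n] by (simp add: q_def field_simps)
  next
    case False
    have "norm x \<le> norm (x + \<delta> n *\<^sub>R e) + norm (\<delta> n *\<^sub>R e)"
      using norm_triangle_ineq4[of "x + \<delta> n *\<^sub>R e" "\<delta> n *\<^sub>R e"] by simp
    then have "norm (x + \<delta> n *\<^sub>R e) > R" using False \<delta>[of n] by simp
    then show ?thesis using False supp[of x] supp[of "x + \<delta> n *\<^sub>R e"]
      by (simp add: q_def)
  qed
  then have qb: "AE x in lborel. norm (q n x) \<le> B' * indicator (cball 0 (R + 1)) x" for n by simp
  have AE: "AE x in lborel. (\<lambda>n. q n x) \<longlonglongrightarrow> G' x"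
  proof (rule AE_I'[OF E(1)], safe)
    fix x assume n: "\<not> (\<lambda>n. q n x) \<longlonglongrightarrow> G' x"
    show "x \<in> E"
    proof (rule ccontr)
      assume "x \<notin> E"
      from deriv[OF this] have "((\<lambda>s. (G (x + s *\<^sub>R e) - G x) /\<^sub>R s) \<longlongrightarrow> G' x) (at 0)"
        by (simp add: has_real_derivative_iff_has_vector_derivative has_vector_derivative_iff_quotient e_def)
      moreover have "filterlim \<delta> (at 0) sequentially"
        unfolding \<delta>_def filterlim_at using LIMSEQ_inverse_real_of_nat by (auto simp: inverse_eq_divide)
      ultimately have "(\<lambda>n. q n x) \<longlonglongrightarrow> G' x"
        unfolding q_def by (rule filterlim_compose)
      with n show False by simp
    qed
  qed
  have dom: "integrable lborel (\<lambda>x::real^'n. B' * indicator (cball 0 (R + 1)) x)"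
    using emeasure_bounded_finite[OF bounded_cball, of "0::real^'n" "R + 1"]
    by (intro integrable_mult_right integrable_real_indicator) (auto simp: infinity_ennreal_def)
  have "(LINT x|lborel. q n x) = 0" for n
  proof -
    have i: "integrable lborel G" using cont supp by (rule integrable_continuous_bounded_support)
    have c: "continuous_on UNIV (\<lambda>x. G (x + \<delta> n *\<^sub>R e))"
      by (rule continuous_on_compose2[OF cont]) (auto intro!: continuous_intros)
    have "integrable lborel (\<lambda>x. G (x + \<delta> n *\<^sub>R e))"
    proof (rule integrable_continuous_bounded_support[OF c, of "R + 1"])
      fix x :: "real^'n" assume "norm x > R + 1"
      moreover have "norm x \<le> norm (x + \<delta> n *\<^sub>R e) + norm (\<delta> n *\<^sub>R e)"
        using norm_triangle_ineq4[of "x + \<delta> n *\<^sub>R e" "\<delta> n *\<^sub>R e"] by simp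
      ultimately show "G (x + \<delta> n *\<^sub>R e) = 0" using \<delta>[of n] by (intro supp) simp
    qed
    with i show ?thesis by (simp add: q_def lborel_integral_shift)
  qed
  moreover have "(\<lambda>n. LINT x|lborel. q n x) \<longlonglongrightarrow> (LINT x|lborel. G' x)"
    by (rule integral_dominated_convergence[OF _ _ dom AE qb]) auto
  moreover have "integrable lborel G'"
    by (rule integrable_dominated_convergence[OF _ _ dom AE qb]) auto
  ultimately show ?thesis by (simp add: LIMSEQ_const_iff)
qed

section \<open>Coordinate reflections\<close>

definition flip :: "'n \<Rightarrow> 'a::uminus^'n \<Rightarrow> 'a^'n" where
  "flip i x = (\<chi> j. if j = i then - x $ j else x $ j)"

lemma flip_flip [simp]: "flip i (flip i x) = (x :: 'a::group_add^'n)"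
  by (simp add: flip_def vec_eq_iff)

lemma flip_commute: "flip i (flip k x) = flip k (flip i (x :: 'a::group_add^'n))"
  by (simp add: flip_def vec_eq_iff)

lemma flip_minus: "flip i (- x) = - flip i (x :: 'a::group_add^'n)"
  by (simp add: flip_def vec_eq_iff)

lemma norm_flip [simp]: "norm (flip i x) = norm (x :: 'a::real_normed_vector^'n::finite)"
  unfolding norm_vec_def L2_set_def by (rule arg_cong[of _ _ sqrt], rule sum.cong) (auto simp: flip_def)

lemma inner_flip [simp]: "flip i x \<bullet> flip i x = (x :: real^'n::finite) \<bullet> x"
  by (simp flip: power2_norm_eq_inner)

text \<open>Reflections in coordinates and the antipodal map x \<mapsto> - x are the two cases in use.\<close>

lemma lborel_distr_signs:
  fixes c :: "'n::finite \<Rightarrow> real"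
  assumes c: "\<And>j. \<bar>c j\<bar> = 1"
  shows "distr lborel borel (\<lambda>x::real^'n. \<chi> j. c j * x $ j) = lborel"
proof -
  define c' where "c' b = b \<bullet> (\<chi> j. c j)" for b :: "real^'n"
  have c': "c' (axis j 1) = c j" for j by (simp add: c'_def inner_axis')
  have B: "\<bar>c' b\<bar> = 1" if "b \<in> Basis" for b
    using that c' c by (auto simp: Basis_vec_def)
  have T: "0 + (\<Sum>b\<in>Basis. (c' b * (x \<bullet> b)) *\<^sub>R b) = (\<chi> j. c j * x $ j)" for x :: "real^'n"
  proof (rule euclidean_eqI)
    fix b :: "real^'n" assume b: "b \<in> Basis"
    then obtain j where j: "b = axis j 1" by (auto simp: Basis_vec_def)
    show "(0 + (\<Sum>b\<in>Basis. (c' b * (x \<bullet> b)) *\<^sub>R b)) \<bullet> b = (\<chi> j. c j * x $ j) \<bullet> b"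
      using b inner_sum_left_Basis[OF b, of "\<lambda>b. c' b * (x \<bullet> b)"]
      by (simp only: add_0_left) (simp add: j c' inner_axis)
  qed
  have "lborel = density (distr lborel borel (\<lambda>x. 0 + (\<Sum>b\<in>Basis. (c' b * (x \<bullet> b)) *\<^sub>R b)))
     (\<lambda>_. ennreal (\<Prod>b\<in>(Basis::(real^'n) set). \<bar>c' b\<bar>))"
    using B by (intro lborel_affine_euclidean) fastforce
  then show ?thesis unfolding T using B by (simp add: density_1)
qed

lemma lborel_distr_flip: "distr lborel borel (flip i) = (lborel :: (real^'n::finite) measure)"
proof -
  have "flip i = (\<lambda>x::real^'n. \<chi> j. (if j = i then -1 else 1) * x $ j)"
    by (auto simp: flip_def fun_eq_iff vec_eq_iff)
  then show ?thesis using lborel_distr_signs[of "\<lambda>j. if j = i then -1 else 1"] by simp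
qed

lemma lborel_distr_minus: "distr lborel borel uminus = (lborel :: (real^'n::finite) measure)"
proof -
  have "uminus = (\<lambda>x::real^'n. \<chi> j. -1 * x $ j)"
    by (auto simp: fun_eq_iff vec_eq_iff)
  then show ?thesis using lborel_distr_signs[of "\<lambda>j::'n. -1"] by simp
qed

lemma flip_continuous: "continuous_on UNIV (flip i :: 'a::real_normed_vector^'n::finite \<Rightarrow> _)"
  unfolding flip_def
proof (rule continuous_on_vec_lambda)
  show "continuous_on UNIV (\<lambda>x::'a^'n. if j = i then - x $ j else x $ j)" for j
    by (cases "j = i") (auto intro!: continuous_intros)
qed

lemma flip_measurable [measurable]:
  "(flip i :: 'a::real_normed_vector^'n::finite \<Rightarrow> _) \<in> borel_measurable borel"
  by (rule borel_measurable_continuous_onI[OF flip_continuous])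

section \<open>The weighted Hardy inequality for functions odd in one coordinate\<close>

text \<open>The functions to which the weighted inequality is applied: compact support and a gradient that
is O(|x|^\<alpha>) at the origin. That is the decay of the gradient of |u|^\<alpha> u for a Lipschitz
function u with u(0) = 0, and it makes every integrand bounded. The origin is left out since
0 powr 0 = 0 would force a vanishing gradient there when \<alpha> = 0.\<close>

definition hardy_class :: "real \<Rightarrow> real \<Rightarrow> real \<Rightarrow> (real^'n::finite \<Rightarrow> 'b::euclidean_space) \<Rightarrow> (real^'n \<Rightarrow> 'b^'n) \<Rightarrow> bool"
  where
  "hardy_class \<alpha> L R v dv \<longleftrightarrow> continuous_on UNIV v \<and> dv \<in> borel_measurable borel \<and> has_partials v dv \<and>
     (\<forall>x. x \<noteq> 0 \<longrightarrow> (norm (dv x))\<^sup>2 \<le> L * (x \<bullet> x) powr \<alpha>) \<and> (\<forall>x. norm x > R \<longrightarrow> v x = 0)"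

lemma norm_vec_power2: "(norm x)\<^sup>2 = (\<Sum>j\<in>UNIV. (norm (x $ j))\<^sup>2)"
  for x :: "'b::real_normed_vector^'n::finite"
  by (simp add: norm_vec_def L2_set_def sum_nonneg)

lemma hardy_class_zero_derivative:
  assumes v: "hardy_class \<alpha> L R v dv" and x: "norm x > R"
  shows "dv x = 0"
proof -
  have "dv x $ j = 0" for j
  proof -
    have o: "open {y::real^'a. norm y > R}" by (simp add: open_Collect_less continuous_on_norm_id)
    have "((\<lambda>t. v (x + t *\<^sub>R axis j 1)) has_vector_derivative dv x $ j) (at 0)"
      using v by (simp add: hardy_class_def has_partials_def)
    moreover have "open ((\<lambda>t. x + t *\<^sub>R axis j 1) -` {y. norm y > R})"
      by (intro open_vimage o) (auto intro!: continuous_intros)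
    ultimately have "((\<lambda>t. 0) has_vector_derivative dv x $ j) (at 0)"
      by (rule has_vector_derivative_transform_within_open) (use v x in \<open>auto simp: hardy_class_def\<close>)
    then show ?thesis
      using vector_derivative_unique_at has_vector_derivative_const by blast
  qed
  then show ?thesis by (simp add: vec_eq_iff)
qed

text \<open>Evaluate the gradient bound at the vector (1, ..., 1).\<close>

lemma hardy_class_L_nonneg:
  assumes "hardy_class \<alpha> L R v dv" shows "L \<ge> 0"
proof -
  have "(norm (dv 1))\<^sup>2 \<le> L * (1 \<bullet> (1::real^'a)) powr \<alpha>" using assms by (auto simp: hardy_class_def)
  then have "0 \<le> L * (1 \<bullet> (1::real^'a)) powr \<alpha>" using zero_le_power2 order.trans by blast
  moreover have "(1 \<bullet> (1::real^'a)) powr \<alpha> > 0" by simp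
  ultimately show ?thesis by (simp add: zero_le_mult_iff)
qed

lemma coord_square_le: "(x $ i)\<^sup>2 \<le> x \<bullet> (x :: real^'n::finite)"
proof -
  have "(x $ i)\<^sup>2 \<le> (\<Sum>j\<in>UNIV. (x $ j)\<^sup>2)" by (rule member_le_sum) auto
  then show ?thesis by (simp add: inner_vec_def power2_eq_square)
qed

text \<open>A function odd in x_i vanishes on the hyperplane x_i = 0. Integrate the gradient bound along the
segment from the projection of x onto that hyperplane to x; points of it are no farther from
the origin than x.\<close>

lemma odd_coord_bound:
  fixes v :: "real^'n::finite \<Rightarrow> 'b::euclidean_space"
  assumes v: "hardy_class \<alpha> L R v dv" and a: "\<alpha> \<ge> 0" and odd: "\<And>x. v (flip i x) = - v x"
  shows "(norm (v x))\<^sup>2 \<le> L * (x $ i)\<^sup>2 * (x \<bullet> x) powr \<alpha>"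
proof -
  define e where "e = (axis i 1 :: real^'n)"
  define y where "y = x - x $ i *\<^sub>R e"
  have yi: "y $ i = 0" by (simp add: y_def e_def axis_def)
  have L: "L \<ge> 0" using v by (rule hardy_class_L_nonneg)
  have fin: "finite {t. y + t *\<^sub>R e = 0}"
  proof (rule finite_subset)
    show "{t. y + t *\<^sub>R e = 0} \<subseteq> {0}"
      using yi by (auto simp: vec_eq_iff e_def axis_def)
  qed simp
  have "flip i y = y" using yi by (simp add: flip_def vec_eq_iff)
  with odd[of y] have "v y = - v y" by simp
  then have "v y + v y = 0" by (simp only: eq_neg_iff_add_eq_0)
  then have vy: "v y = 0" by (simp flip: scaleR_2)
  define B where "B = sqrt (L * (x \<bullet> x) powr \<alpha>)"
  have "norm (v (y + x $ i *\<^sub>R e) - v (y + 0 *\<^sub>R e)) \<le> B * \<bar>x $ i - 0\<bar>"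
  proof (rule lipschitz_off_finite[OF fin, where \<phi>' = "\<lambda>t. dv (y + t *\<^sub>R e) $ i"])
    show "B \<ge> 0" using L by (simp add: B_def)
    have "continuous_on UNIV v" using v by (simp add: hardy_class_def)
    then show "continuous_on UNIV (\<lambda>t. v (y + t *\<^sub>R e))"
      by (rule continuous_on_compose2) (auto intro!: continuous_intros)
    fix t assume t: "t \<in> {min 0 (x $ i)..max 0 (x $ i)} - {t. y + t *\<^sub>R e = 0}"
    have d: "((\<lambda>t. v (y + t *\<^sub>R e)) has_vector_derivative dv (y + t *\<^sub>R e) $ i) (at t)"
      unfolding e_def by (rule has_partials_line) (use v in \<open>simp add: hardy_class_def\<close>)
    have ye: "y \<bullet> e = 0" using yi by (simp add: e_def inner_axis)
    have ee: "e \<bullet> e = 1" by (simp add: e_def inner_axis)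
    have q: "(y + s *\<^sub>R e) \<bullet> (y + s *\<^sub>R e) = y \<bullet> y + s\<^sup>2" for s
      using ye ee by (simp add: inner_add_left inner_add_right inner_commute power2_eq_square)
    have "x \<bullet> x = y \<bullet> y + (x $ i)\<^sup>2" using q[of "x $ i"] by (simp add: y_def)
    moreover have "t\<^sup>2 \<le> (x $ i)\<^sup>2"
      using t by (intro abs_le_square_iff[THEN iffD1]) (auto simp: min_def max_def split: if_splits)
    ultimately have "(y + t *\<^sub>R e) \<bullet> (y + t *\<^sub>R e) \<le> x \<bullet> x" by (simp add: q)
    then have "((y + t *\<^sub>R e) \<bullet> (y + t *\<^sub>R e)) powr \<alpha> \<le> (x \<bullet> x) powr \<alpha>"
      using a by (intro powr_mono2) auto
    moreover have "(norm (dv (y + t *\<^sub>R e)))\<^sup>2 \<le> L * ((y + t *\<^sub>R e) \<bullet> (y + t *\<^sub>R e)) powr \<alpha>"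
      using v t by (simp add: hardy_class_def)
    ultimately have "(norm (dv (y + t *\<^sub>R e)))\<^sup>2 \<le> L * (x \<bullet> x) powr \<alpha>"
      using L by (meson mult_left_mono order.trans)
    then have "norm (dv (y + t *\<^sub>R e)) \<le> B"
      unfolding B_def by (rule real_le_rsqrt)
    moreover have "norm (dv (y + t *\<^sub>R e) $ i) \<le> norm (dv (y + t *\<^sub>R e))"
      by (rule Finite_Cartesian_Product.norm_nth_le)
    ultimately show "((\<lambda>t. v (y + t *\<^sub>R e)) has_vector_derivative dv (y + t *\<^sub>R e) $ i) (at t) \<and>
        norm (dv (y + t *\<^sub>R e) $ i) \<le> B" using d by simp
  qed
  then have "norm (v x) \<le> B * \<bar>x $ i\<bar>" by (simp add: vy) (simp add: y_def)
  then have "(norm (v x))\<^sup>2 \<le> (B * \<bar>x $ i\<bar>)\<^sup>2" by (rule power_mono) simp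
  also have "\<dots> = L * (x $ i)\<^sup>2 * (x \<bullet> x) powr \<alpha>"
    using L by (simp add: B_def power_mult_distrib)
  finally show ?thesis .
qed

lemma coord_hyperplane_null: "{x::real^'n::finite. x $ i = 0} \<in> null_sets lborel"
proof -
  have "negligible {x::real^'n. axis i 1 \<bullet> x = 0}"
    by (rule negligible_hyperplane) simp
  then have "{x::real^'n. x $ i = 0} \<in> null_sets lebesgue"
    by (simp add: negligible_iff_null_sets inner_axis')
  moreover have "closed {x::real^'n. x $ i = 0}"
    by (intro closed_Collect_eq continuous_intros)
  ultimately show ?thesis by (simp add: null_sets_completion_iff borel_closed)
qed

text \<open>This is the expansion of \<Sum>_j |A_j - c_j V|^2 \<ge> 0, where c = dh/h is the logarithmic gradient of
the ground state h = x_i |x|^(-s), that is, c_j = \<delta>_ij / x_i - s x_j / |x|^2.\<close>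

lemma ground_state_pointwise:
  fixes V :: "'b::real_inner" and A :: "'b^'n::finite" and x :: "real^'n"
  assumes "x $ i \<noteq> 0"
  shows "(norm A)\<^sup>2 - 2 * (V \<bullet> A $ i) / x $ i + 2 * s * (\<Sum>j\<in>UNIV. x $ j * (V \<bullet> A $ j)) / (x \<bullet> x)
          + (V \<bullet> V) * (1 / (x $ i)\<^sup>2 - 2 * s / (x \<bullet> x) + s\<^sup>2 / (x \<bullet> x)) \<ge> 0"
proof -
  define r where "r = x \<bullet> x"
  have "x \<noteq> 0" using assms by auto
  then have r: "r \<noteq> 0" by (simp add: r_def)
  define c where "c j = (if j = i then 1 / x $ i else 0) - s * x $ j / r" for j
  have "0 \<le> (\<Sum>j\<in>UNIV. (norm (A $ j - c j *\<^sub>R V))\<^sup>2)" by (intro sum_nonneg) auto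
  also have "\<dots> = (\<Sum>j\<in>UNIV. (norm (A $ j))\<^sup>2 - 2 * (c j * (V \<bullet> A $ j)) + (V \<bullet> V) * (c j)\<^sup>2)"
    unfolding power2_norm_eq_inner
    by (intro sum.cong) (auto simp: inner_diff_left inner_diff_right inner_commute power2_eq_square)
  also have "\<dots> = (norm A)\<^sup>2 - 2 * (\<Sum>j\<in>UNIV. c j * (V \<bullet> A $ j)) + (V \<bullet> V) * (\<Sum>j\<in>UNIV. (c j)\<^sup>2)"
    by (simp add: sum.distrib sum_subtractf sum_distrib_left norm_vec_power2)
  also have "(\<Sum>j\<in>UNIV. c j * (V \<bullet> A $ j)) = (V \<bullet> A $ i) / x $ i - s * (\<Sum>j\<in>UNIV. x $ j * (V \<bullet> A $ j)) / r"
  proof -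
    have "(\<Sum>j\<in>UNIV. c j * (V \<bullet> A $ j)) =
       (\<Sum>j\<in>UNIV. (if j = i then (V \<bullet> A $ i) / x $ i else 0) - s / r * (x $ j * (V \<bullet> A $ j)))"
      by (intro sum.cong) (auto simp: c_def algebra_simps)
    also have "\<dots> = (V \<bullet> A $ i) / x $ i - s / r * (\<Sum>j\<in>UNIV. x $ j * (V \<bullet> A $ j))"
      by (simp add: sum_subtractf sum_distrib_left)
    finally show ?thesis by simp
  qed
  also have "(\<Sum>j\<in>UNIV. (c j)\<^sup>2) = 1 / (x $ i)\<^sup>2 - 2 * s / r + s\<^sup>2 / r"
  proof -
    have "(\<Sum>j\<in>UNIV. (c j)\<^sup>2) =
       (\<Sum>j\<in>UNIV. (if j = i then 1 / (x $ i)\<^sup>2 - 2 * s / r else 0) + s\<^sup>2 / r\<^sup>2 * (x $ j * x $ j))"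
      using assms r by (intro sum.cong) (auto simp: c_def power2_eq_square field_simps)
    also have "\<dots> = 1 / (x $ i)\<^sup>2 - 2 * s / r + s\<^sup>2 / r\<^sup>2 * (x \<bullet> x)"
      by (simp add: sum.distrib sum_distrib_left inner_vec_def)
    finally show ?thesis using r by (simp add: r_def[symmetric] power2_eq_square)
  qed
  finally show ?thesis by (simp add: r_def algebra_simps)
qed

lemma inner_self_line_derivative:
  "((\<lambda>t. (x + t *\<^sub>R axis j 1) \<bullet> (x + t *\<^sub>R axis j 1)) has_real_derivative 2 * x $ j) (at 0)"
  for x :: "real^'n::finite"
proof -
  have "(x + t *\<^sub>R axis j 1) \<bullet> (x + t *\<^sub>R axis j 1) = x \<bullet> x + 2 * x $ j * t + t\<^sup>2" for t
    by (simp add: inner_add_left inner_add_right inner_axis inner_axis' power2_eq_square)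
       (simp add: axis_def algebra_simps)
  then show ?thesis by (auto intro!: derivative_eq_intros)
qed

lemma weight_line_derivative:
  fixes x :: "real^'n::finite"
  assumes "x \<noteq> 0"
  shows "((\<lambda>t. ((x + t *\<^sub>R axis j 1) \<bullet> (x + t *\<^sub>R axis j 1)) powr \<beta>)
           has_real_derivative 2 * \<beta> * x $ j * (x \<bullet> x) powr \<beta> / (x \<bullet> x)) (at 0)"
  by (rule DERIV_cong[OF DERIV_fun_powr[OF inner_self_line_derivative]])
     (use assms in \<open>auto simp: powr_diff\<close>)

lemma norm_square_line_derivative:
  fixes v :: "real^'n::finite \<Rightarrow> 'b::real_inner"
  assumes "has_partials v dv"
  shows "((\<lambda>t. v (x + t *\<^sub>R axis j 1) \<bullet> v (x + t *\<^sub>R axis j 1)) has_real_derivative 2 * (v x \<bullet> dv x $ j)) (at 0)"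
proof -
  have "((\<lambda>t. v (x + t *\<^sub>R axis j 1)) has_vector_derivative dv x $ j) (at 0)"
    using assms by (simp add: has_partials_def)
  then have d: "((\<lambda>t. v (x + t *\<^sub>R axis j 1)) has_derivative (\<lambda>h. h *\<^sub>R dv x $ j)) (at 0)"
    by (simp add: has_vector_derivative_def)
  show ?thesis unfolding has_field_derivative_def
    by (rule has_derivative_eq_rhs[OF has_derivative_inner[OF d d]])
       (auto simp: fun_eq_iff inner_commute)
qed

lemma abs_three_le:
  fixes a b c :: real
  assumes "\<bar>a\<bar> \<le> A" "\<bar>b\<bar> \<le> B" "\<bar>c\<bar> \<le> C"
  shows "\<bar>a - b - c\<bar> \<le> A + B + C" "\<bar>a + b - c\<bar> \<le> A + B + C"
  using assms by linarith+

text \<open>Write W = |x|^(-2\<alpha>) and f = |v|^2. The cross terms in \<open>ground_state_pointwise\<close>, multiplied by W,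
are, up to multiples of f W / |x|^2 and f W / x_i^2, partial derivatives of f W / x_i and of
f W x_j / |x|^2, and these have integral zero. The terms with 1/x_i^2 cancel, and there remains
the inequality with the constant s (d - 2\<alpha>) - s^2 + 2\<alpha>, which is largest for s = (d - 2\<alpha>)/2.\<close>

lemma half_space_hardy:
  fixes v :: "real^'n::finite \<Rightarrow> 'b::euclidean_space" and \<alpha> :: real
  defines "C \<equiv> ((real CARD('n) - 2 * \<alpha>) / 2)\<^sup>2 + 2 * \<alpha>"
  assumes v: "hardy_class \<alpha> L R v dv" and a: "\<alpha> \<ge> 0" and odd: "\<And>x. v (flip i x) = - v x"
  shows "integrable lborel (\<lambda>x. (norm (v x))\<^sup>2 * (x \<bullet> x) powr (-\<alpha>) / (x \<bullet> x))"
    and "integrable lborel (\<lambda>x. (norm (dv x))\<^sup>2 * (x \<bullet> x) powr (-\<alpha>))"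
    and "C * (LINT x|lborel. (norm (v x))\<^sup>2 * (x \<bullet> x) powr (-\<alpha>) / (x \<bullet> x))
          \<le> (LINT x|lborel. (norm (dv x))\<^sup>2 * (x \<bullet> x) powr (-\<alpha>))"
proof -
  define s where "s = (real CARD('n) - 2 * \<alpha>) / 2"
  define W where "W x = (x \<bullet> x) powr (-\<alpha>)" for x :: "real^'n"
  define f where "f x = v x \<bullet> v x" for x
  have cont_v: "continuous_on UNIV v" and [measurable]: "dv \<in> borel_measurable borel"
    and part: "has_partials v dv"
    and dvb: "\<And>x. x \<noteq> 0 \<Longrightarrow> (norm (dv x))\<^sup>2 \<le> L * (x \<bullet> x) powr \<alpha>"
    and supp: "\<And>x. norm x > R \<Longrightarrow> v x = 0"
    using v by (auto simp: hardy_class_def)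
  have L: "L \<ge> 0" using v by (rule hardy_class_L_nonneg)
  have [measurable]: "v \<in> borel_measurable borel" using cont_v by (rule borel_measurable_continuous_onI)
  have [measurable]: "W \<in> borel_measurable borel" unfolding W_def by measurable
  have [measurable]: "f \<in> borel_measurable borel" unfolding f_def by measurable
  have [measurable]: "(\<lambda>x. dv x $ j) \<in> borel_measurable borel" for j
  proof -
    have "(\<lambda>y::'b^'n. y $ j) \<in> borel_measurable borel"
      by (intro borel_measurable_continuous_onI continuous_intros)
    from measurable_compose[OF _ this, of dv borel] show ?thesis by simp
  qed
  have [measurable]: "(\<lambda>x::real^'n. x $ j) \<in> borel_measurable borel" for j
    by (intro borel_measurable_continuous_onI continuous_intros)
  have W0: "W x \<ge> 0" for x by (simp add: W_def)
  have Wa: "W x * (x \<bullet> x) powr \<alpha> = 1" if "x \<noteq> 0" for x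
    using that by (simp add: W_def powr_minus)
  have fb: "f x * W x \<le> L * (x $ i)\<^sup>2" for x
  proof (cases "x = 0")
    case False
    have "f x \<le> L * (x $ i)\<^sup>2 * (x \<bullet> x) powr \<alpha>"
      using odd_coord_bound[OF v a odd, of x] by (simp add: f_def power2_norm_eq_inner)
    then have "f x * W x \<le> L * (x $ i)\<^sup>2 * (x \<bullet> x) powr \<alpha> * W x"
      by (rule mult_right_mono) (simp add: W0)
    also have "\<dots> = L * (x $ i)\<^sup>2 * (W x * (x \<bullet> x) powr \<alpha>)" by simp
    finally show ?thesis unfolding Wa[OF False] by simp
  qed (simp add: W_def)
  have f0: "f x \<ge> 0" for x by (simp add: f_def)
  have fb2: "f x * W x \<le> L * (x \<bullet> x)" for x
    using fb[of x] mult_left_mono[OF coord_square_le[of x i] L] by linarith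
  have db: "(norm (dv x))\<^sup>2 * W x \<le> L" if "x \<noteq> 0" for x
  proof -
    have "(norm (dv x))\<^sup>2 * W x \<le> L * (x \<bullet> x) powr \<alpha> * W x"
      using dvb[OF that] by (rule mult_right_mono) (simp add: W0)
    also have "\<dots> = L * (W x * (x \<bullet> x) powr \<alpha>)" by simp
    finally show ?thesis unfolding Wa[OF that] by simp
  qed
  have vdv: "\<bar>v x \<bullet> dv x $ j\<bar> * W x \<le> L * b" if x: "x \<noteq> 0" and b: "f x * W x \<le> L * b\<^sup>2" "b \<ge> 0" for x j b
  proof -
    have "(\<bar>v x \<bullet> dv x $ j\<bar> * W x)\<^sup>2 \<le> (norm (v x) * norm (dv x) * W x)\<^sup>2"
    proof (rule power_mono)
      have "\<bar>v x \<bullet> dv x $ j\<bar> \<le> norm (v x) * norm (dv x)"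
        using Cauchy_Schwarz_ineq2[of "v x" "dv x $ j"] Finite_Cartesian_Product.norm_nth_le[of "dv x" j]
        by (meson mult_left_mono norm_ge_zero order.trans)
      then show "\<bar>v x \<bullet> dv x $ j\<bar> * W x \<le> norm (v x) * norm (dv x) * W x"
        by (rule mult_right_mono) (simp add: W0)
    qed (simp add: W0)
    also have "\<dots> = (f x * W x) * ((norm (dv x))\<^sup>2 * W x)"
      by (simp add: f_def power2_norm_eq_inner power_mult_distrib power2_eq_square[of "W x"])
    also have "\<dots> \<le> (L * b\<^sup>2) * L"
      by (rule mult_mono[OF b(1) db[OF x]]) (use L W0 f0 in auto)
    also have "\<dots> = (L * b)\<^sup>2" by (simp add: power2_eq_square)
    finally show ?thesis by (rule power2_le_imp_le) (use L b(2) in simp)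
  qed
  have deriv_f: "((\<lambda>t. f (x + t *\<^sub>R axis j 1)) has_real_derivative 2 * (v x \<bullet> dv x $ j)) (at 0)" for x j
    unfolding f_def by (rule norm_square_line_derivative[OF part])
  have deriv_W: "((\<lambda>t. W (x + t *\<^sub>R axis j 1)) has_real_derivative - 2 * \<alpha> * x $ j * W x / (x \<bullet> x)) (at 0)"
    if "x \<noteq> 0" for x j
    unfolding W_def by (rule DERIV_cong[OF weight_line_derivative[OF that]]) simp
  have cont_f: "continuous_on UNIV f" unfolding f_def by (intro continuous_intros cont_v)
  have cont_W: "isCont W x" if "x \<noteq> 0" for x
    unfolding W_def using that by (intro continuous_intros) auto
  have isf: "isCont f x" for x using cont_f by (simp add: continuous_on_eq_continuous_at)
  have isc: "isCont (\<lambda>x::real^'n. x $ j) x" for x j by (intro continuous_intros)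

  \<comment> \<open>On x_i = 0 the quotient G1 is 0 by convention, which is its continuous extension since f W \<le> L x_i^2.\<close>
  define G1 where "G1 x = f x * W x / x $ i" for x
  define G1' where "G1' x = 2 * (v x \<bullet> dv x $ i) * W x / x $ i - 2 * \<alpha> * f x * W x / (x \<bullet> x)
      - f x * W x / (x $ i)\<^sup>2" for x
  define G2 where "G2 j x = f x * W x * x $ j / (x \<bullet> x)" for j x
  define G2' where "G2' j x = 2 * (v x \<bullet> dv x $ j) * x $ j * W x / (x \<bullet> x) + f x * W x / (x \<bullet> x)
      - (2 * \<alpha> + 2) * f x * (x $ j)\<^sup>2 * W x / (x \<bullet> x)\<^sup>2" for j x

  have IBP1: "integrable lborel G1' \<and> (LINT x|lborel. G1' x) = 0"
  proof (rule integral_partial_derivative_eq_0[where E = "{x::real^'n. x $ i = 0}" and j = i and G = G1])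
    have "\<bar>G1 x\<bar> \<le> L * \<bar>x $ i\<bar>" for x
    proof (cases "x $ i = 0")
      case False
      have "\<bar>G1 x\<bar> = f x * W x / \<bar>x $ i\<bar>" using f0 W0 by (simp add: G1_def abs_mult)
      also have "\<dots> \<le> L * (x $ i)\<^sup>2 / \<bar>x $ i\<bar>" using fb by (rule divide_right_mono) simp
      also have "\<dots> = L * \<bar>x $ i\<bar>" using False by (simp add: power2_eq_square field_simps)
      finally show ?thesis .
    qed (simp add: G1_def)
    note G1b = this
    have "isCont G1 x" for x
    proof (cases "x $ i = 0")
      case True
      have "((\<lambda>y. L * \<bar>y $ i\<bar>) \<longlongrightarrow> L * \<bar>x $ i\<bar>) (at x)" by (intro tendsto_intros)
      then have "(G1 \<longlongrightarrow> 0) (at x)"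
        using G1b True by (intro Lim_null_comparison[of G1 "\<lambda>y. L * \<bar>y $ i\<bar>"]) auto
      then show ?thesis using True by (simp add: isCont_def G1_def)
    next
      case False
      then have "x \<noteq> 0" by auto
      then show ?thesis unfolding G1_def using False
        by (intro continuous_intros isf cont_W isc) auto
    qed
    then show "continuous_on UNIV G1" by (simp add: continuous_at_imp_continuous_on)
    show "G1' \<in> borel_measurable borel" unfolding G1'_def by measurable
    show "G1 x = 0" if "norm x > R" for x using supp[OF that] by (simp add: G1_def f_def)
    show "{x::real^'n. x $ i = 0} \<in> null_sets lborel" by (rule coord_hyperplane_null)
    show "finite {t. x + t *\<^sub>R axis i 1 \<in> {x::real^'n. x $ i = 0}}" for x :: "real^'n"
      by (rule finite_subset[of _ "{- x $ i}"]) (auto simp: axis_def)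
    fix x :: "real^'n" assume "x \<notin> {x. x $ i = 0}"
    then have xi: "x $ i \<noteq> 0" and x0: "x \<noteq> 0" by auto
    then have r: "x \<bullet> x > 0" by simp
    have "\<bar>v x \<bullet> dv x $ i\<bar> * W x \<le> L * \<bar>x $ i\<bar>" using fb[of x] by (intro vdv[OF x0]) auto
    then have "\<bar>2 * (v x \<bullet> dv x $ i) * W x / x $ i\<bar> \<le> 2 * L"
      using xi W0 by (simp add: abs_mult field_simps)
    moreover have "\<bar>2 * \<alpha> * f x * W x / (x \<bullet> x)\<bar> \<le> 2 * \<alpha> * L"
    proof -
      have "2 * \<alpha> * (f x * W x / (x \<bullet> x)) \<le> 2 * \<alpha> * L"
        using fb2[of x] r a by (intro mult_left_mono) (auto simp: field_simps)
      then show ?thesis using a f0[of x] W0[of x] r by (simp add: abs_mult)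
    qed
    moreover have "\<bar>f x * W x / (x $ i)\<^sup>2\<bar> \<le> L"
      using fb[of x] f0[of x] W0[of x] xi by (simp add: abs_mult field_simps)
    ultimately show "\<bar>G1' x\<bar> \<le> 2 * L + 2 * \<alpha> * L + L" unfolding G1'_def by (rule abs_three_le)
    have d: "((\<lambda>t. (x + t *\<^sub>R axis i 1) $ i) has_real_derivative 1) (at 0)"
      by (auto simp: axis_def intro!: derivative_eq_intros)
    show "((\<lambda>t. G1 (x + t *\<^sub>R axis i 1)) has_real_derivative G1' x) (at 0)"
      unfolding G1_def
      by (rule DERIV_cong[OF DERIV_divide[OF DERIV_mult[OF deriv_f deriv_W[OF x0]] d]])
         (use xi r in \<open>simp_all add: G1'_def field_simps power2_eq_square\<close>)
  qed
  \<comment> \<open>For G2 the only singular point is the origin, where it extends continuously by 0.\<close>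
  have IBP2: "integrable lborel (G2' j) \<and> (LINT x|lborel. G2' j x) = 0" for j
  proof (rule integral_partial_derivative_eq_0[where E = "{0}" and j = j and G = "G2 j"])
    have G2b: "\<bar>G2 j x\<bar> \<le> L * norm x" for x
    proof (cases "x = 0")
      case False
      then have r: "x \<bullet> x > 0" by simp
      have "\<bar>G2 j x\<bar> = (f x * W x) * \<bar>x $ j\<bar> / (x \<bullet> x)" using f0[of x] W0[of x] r by (simp add: G2_def abs_mult)
      also have "\<dots> \<le> (L * (x \<bullet> x)) * norm x / (x \<bullet> x)"
      proof (rule divide_right_mono)
        show "(f x * W x) * \<bar>x $ j\<bar> \<le> (L * (x \<bullet> x)) * norm x"
          using Finite_Cartesian_Product.norm_nth_le[of x j] L by (intro mult_mono[OF fb2]) auto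
      qed simp
      also have "\<dots> = L * norm x" using r by simp
      finally show ?thesis .
    qed (simp add: G2_def)
    have "isCont (G2 j) x" for x
    proof (cases "x = 0")
      case True
      have "((\<lambda>y. L * norm y) \<longlongrightarrow> L * norm x) (at x)" by (intro tendsto_intros)
      then have "(G2 j \<longlongrightarrow> 0) (at x)"
        using G2b True by (intro Lim_null_comparison[of "G2 j" "\<lambda>y. L * norm y"]) auto
      then show ?thesis using True by (simp add: isCont_def G2_def)
    next
      case False
      then show ?thesis unfolding G2_def
        by (intro continuous_intros isf cont_W isc) auto
    qed
    then show "continuous_on UNIV (G2 j)" by (simp add: continuous_at_imp_continuous_on)
    show "G2' j \<in> borel_measurable borel" unfolding G2'_def by measurable
    show "G2 j x = 0" if "norm x > R" for x using supp[OF that] by (simp add: G2_def f_def)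
    show "{0} \<in> null_sets (lborel :: (real^'n) measure)" by (rule finite_imp_null_set_lborel) simp
    show "finite {t. x + t *\<^sub>R axis j 1 \<in> {0}}" for x :: "real^'n"
      by (rule finite_subset[of _ "{- x $ j}"]) (auto simp: axis_def vec_eq_iff)
    fix x :: "real^'n" assume "x \<notin> {0}"
    then have x0: "x \<noteq> 0" by auto
    then have r: "x \<bullet> x > 0" by simp
    have xj: "\<bar>x $ j\<bar> \<le> norm x" using Finite_Cartesian_Product.norm_nth_le[of x j] by simp
    have nn: "norm x * norm x = x \<bullet> x" by (simp add: dot_square_norm power2_eq_square)
    have "\<bar>v x \<bullet> dv x $ j\<bar> * W x \<le> L * norm x"
      using fb2[of x] by (intro vdv[OF x0]) (auto simp: dot_square_norm)
    then have "\<bar>v x \<bullet> dv x $ j\<bar> * W x * \<bar>x $ j\<bar> \<le> L * norm x * norm x"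
      by (rule mult_mono) (use xj L in auto)
    then have "\<bar>2 * (v x \<bullet> dv x $ j) * x $ j * W x / (x \<bullet> x)\<bar> \<le> 2 * L"
      using r W0[of x] nn by (simp add: abs_mult field_simps)
    moreover have f1: "\<bar>f x * W x / (x \<bullet> x)\<bar> \<le> L"
      using fb2[of x] f0[of x] W0[of x] r by (simp add: abs_mult field_simps)
    moreover have "\<bar>(2 * \<alpha> + 2) * f x * (x $ j)\<^sup>2 * W x / (x \<bullet> x)\<^sup>2\<bar> \<le> (2 * \<alpha> + 2) * L"
    proof -
      have "\<bar>(2 * \<alpha> + 2) * f x * (x $ j)\<^sup>2 * W x / (x \<bullet> x)\<^sup>2\<bar>
          = (2 * \<alpha> + 2) * (\<bar>f x * W x / (x \<bullet> x)\<bar> * ((x $ j)\<^sup>2 / (x \<bullet> x)))"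
        using r a f0[of x] W0[of x] by (simp add: abs_mult power2_eq_square field_simps)
      also have "\<dots> \<le> (2 * \<alpha> + 2) * (L * 1)"
        using f1 L a r coord_square_le[of x j] by (intro mult_left_mono mult_mono) auto
      finally show ?thesis by simp
    qed
    ultimately show "\<bar>G2' j x\<bar> \<le> 2 * L + L + (2 * \<alpha> + 2) * L" unfolding G2'_def by (rule abs_three_le)
    have d: "((\<lambda>t. (x + t *\<^sub>R axis j 1) $ j) has_real_derivative 1) (at 0)"
      by (auto simp: axis_def intro!: derivative_eq_intros)
    show "((\<lambda>t. G2 j (x + t *\<^sub>R axis j 1)) has_real_derivative G2' j x) (at 0)"
      unfolding G2_def
      by (rule DERIV_cong[OF DERIV_divide[OF DERIV_mult[OF DERIV_mult[OF deriv_f deriv_W[OF x0]] d]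
            inner_self_line_derivative]])
         (use r in \<open>simp_all add: G2'_def field_simps power2_eq_square\<close>)
  qed
  let ?F = "\<lambda>x. (norm (v x))\<^sup>2 * (x \<bullet> x) powr (-\<alpha>) / (x \<bullet> x)"
  let ?E = "\<lambda>x. (norm (dv x))\<^sup>2 * (x \<bullet> x) powr (-\<alpha>)"
  have dom: "integrable lborel (\<lambda>x::real^'n. L * indicator (cball 0 R) x)"
    using emeasure_bounded_finite[OF bounded_cball, of "0::real^'n" R]
    by (intro integrable_mult_right integrable_real_indicator) (auto simp: infinity_ennreal_def)
  show iF: "integrable lborel ?F"
  proof (rule Bochner_Integration.integrable_bound[OF dom])
    have "norm (?F x) \<le> norm (L * indicator (cball 0 R) x)" for x
    proof (cases "norm x > R \<or> x = 0")
      case False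
      then have "x \<bullet> x > 0" "norm x \<le> R" by auto
      then show ?thesis using fb2[of x] L
        by (simp add: W_def[symmetric] f_def power2_norm_eq_inner field_simps abs_mult W0)
    qed (use supp in auto)
    then show "AE x in lborel. norm (?F x) \<le> norm (L * indicator (cball 0 R) x)" by simp
  qed measurable
  show iE: "integrable lborel ?E"
  proof (rule Bochner_Integration.integrable_bound[OF dom])
    have "norm (?E x) \<le> norm (L * indicator (cball 0 R) x)" for x
    proof (cases "norm x > R \<or> x = 0")
      case False
      then show ?thesis using db[of x] L
        by (simp add: W_def[symmetric] abs_mult W0)
    qed (use hardy_class_zero_derivative[OF v] in auto)
    then show "AE x in lborel. norm (?E x) \<le> norm (L * indicator (cball 0 R) x)" by simp
  qed measurable
  have CC: "C = s\<^sup>2 + 2 * \<alpha>" by (simp add: C_def s_def)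
  have d2s: "real CARD('n) = 2 * s + 2 * \<alpha>" by (simp add: s_def field_simps)
  \<comment> \<open>The ground state inequality, rewritten with the two exact derivatives.\<close>
  have pw: "G1' x - s * (\<Sum>j\<in>UNIV. G2' j x) + C * ?F x \<le> ?E x" if xi: "x $ i \<noteq> 0" for x
  proof -
    define r where "r = x \<bullet> x"
    have "x \<noteq> 0" using xi by auto
    then have r: "r > 0" by (simp add: r_def)
    define S where "S = (\<Sum>j\<in>UNIV. x $ j * (v x \<bullet> dv x $ j))"
    have "(\<Sum>j\<in>UNIV. G2' j x) = (\<Sum>j\<in>UNIV. 2 * W x / r * (x $ j * (v x \<bullet> dv x $ j)) + f x * W x / r
          - (2 * \<alpha> + 2) * f x * W x / r\<^sup>2 * (x $ j * x $ j))"
      by (intro sum.cong) (auto simp: G2'_def r_def[symmetric] power2_eq_square mult_ac)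
    also have "\<dots> = 2 * W x / r * S + real CARD('n) * (f x * W x / r) - (2 * \<alpha> + 2) * f x * W x / r\<^sup>2 * r"
      unfolding sum.distrib sum_subtractf sum_distrib_left[symmetric] S_def r_def inner_vec_def by simp
    also have "\<dots> = 2 * W x * S / r + (2 * s - 2) * (f x * W x / r)"
      using r unfolding d2s by (simp add: field_simps power2_eq_square)
    finally have S2: "(\<Sum>j\<in>UNIV. G2' j x) = 2 * W x * S / r + (2 * s - 2) * (f x * W x / r)" .
    have "0 \<le> W x * ((norm (dv x))\<^sup>2 - 2 * (v x \<bullet> dv x $ i) / x $ i + 2 * s * S / r
          + f x * (1 / (x $ i)\<^sup>2 - 2 * s / r + s\<^sup>2 / r))"
      using ground_state_pointwise[OF xi, of "dv x" "v x" s]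
      by (intro mult_nonneg_nonneg[OF W0]) (simp add: f_def r_def S_def)
    also have "\<dots> = ?E x - (G1' x - s * (\<Sum>j\<in>UNIV. G2' j x) + C * ?F x)"
    proof -
      have E: "?E x = (norm (dv x))\<^sup>2 * W x" and F: "?F x = f x * W x / r"
        by (simp_all add: W_def f_def r_def power2_norm_eq_inner)
      show ?thesis unfolding E F S2 CC G1'_def unfolding r_def[symmetric]
        by (simp add: divide_inverse algebra_simps power2_eq_square)
    qed
    finally show ?thesis by simp
  qed
  have i1: "integrable lborel G1'" and z1: "(LINT x|lborel. G1' x) = 0" using IBP1 by auto
  have i2: "integrable lborel (G2' j)" and z2: "(LINT x|lborel. G2' j x) = 0" for j using IBP2 by auto
  have iS: "integrable lborel (\<lambda>x. \<Sum>j\<in>UNIV. G2' j x)" by (intro Bochner_Integration.integrable_sum i2)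
  have "(LINT x|lborel. G1' x - s * (\<Sum>j\<in>UNIV. G2' j x) + C * ?F x) \<le> (LINT x|lborel. ?E x)"
  proof (rule integral_mono_AE[OF _ iE])
    show "integrable lborel (\<lambda>x. G1' x - s * (\<Sum>j\<in>UNIV. G2' j x) + C * ?F x)"
      by (intro Bochner_Integration.integrable_add Bochner_Integration.integrable_diff integrable_mult_right i1 iS iF)
    show "AE x in lborel. G1' x - s * (\<Sum>j\<in>UNIV. G2' j x) + C * ?F x \<le> ?E x"
      by (rule AE_I'[OF coord_hyperplane_null[of i]]) (use pw in auto)
  qed
  also have "(LINT x|lborel. G1' x - s * (\<Sum>j\<in>UNIV. G2' j x) + C * ?F x)
      = (LINT x|lborel. G1' x) - s * (\<Sum>j\<in>UNIV. LINT x|lborel. G2' j x) + C * (LINT x|lborel. ?F x)"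
    by (simp add: Bochner_Integration.integral_add Bochner_Integration.integral_diff integrable_mult_right i1 iS iF i2
        Bochner_Integration.integral_sum del: integral_divide_zero times_divide_eq_right)
  finally show "C * (LINT x|lborel. ?F x) \<le> (LINT x|lborel. ?E x)" by (simp add: z1 z2)
qed

section \<open>The weighted Hardy inequality for odd functions\<close>

text \<open>Integrability is part of the claim since otherwise the integrals could be zero by default.\<close>

definition hardy_ineq :: "real \<Rightarrow> (real^'n::finite \<Rightarrow> 'b::euclidean_space) \<Rightarrow> (real^'n \<Rightarrow> 'b^'n) \<Rightarrow> bool" where
  "hardy_ineq \<alpha> v dv \<longleftrightarrow>
     integrable lborel (\<lambda>x. (norm (v x))\<^sup>2 * (x \<bullet> x) powr (-\<alpha>) / (x \<bullet> x)) \<and>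
     integrable lborel (\<lambda>x. (norm (dv x))\<^sup>2 * (x \<bullet> x) powr (-\<alpha>)) \<and>
     (((real CARD('n) - 2 * \<alpha>) / 2)\<^sup>2 + 2 * \<alpha>) *
         (LINT x|lborel. (norm (v x))\<^sup>2 * (x \<bullet> x) powr (-\<alpha>) / (x \<bullet> x))
       \<le> (LINT x|lborel. (norm (dv x))\<^sup>2 * (x \<bullet> x) powr (-\<alpha>))"

lemma flip_line: "flip i (x + t *\<^sub>R axis j 1) = flip i x + (if j = i then - t else t) *\<^sub>R axis j 1"
  for x :: "real^'n::finite"
  by (simp add: flip_def vec_eq_iff axis_def)

lemma hardy_class_flip:
  assumes "hardy_class \<alpha> L R v dv"
  shows "hardy_class \<alpha> L R (\<lambda>x. v (flip i x)) (\<lambda>x. flip i (dv (flip i x)))"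
proof -
  have [measurable]: "dv \<in> borel_measurable borel" using assms by (simp add: hardy_class_def)
  have "continuous_on UNIV (\<lambda>x. v (flip i x))"
    using assms by (intro continuous_on_compose2[OF _ flip_continuous]) (auto simp: hardy_class_def)
  moreover have "(\<lambda>x. flip i (dv (flip i x))) \<in> borel_measurable borel" by measurable
  moreover have "has_partials (\<lambda>x. v (flip i x)) (\<lambda>x. flip i (dv (flip i x)))"
    unfolding has_partials_def
  proof (intro allI)
    fix x j
    define c :: real where "c = (if j = i then -1 else 1)"
    have "((\<lambda>t. v (flip i x + t *\<^sub>R axis j 1)) has_vector_derivative dv (flip i x) $ j) (at (c * 0))"
      using assms by (simp add: hardy_class_def has_partials_def)
    moreover have "((\<lambda>t. c * t) has_vector_derivative c) (at 0)"
      by (auto intro!: derivative_eq_intros simp: has_real_derivative_iff_has_vector_derivative[symmetric])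
    ultimately have "((\<lambda>t. v (flip i x + t *\<^sub>R axis j 1)) \<circ> (\<lambda>t. c * t) has_vector_derivative
         c *\<^sub>R (dv (flip i x) $ j)) (at 0)"
      by (intro vector_diff_chain_at) auto
    moreover have "(\<lambda>t. v (flip i x + t *\<^sub>R axis j 1)) \<circ> (\<lambda>t. c * t) = (\<lambda>t. v (flip i (x + t *\<^sub>R axis j 1)))"
      by (auto simp: flip_line c_def fun_eq_iff)
    moreover have "c *\<^sub>R (dv (flip i x) $ j) = flip i (dv (flip i x)) $ j"
      by (simp add: c_def flip_def)
    ultimately show "((\<lambda>t. v (flip i (x + t *\<^sub>R axis j 1))) has_vector_derivative
        flip i (dv (flip i x)) $ j) (at 0)" by simp
  qed
  moreover have "(norm (flip i (dv (flip i x))))\<^sup>2 \<le> L * (x \<bullet> x) powr \<alpha>" if "x \<noteq> 0" for x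
  proof -
    have "flip i x \<noteq> 0" using that norm_flip[of i x] by (metis norm_eq_zero)
    then have "(norm (dv (flip i x)))\<^sup>2 \<le> L * (flip i x \<bullet> flip i x) powr \<alpha>"
      using assms unfolding hardy_class_def by blast
    then show ?thesis by simp
  qed
  ultimately show ?thesis using assms by (simp add: hardy_class_def)
qed

lemma norm_half_combination_le:
  fixes a b :: "'a::real_inner"
  assumes "\<bar>c\<bar> = 1" "(norm a)\<^sup>2 \<le> B" "(norm b)\<^sup>2 \<le> B"
  shows "(norm ((1/2) *\<^sub>R (a + c *\<^sub>R b)))\<^sup>2 \<le> B"
proof -
  have "(norm (a + c *\<^sub>R b))\<^sup>2 \<le> (norm a + norm b)\<^sup>2"
    using norm_triangle_ineq[of a "c *\<^sub>R b"] assms(1) by (intro power_mono) auto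
  also have "\<dots> \<le> 2 * (norm a)\<^sup>2 + 2 * (norm b)\<^sup>2"
    using zero_le_power2[of "norm a - norm b"] unfolding power2_sum power2_diff by linarith
  finally have "(norm (a + c *\<^sub>R b))\<^sup>2 \<le> 4 * B" using assms(2,3) by linarith
  moreover have "norm ((1/2) *\<^sub>R (a + c *\<^sub>R b)) = norm (a + c *\<^sub>R b) / 2"
    by simp
  ultimately show ?thesis by (simp add: power_divide)
qed

lemma hardy_class_combine:
  assumes 1: "hardy_class \<alpha> L R v dv" and 2: "hardy_class \<alpha> L R w dw" and c: "\<bar>c\<bar> = 1"
  shows "hardy_class \<alpha> L R (\<lambda>x. (1/2) *\<^sub>R (v x + c *\<^sub>R w x)) (\<lambda>x. (1/2) *\<^sub>R (dv x + c *\<^sub>R dw x))"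
proof -
  have [measurable]: "dv \<in> borel_measurable borel" "dw \<in> borel_measurable borel"
    using 1 2 by (auto simp: hardy_class_def)
  have "has_partials (\<lambda>x. (1/2) *\<^sub>R (v x + c *\<^sub>R w x)) (\<lambda>x. (1/2) *\<^sub>R (dv x + c *\<^sub>R dw x))"
    using 1 2 unfolding hardy_class_def has_partials_def
    by (auto intro!: derivative_eq_intros)
  moreover have "(norm ((1/2) *\<^sub>R (dv x + c *\<^sub>R dw x)))\<^sup>2 \<le> L * (x \<bullet> x) powr \<alpha>" if "x \<noteq> 0" for x
    using 1 2 that by (intro norm_half_combination_le[OF c]) (auto simp: hardy_class_def)
  moreover have "continuous_on UNIV (\<lambda>x. (1/2) *\<^sub>R (v x + c *\<^sub>R w x))"
    using 1 2 by (auto simp: hardy_class_def intro!: continuous_intros)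
  ultimately show ?thesis using 1 2 by (simp add: hardy_class_def)
qed

lemma integral_flip:
  fixes f :: "real^'n::finite \<Rightarrow> real"
  assumes [measurable]: "f \<in> borel_measurable borel"
  shows "(LINT x|lborel. f (flip i x)) = (LINT x|lborel. f x)"
    and "integrable lborel (\<lambda>x. f (flip i x)) \<longleftrightarrow> integrable lborel f"
proof -
  show "(LINT x|lborel. f (flip i x)) = (LINT x|lborel. f x)"
    by (subst (2) lborel_distr_flip[of i, symmetric], subst integral_distr) auto
  show "integrable lborel (\<lambda>x. f (flip i x)) \<longleftrightarrow> integrable lborel f"
    by (subst (2) lborel_distr_flip[of i, symmetric], subst integrable_distr_eq) auto
qed

text \<open>Parallelogram law: the squares of the two halves add up to the average of |h(x)|^2 and
|h(flip i x)|^2. It is used with k the reflected function (for v) and with k the reflected gradient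
(for dv), hence only the norm of k is prescribed.\<close>

lemma parity_split_integral:
  fixes h :: "real^'n::finite \<Rightarrow> 'c::euclidean_space" and w :: "real^'n \<Rightarrow> real"
  assumes [measurable]: "h \<in> borel_measurable borel" "w \<in> borel_measurable borel"
    "k \<in> borel_measurable borel"
    and w: "\<And>x. w (flip i x) = w x" "\<And>x. w x \<ge> 0"
    and k: "\<And>x. norm (k x) = norm (h (flip i x))"
    and ip: "integrable lborel (\<lambda>x. (norm ((1/2) *\<^sub>R (h x + 1 *\<^sub>R k x)))\<^sup>2 * w x)"
    and im: "integrable lborel (\<lambda>x. (norm ((1/2) *\<^sub>R (h x + (-1) *\<^sub>R k x)))\<^sup>2 * w x)"
  shows "integrable lborel (\<lambda>x. (norm (h x))\<^sup>2 * w x)"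
    and "(LINT x|lborel. (norm (h x))\<^sup>2 * w x) =
         (LINT x|lborel. (norm ((1/2) *\<^sub>R (h x + 1 *\<^sub>R k x)))\<^sup>2 * w x) +
         (LINT x|lborel. (norm ((1/2) *\<^sub>R (h x + (-1) *\<^sub>R k x)))\<^sup>2 * w x)"
proof -
  define H where "H x = (norm (h x))\<^sup>2 * w x" for x
  have [measurable]: "H \<in> borel_measurable borel" unfolding H_def by measurable
  have pl: "(norm ((1/2) *\<^sub>R (h x + 1 *\<^sub>R k x)))\<^sup>2 * w x + (norm ((1/2) *\<^sub>R (h x + (-1) *\<^sub>R k x)))\<^sup>2 * w x
      = (H x + H (flip i x)) / 2" for x
  proof -
    have "(norm ((1/2) *\<^sub>R (h x + 1 *\<^sub>R k x)))\<^sup>2 + (norm ((1/2) *\<^sub>R (h x + (-1) *\<^sub>R k x)))\<^sup>2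
        = ((norm (h x))\<^sup>2 + (norm (k x))\<^sup>2) / 2"
      unfolding power2_norm_eq_inner
      by (simp add: inner_add_left inner_add_right inner_diff_left inner_diff_right inner_commute field_simps)
    then show ?thesis unfolding H_def w(1) k[symmetric]
      by (metis (no_types, lifting) distrib_right times_divide_eq_left)
  qed
  have iS: "integrable lborel (\<lambda>x. (H x + H (flip i x)) / 2)"
    using Bochner_Integration.integrable_add[OF ip im] unfolding pl .
  have iH: "integrable lborel H"
  proof (rule Bochner_Integration.integrable_bound[OF integrable_mult_right[OF iS, of 2]])
    show "AE x in lborel. norm (H x) \<le> norm (2 * ((H x + H (flip i x)) / 2))"
      using w by (simp add: H_def)
  qed measurable
  then show "integrable lborel (\<lambda>x. (norm (h x))\<^sup>2 * w x)" by (simp add: H_def[abs_def])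
  have "integrable lborel (\<lambda>x. H (flip i x))" using iH by (simp add: integral_flip)
  with iH have "(LINT x|lborel. (H x + H (flip i x)) / 2) = (LINT x|lborel. H x)"
    by (simp add: integral_flip)
  then show "(LINT x|lborel. (norm (h x))\<^sup>2 * w x) =
         (LINT x|lborel. (norm ((1/2) *\<^sub>R (h x + 1 *\<^sub>R k x)))\<^sup>2 * w x) +
         (LINT x|lborel. (norm ((1/2) *\<^sub>R (h x + (-1) *\<^sub>R k x)))\<^sup>2 * w x)"
    using Bochner_Integration.integral_add[OF ip im] unfolding pl by (simp add: H_def)
qed

text \<open>The antipodal map is the composition of all coordinate reflections.\<close>

lemma even_in_all_coordinates_minus:
  fixes v :: "real^'n::finite \<Rightarrow> 'b"
  assumes "\<And>k x. v (flip k x) = v x"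
  shows "v (- x) = v x"
proof -
  have "v (\<chi> j. if j \<in> F then - x $ j else x $ j) = v x" if "finite F" for F
    using that
  proof (induction F)
    case (insert k F)
    have "(\<chi> j. if j \<in> insert k F then - x $ j else x $ j) = flip k (\<chi> j. if j \<in> F then - x $ j else x $ j)"
      using insert by (auto simp: flip_def vec_eq_iff)
    then show ?case using insert assms by simp
  qed simp
  from this[of UNIV] have "v (\<chi> j. - x $ j) = v x" by simp
  moreover have "(\<chi> j. - x $ j) = - x" by (simp add: vec_eq_iff)
  ultimately show ?thesis by simp
qed

text \<open>Induction on the set S of coordinates with respect to which v has not yet been made even. Each step
splits off the part of v that is odd in one coordinate i and leaves a part even in i, to which
the induction hypothesis applies.\<close>

lemma odd_weighted_hardy_induct:
  fixes v :: "real^'n::finite \<Rightarrow> 'b::euclidean_space"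
  assumes "finite S" "\<alpha> \<ge> 0"
  shows "hardy_class \<alpha> L R v dv \<Longrightarrow> (\<And>x. v (- x) = - v x) \<Longrightarrow> (\<And>k x. k \<notin> S \<Longrightarrow> v (flip k x) = v x)
     \<Longrightarrow> hardy_ineq \<alpha> v dv"
  using assms(1)
proof (induction S arbitrary: v dv)
  case empty
  have v0: "v x = 0" for x
  proof -
    have "v x = - v x" using even_in_all_coordinates_minus[of v x] empty by simp
    then have "v x + v x = 0" by (simp only: eq_neg_iff_add_eq_0)
    then show ?thesis by (simp flip: scaleR_2)
  qed
  \<comment> \<open>With R = -1 every point is outside the support, so the gradient vanishes too.\<close>
  then have "hardy_class \<alpha> L (-1) v dv" using empty(1) unfolding hardy_class_def by blast
  then have "dv x = 0" for x
    by (rule hardy_class_zero_derivative) (use norm_ge_zero[of x] in linarith)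
  with v0 show ?case by (simp add: hardy_ineq_def)
next
  case (insert i S)
  note v = insert.prems(1)
  define k where "k x = v (flip i x)" for x
  define dk where "dk x = flip i (dv (flip i x))" for x
  have k: "hardy_class \<alpha> L R k dk"
    unfolding k_def dk_def by (rule hardy_class_flip[OF v])
  have k_odd: "k (- x) = - k x" for x by (simp add: k_def flip_minus insert.prems(2))
  let ?a = "\<lambda>x. (1/2) *\<^sub>R (v x + (-1) *\<^sub>R k x)"
  let ?da = "\<lambda>x. (1/2) *\<^sub>R (dv x + (-1) *\<^sub>R dk x)"
  let ?b = "\<lambda>x. (1/2) *\<^sub>R (v x + 1 *\<^sub>R k x)"
  let ?db = "\<lambda>x. (1/2) *\<^sub>R (dv x + 1 *\<^sub>R dk x)"
  have a: "hardy_class \<alpha> L R ?a ?da" by (rule hardy_class_combine[OF v k]) simp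
  have b: "hardy_class \<alpha> L R ?b ?db" by (rule hardy_class_combine[OF v k]) simp
  have A: "hardy_ineq \<alpha> ?a ?da"
    unfolding hardy_ineq_def
    by (intro conjI half_space_hardy[OF a \<open>\<alpha> \<ge> 0\<close>, of i]) (simp_all add: k_def scaleR_diff_right)
  have B: "hardy_ineq \<alpha> ?b ?db"
  proof (rule insert.IH[OF b])
    show "?b (- x) = - ?b x" for x by (simp add: k_odd insert.prems(2) scaleR_add_right scaleR_diff_right)
    show "?b (flip l x) = ?b x" if "l \<notin> S" for l x
    proof (cases "l = i")
      case True then show ?thesis by (simp add: k_def add.commute)
    next
      case False
      then have "v (flip l y) = v y" for y using insert.prems(3)[of l y] that by auto
      then show ?thesis by (simp add: k_def flip_commute[of i l])
    qed
  qed
  have [measurable]: "v \<in> borel_measurable borel" "k \<in> borel_measurable borel"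
      "dv \<in> borel_measurable borel" "dk \<in> borel_measurable borel"
    using v k by (auto simp: hardy_class_def intro: borel_measurable_continuous_onI)
  let ?w = "\<lambda>x::real^'n. (x \<bullet> x) powr (-\<alpha>)"
  let ?w' = "\<lambda>x::real^'n. (x \<bullet> x) powr (-\<alpha>) / (x \<bullet> x)"
  note dv_split = parity_split_integral[of dv ?w dk i]
  note v_split = parity_split_integral[of v ?w' k i]
  have D: "integrable lborel (\<lambda>x. (norm (dv x))\<^sup>2 * ?w x) \<and> (LINT x|lborel. (norm (dv x))\<^sup>2 * ?w x) =
        (LINT x|lborel. (norm (?db x))\<^sup>2 * ?w x) + (LINT x|lborel. (norm (?da x))\<^sup>2 * ?w x)"
    using A B by (intro conjI dv_split) (auto simp: dk_def hardy_ineq_def)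
  have V: "integrable lborel (\<lambda>x. (norm (v x))\<^sup>2 * ?w' x) \<and> (LINT x|lborel. (norm (v x))\<^sup>2 * ?w' x) =
        (LINT x|lborel. (norm (?b x))\<^sup>2 * ?w' x) + (LINT x|lborel. (norm (?a x))\<^sup>2 * ?w' x)"
    using A B by (intro conjI v_split) (auto simp: k_def hardy_ineq_def)
  show ?case using A B D V unfolding hardy_ineq_def times_divide_eq_right[symmetric]
    by (simp only: distrib_left) (simp add: add_mono)
qed

lemma odd_weighted_hardy:
  assumes "hardy_class \<alpha> L R v dv" "\<alpha> \<ge> 0" "\<And>x. v (- x) = - v x"
  shows "hardy_ineq \<alpha> v dv"
  by (rule odd_weighted_hardy_induct[of UNIV]) (use assms in auto)

section \<open>From the quadratic inequality to the exponent p\<close>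

text \<open>The functions for which the inequality with exponent p is first proved. The bound M |x| on u
together with the bound M on the gradient puts |u|^\<alpha> u into \<open>hardy_class\<close>.\<close>

definition odd_admissible :: "real \<Rightarrow> real \<Rightarrow> (real^'n::finite \<Rightarrow> 'b::euclidean_space) \<Rightarrow> (real^'n \<Rightarrow> 'b^'n) \<Rightarrow> bool"
  where
  "odd_admissible M R u du \<longleftrightarrow> continuous_on UNIV u \<and> du \<in> borel_measurable borel \<and> has_partials u du \<and>
     (\<forall>x. norm (u x) \<le> M * norm x) \<and> (\<forall>x. norm (du x) \<le> M) \<and> (\<forall>x. norm x > R \<longrightarrow> u x = 0) \<and>
     (\<forall>x. u (- x) = - u x)"

lemma inner_self_powr: "(x \<bullet> x) powr \<beta> = norm x powr (2 * \<beta>)"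
  for x :: "'a::real_inner"
  by (simp add: dot_square_norm powr_powr flip: powr_numeral)

lemma pow_map_hardy_class:
  fixes u :: "real^'n::finite \<Rightarrow> 'b::euclidean_space"
  assumes u: "odd_admissible M R u du" and a: "\<alpha> > 0" and M: "M \<ge> 0"
  defines "dv \<equiv> (\<lambda>x. \<chi> j. pow_deriv \<alpha> (u x) (du x $ j))"
  shows "hardy_class \<alpha> ((\<alpha> + 1)\<^sup>2 * M powr (2 * \<alpha>) * M\<^sup>2) R (\<lambda>x. pow_map \<alpha> (u x)) dv"
    and "(norm (dv x))\<^sup>2 \<le> (\<alpha> + 1)\<^sup>2 * norm (u x) powr (2 * \<alpha>) * (norm (du x))\<^sup>2"
proof -
  have cu: "continuous_on UNIV u" and [measurable]: "du \<in> borel_measurable borel"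
    using u by (auto simp: odd_admissible_def)
  have [measurable]: "u \<in> borel_measurable borel" using cu by (rule borel_measurable_continuous_onI)
  show b: "(norm (dv x))\<^sup>2 \<le> (\<alpha> + 1)\<^sup>2 * norm (u x) powr (2 * \<alpha>) * (norm (du x))\<^sup>2" for x
  proof -
    have "(norm (dv x))\<^sup>2 = (\<Sum>j\<in>UNIV. (norm (pow_deriv \<alpha> (u x) (du x $ j)))\<^sup>2)"
      by (simp add: norm_vec_power2 dv_def)
    also have "\<dots> \<le> (\<Sum>j\<in>UNIV. ((\<alpha> + 1) * norm (u x) powr \<alpha> * norm (du x $ j))\<^sup>2)"
      using a by (intro sum_mono power_mono norm_pow_deriv_le) auto
    also have "\<dots> = (\<alpha> + 1)\<^sup>2 * (norm (u x) powr \<alpha>)\<^sup>2 * (norm (du x))\<^sup>2"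
      by (simp add: norm_vec_power2 power_mult_distrib sum_distrib_left)
    also have "(norm (u x) powr \<alpha>)\<^sup>2 = norm (u x) powr (2 * \<alpha>)"
      by (simp add: power2_eq_square flip: powr_add)
    finally show ?thesis .
  qed
  have "continuous_on UNIV (\<lambda>x. pow_map \<alpha> (u x))"
    unfolding pow_map_def
    by (intro continuous_on_scaleR continuous_on_powr' continuous_on_norm continuous_on_const cu) (use a in auto)
  moreover have "dv \<in> borel_measurable borel"
  proof -
    have m: "(\<lambda>x. du x $ j) \<in> borel_measurable borel" for j
    proof -
      have "(\<lambda>y::'b^'n. y $ j) \<in> borel_measurable borel"
        by (intro borel_measurable_continuous_onI continuous_intros)
      from measurable_compose[OF _ this, of du borel] show ?thesis by simp
    qed
    have "(\<lambda>x. pow_deriv \<alpha> (u x) (du x $ j)) \<in> borel_measurable borel" for j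
      unfolding pow_deriv_def using m[of j] by measurable
    then show ?thesis
      unfolding dv_def by (subst borel_measurable_euclidean_space) (auto simp: Basis_vec_def inner_axis)
  qed
  moreover have "has_partials (\<lambda>x. pow_map \<alpha> (u x)) dv"
    unfolding has_partials_def
  proof (intro allI)
    fix x j
    have "((\<lambda>t. u (x + t *\<^sub>R axis j 1)) has_vector_derivative du x $ j) (at 0)"
      using u by (simp add: odd_admissible_def has_partials_def)
    from pow_map_has_vector_derivative[OF a this]
    show "((\<lambda>t. pow_map \<alpha> (u (x + t *\<^sub>R axis j 1))) has_vector_derivative dv x $ j) (at 0)"
      by (simp add: dv_def)
  qed
  moreover have "(norm (dv x))\<^sup>2 \<le> (\<alpha> + 1)\<^sup>2 * M powr (2 * \<alpha>) * M\<^sup>2 * (x \<bullet> x) powr \<alpha>" for x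
  proof -
    have "norm (u x) powr (2 * \<alpha>) \<le> (M * norm x) powr (2 * \<alpha>)"
      using u a by (intro powr_mono2) (auto simp: odd_admissible_def)
    also have "\<dots> = M powr (2 * \<alpha>) * (x \<bullet> x) powr \<alpha>"
      using M by (simp add: powr_mult inner_self_powr)
    finally have 1: "norm (u x) powr (2 * \<alpha>) \<le> M powr (2 * \<alpha>) * (x \<bullet> x) powr \<alpha>" .
    have 2: "(norm (du x))\<^sup>2 \<le> M\<^sup>2"
      using u by (intro power_mono) (auto simp: odd_admissible_def)
    have "(norm (dv x))\<^sup>2 \<le> (\<alpha> + 1)\<^sup>2 * (norm (u x) powr (2 * \<alpha>) * (norm (du x))\<^sup>2)"
      using b[of x] by (simp add: mult.assoc)
    also have "\<dots> \<le> (\<alpha> + 1)\<^sup>2 * ((M powr (2 * \<alpha>) * (x \<bullet> x) powr \<alpha>) * M\<^sup>2)"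
      by (intro mult_left_mono mult_mono 1 2) auto
    finally show ?thesis by (simp add: mult_ac)
  qed
  moreover have "pow_map \<alpha> (u x) = 0" if "norm x > R" for x
    using u that by (simp add: odd_admissible_def pow_map_def)
  ultimately show "hardy_class \<alpha> ((\<alpha> + 1)\<^sup>2 * M powr (2 * \<alpha>) * M\<^sup>2) R (\<lambda>x. pow_map \<alpha> (u x)) dv"
    by (simp add: hardy_class_def)
qed

lemma D_H_eq:
  assumes "p = 2 * \<alpha> + 2"
  shows "D_H d p = ((((real d - 2 * \<alpha>) / 2)\<^sup>2 + 2 * \<alpha>) / (\<alpha> + 1)\<^sup>2) powr (\<alpha> + 1)"
proof (cases "\<alpha> = -1")
  case False
  then have "4 * (p - 2) / p\<^sup>2 + ((real d - p + 2) / p)\<^sup>2 = (((real d - 2 * \<alpha>) / 2)\<^sup>2 + 2 * \<alpha>) / (\<alpha> + 1)\<^sup>2"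
  proof -
    have p2: "p\<^sup>2 = 4 * (\<alpha> + 1)\<^sup>2" and dp: "real d - p + 2 = real d - 2 * \<alpha>" "4 * (p - 2) = 4 * (2 * \<alpha>)"
      using assms by (auto simp: power2_eq_square algebra_simps)
    show ?thesis unfolding power_divide p2 dp using False by (simp add: field_simps)
  qed
  moreover have "p / 2 = \<alpha> + 1" using assms by simp
  ultimately show ?thesis unfolding D_H_def by (simp only:)
qed (use assms in \<open>simp add: D_H_def\<close>)

text \<open>Integrate the tangent inequality for t \<mapsto> t^(p/2) at the point \<kappa> a^2, where a = |u|/|x|. By
\<open>norm_pow_deriv_le\<close> its first-order term dominates a nonnegative multiple of the difference of the two
integrands in \<open>hardy_ineq\<close> for v = |u|^\<alpha> u. For p = 2 one
takes v = u.\<close>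

lemma smooth_odd_hardy:
  fixes u :: "real^'n::finite \<Rightarrow> 'b::euclidean_space"
  assumes u: "odd_admissible M R u du" and p: "p \<ge> 2"
  shows "ennreal (D_H CARD('n) p) * (\<integral>\<^sup>+ x. ennreal (norm (u x) powr p / norm x powr p) \<partial>lborel)
       \<le> (\<integral>\<^sup>+ x. ennreal (norm (du x) powr p) \<partial>lborel)"
proof -
  define \<alpha> where "\<alpha> = p / 2 - 1"
  have p_eq: "p = 2 * \<alpha> + 2" and a0: "\<alpha> \<ge> 0" using p by (auto simp: \<alpha>_def)
  define C where "C = ((real CARD('n) - 2 * \<alpha>) / 2)\<^sup>2 + 2 * \<alpha>"
  define \<kappa> where "\<kappa> = C / (\<alpha> + 1)\<^sup>2"
  have C0: "C \<ge> 0" using a0 by (simp add: C_def)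
  then have k0: "\<kappa> \<ge> 0" by (simp add: \<kappa>_def)
  have Ck: "C = (\<alpha> + 1)\<^sup>2 * \<kappa>" using a0 by (simp add: \<kappa>_def)
  have D: "D_H CARD('n) p = \<kappa> powr (\<alpha> + 1)"
    unfolding \<kappa>_def C_def by (rule D_H_eq[OF p_eq])
  have [measurable]: "du \<in> borel_measurable borel" using u by (simp add: odd_admissible_def)
  have M: "M \<ge> 0"
    using u norm_ge_zero[of "du 0"] unfolding odd_admissible_def by (meson order.trans)
  let ?F = "\<lambda>x. norm (u x) powr p / norm x powr p"
  let ?B = "\<lambda>x. norm (du x) powr p"
  have "\<exists>(v :: real^'n \<Rightarrow> 'b) dv L \<beta>. hardy_class \<alpha> L R v dv \<and> (\<forall>x. v (- x) = - v x) \<and> \<beta> \<ge> 0 \<and>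
      (\<forall>x. x \<noteq> 0 \<longrightarrow> ?F x = (norm (v x))\<^sup>2 * (x \<bullet> x) powr (-\<alpha>) / (x \<bullet> x) \<and>
        D_H CARD('n) p * ?F x + \<beta> * ((norm (dv x))\<^sup>2 * (x \<bullet> x) powr (-\<alpha>) - C * ?F x) \<le> ?B x)"
  \<comment> \<open>The case \<alpha> = 0 is separate: there |u|^\<alpha> would be 0 instead of 1 at zeros of u.\<close>
  proof (cases "\<alpha> = 0")
    case True
    then have p2: "p = 2" by (simp add: p_eq)
    have "hardy_class \<alpha> (M\<^sup>2) R u du"
      using u by (auto simp: hardy_class_def odd_admissible_def True intro: power_mono)
    moreover have "D_H CARD('n) p = C" using C0 by (simp add: D \<kappa>_def True)
    moreover have "?F x = (norm (u x))\<^sup>2 * (x \<bullet> x) powr (-\<alpha>) / (x \<bullet> x)" if "x \<noteq> 0" for x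
      using that by (simp add: p2 True powr_numeral dot_square_norm)
    moreover have "(norm (du x))\<^sup>2 * (x \<bullet> x) powr (-\<alpha>) = ?B x" if "x \<noteq> 0" for x
      using that by (simp add: p2 True powr_numeral)
    ultimately show ?thesis using u
      by (intro exI[of _ u] exI[of _ du] exI[of _ "M\<^sup>2"] exI[of _ "1::real"])
         (auto simp: odd_admissible_def)
  next
    case False
    with a0 have a: "\<alpha> > 0" by simp
    define dv where "dv = (\<lambda>x. \<chi> j. pow_deriv \<alpha> (u x) (du x $ j))"
    let ?v = "\<lambda>x. pow_map \<alpha> (u x)"
    have cl: "hardy_class \<alpha> ((\<alpha> + 1)\<^sup>2 * M powr (2 * \<alpha>) * M\<^sup>2) R ?v dv"
      "(norm (dv x))\<^sup>2 \<le> (\<alpha> + 1)\<^sup>2 * norm (u x) powr (2 * \<alpha>) * (norm (du x))\<^sup>2" for x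
      unfolding dv_def by (rule pow_map_hardy_class[OF u a M])+
    have Fv: "?F x = (norm (?v x))\<^sup>2 * (x \<bullet> x) powr (-\<alpha>) / (x \<bullet> x)" if x: "x \<noteq> 0" for x
    proof -
      have "(norm (?v x))\<^sup>2 = norm (u x) powr p"
        by (simp add: norm_pow_map p_eq power2_eq_square flip: powr_add)
      moreover have "(x \<bullet> x) powr (-\<alpha>) / (x \<bullet> x) = 1 / norm x powr p"
      proof -
        have "(x \<bullet> x) powr (-\<alpha>) = norm x powr (- 2 * \<alpha>)" by (simp add: inner_self_powr)
        moreover have "x \<bullet> x = norm x powr 2" using x by (simp add: dot_square_norm powr_numeral)
        ultimately have "(x \<bullet> x) powr (-\<alpha>) / (x \<bullet> x) = norm x powr (- 2 * \<alpha> - 2)"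
          by (simp only: powr_diff)
        also have "- 2 * \<alpha> - 2 = - p" by (simp add: p_eq)
        finally show ?thesis by (simp add: powr_minus_divide)
      qed
      ultimately show ?thesis unfolding times_divide_eq_right[symmetric] by simp
    qed
    have tangent: "D_H CARD('n) p * ?F x + (\<kappa> powr \<alpha> / (\<alpha> + 1)) * ((norm (dv x))\<^sup>2 * (x \<bullet> x) powr (-\<alpha>) - C * ?F x) \<le> ?B x"
      if x: "x \<noteq> 0" for x
    proof -
      define aa where "aa = norm (u x) / norm x"
      define b where "b = norm (du x)"
      have aa: "aa \<ge> 0" and b: "b \<ge> 0" by (auto simp: aa_def b_def)
      have Fa: "?F x = aa powr p" by (simp add: aa_def powr_divide)
      have sq: "(y\<^sup>2) powr q = y powr (2 * q)" if "y \<ge> 0" for y q :: real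
        using that by (simp add: powr_powr flip: powr_numeral)
      have E: "(norm (dv x))\<^sup>2 * (x \<bullet> x) powr (-\<alpha>) \<le> (\<alpha> + 1)\<^sup>2 * (aa powr (2 * \<alpha>) * b\<^sup>2)"
      proof -
        have "(norm (dv x))\<^sup>2 * (x \<bullet> x) powr (-\<alpha>) \<le> (\<alpha> + 1)\<^sup>2 * norm (u x) powr (2 * \<alpha>) * b\<^sup>2 * (x \<bullet> x) powr (-\<alpha>)"
          unfolding b_def by (rule mult_right_mono[OF cl(2)]) simp
        also have "\<dots> = (\<alpha> + 1)\<^sup>2 * (aa powr (2 * \<alpha>) * b\<^sup>2)"
          by (simp add: aa_def powr_divide inner_self_powr powr_minus field_simps)
        finally show ?thesis .
      qed
      have "(\<kappa> * aa\<^sup>2) powr (\<alpha> + 1) + (\<alpha> + 1) * (\<kappa> * aa\<^sup>2) powr (\<alpha> + 1 - 1) * (b\<^sup>2 - \<kappa> * aa\<^sup>2) \<le> (b\<^sup>2) powr (\<alpha> + 1)"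
        using a k0 by (intro powr_above_tangent) auto
      moreover have "(b\<^sup>2) powr (\<alpha> + 1) = ?B x" using b by (simp add: sq p_eq b_def)
      moreover have "(\<kappa> * aa\<^sup>2) powr (\<alpha> + 1) = \<kappa> powr (\<alpha> + 1) * aa powr p"
        using k0 aa by (simp add: powr_mult sq p_eq)
      moreover have "(\<kappa> * aa\<^sup>2) powr (\<alpha> + 1 - 1) = \<kappa> powr \<alpha> * aa powr (2 * \<alpha>)"
        using k0 aa by (simp add: powr_mult sq)
      moreover have "aa powr (2 * \<alpha>) * aa\<^sup>2 = aa powr p"
        using aa by (cases "aa = 0") (auto simp: p_eq powr_add powr_numeral)
      ultimately have "\<kappa> powr (\<alpha> + 1) * aa powr p + (\<alpha> + 1) * \<kappa> powr \<alpha> * (aa powr (2 * \<alpha>) * b\<^sup>2 - \<kappa> * aa powr p) \<le> ?B x"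
        by (simp add: algebra_simps)
      moreover have "(\<kappa> powr \<alpha> / (\<alpha> + 1)) * ((norm (dv x))\<^sup>2 * (x \<bullet> x) powr (-\<alpha>) - C * ?F x)
          \<le> (\<kappa> powr \<alpha> / (\<alpha> + 1)) * ((\<alpha> + 1)\<^sup>2 * (aa powr (2 * \<alpha>) * b\<^sup>2) - C * ?F x)"
        using E a by (intro mult_left_mono) auto
      moreover have "\<dots> = (\<alpha> + 1) * \<kappa> powr \<alpha> * (aa powr (2 * \<alpha>) * b\<^sup>2 - \<kappa> * aa powr p)"
        unfolding Fa Ck using a by (simp add: power2_eq_square field_simps)
      ultimately show ?thesis unfolding D Fa by linarith
    qed
    show ?thesis
      using cl(1) Fv tangent u a
      by (intro exI[of _ ?v] exI[of _ dv] exI[of _ "(\<alpha> + 1)\<^sup>2 * M powr (2 * \<alpha>) * M\<^sup>2"] exI[of _ "\<kappa> powr \<alpha> / (\<alpha> + 1)"])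
         (auto simp: odd_admissible_def pow_map_minus)
  qed
  then obtain v :: "real^'n \<Rightarrow> 'b" and dv L \<beta> where v: "hardy_class \<alpha> L R v dv" "\<And>x. v (- x) = - v x" and b0: "\<beta> \<ge> 0"
    and Fv: "\<And>x. x \<noteq> 0 \<Longrightarrow> ?F x = (norm (v x))\<^sup>2 * (x \<bullet> x) powr (-\<alpha>) / (x \<bullet> x)"
    and pw: "\<And>x. x \<noteq> 0 \<Longrightarrow> D_H CARD('n) p * ?F x + \<beta> * ((norm (dv x))\<^sup>2 * (x \<bullet> x) powr (-\<alpha>) - C * ?F x) \<le> ?B x"
    by blast
  let ?F' = "\<lambda>x. (norm (v x))\<^sup>2 * (x \<bullet> x) powr (-\<alpha>) / (x \<bullet> x)"
  let ?E = "\<lambda>x. (norm (dv x))\<^sup>2 * (x \<bullet> x) powr (-\<alpha>)"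
  have H: "hardy_ineq \<alpha> v dv" by (rule odd_weighted_hardy[OF v(1) a0 v(2)])
  then have iF: "integrable lborel ?F'" and iE: "integrable lborel ?E"
    and CF: "C * (LINT x|lborel. ?F' x) \<le> (LINT x|lborel. ?E x)"
    by (auto simp: hardy_ineq_def C_def)
  have AE0: "AE x in lborel. x \<noteq> (0::real^'n)"
    by (rule AE_I'[of "{0}"]) (auto intro: finite_imp_null_set_lborel)
  have F0: "D_H CARD('n) p * ?F' x \<ge> 0" for x
    by (simp add: D_H_def)
  have iG: "integrable lborel (\<lambda>x. D_H CARD('n) p * ?F' x + \<beta> * (?E x - C * ?F' x))"
    by (intro Bochner_Integration.integrable_add Bochner_Integration.integrable_diff integrable_mult_right iF iE)
  have "ennreal (D_H CARD('n) p) * (\<integral>\<^sup>+ x. ennreal (?F x) \<partial>lborel)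
      = ennreal (D_H CARD('n) p) * (\<integral>\<^sup>+ x. ennreal (?F' x) \<partial>lborel)"
    using AE0 by (intro arg_cong[of _ _ "\<lambda>x. ennreal (D_H CARD('n) p) * x"] nn_integral_cong_AE) (auto simp: Fv)
  also have "\<dots> = ennreal (D_H CARD('n) p) * ennreal (LINT x|lborel. ?F' x)"
    using iF by (subst nn_integral_eq_integral) auto
  also have "\<dots> = ennreal (D_H CARD('n) p * (LINT x|lborel. ?F' x))"
    by (simp add: ennreal_mult D_H_def)
  also have "\<dots> \<le> ennreal (LINT x|lborel. D_H CARD('n) p * ?F' x + \<beta> * (?E x - C * ?F' x))"
  proof (rule ennreal_leI)
    have "(LINT x|lborel. D_H CARD('n) p * ?F' x + \<beta> * (?E x - C * ?F' x))
       = D_H CARD('n) p * (LINT x|lborel. ?F' x) + \<beta> * ((LINT x|lborel. ?E x) - C * (LINT x|lborel. ?F' x))"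
      by (simp add: Bochner_Integration.integral_add Bochner_Integration.integral_diff integrable_mult_right iF iE
            del: times_divide_eq_right)
    then show "D_H CARD('n) p * (LINT x|lborel. ?F' x)
        \<le> (LINT x|lborel. D_H CARD('n) p * ?F' x + \<beta> * (?E x - C * ?F' x))"
      using CF b0 by (simp add: zero_le_mult_iff)
  qed
  also have "\<dots> \<le> (\<integral>\<^sup>+ x. ennreal (D_H CARD('n) p * ?F' x + \<beta> * (?E x - C * ?F' x)) \<partial>lborel)"
  proof -
    let ?G = "\<lambda>x. D_H CARD('n) p * ?F' x + \<beta> * (?E x - C * ?F' x)"
    \<comment> \<open>The integrand may be negative somewhere, so compare with its positive part.\<close>
    have i: "integrable lborel (\<lambda>x. max 0 (?G x))" by (intro integrable_max iG) simp
    have "(LINT x|lborel. ?G x) \<le> (LINT x|lborel. max 0 (?G x))"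
      by (rule integral_mono[OF iG i]) simp
    then have "ennreal (LINT x|lborel. ?G x) \<le> (\<integral>\<^sup>+ x. ennreal (max 0 (?G x)) \<partial>lborel)"
      by (subst nn_integral_eq_integral[OF i]) (auto intro: ennreal_leI)
    moreover have "ennreal (max 0 y) = ennreal y" for y by (simp add: max_def ennreal_neg)
    ultimately show ?thesis by (simp only:)
  qed
  also have "\<dots> \<le> (\<integral>\<^sup>+ x. ennreal (?B x) \<partial>lborel)"
    using AE0 pw Fv by (intro nn_integral_mono_AE) (auto intro!: ennreal_leI)
  finally show ?thesis .
qed

section \<open>Smooth bump functions\<close>

text \<open>The flat function exp(-1/t), extended by 0 to t \<le> 0, with an extra factor t^(-m); these
factors appear in its derivatives.\<close>

definition flat :: "nat \<Rightarrow> real \<Rightarrow> real" where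
  "flat m t = (if t > 0 then (1 / t) ^ m * exp (- (1 / t)) else 0)"

lemma power_le_fact_exp:
  fixes s :: real
  assumes "s \<ge> 0"
  shows "s ^ n \<le> fact n * exp s"
proof -
  have "(\<Sum>k\<in>{n}. s ^ k /\<^sub>R fact k) \<le> (\<Sum>k. s ^ k /\<^sub>R fact k)"
    using assms by (intro sum_le_suminf summable_exp_generic) auto
  then have "s ^ n / fact n \<le> exp s" by (simp add: exp_def divide_inverse mult.commute)
  then show ?thesis by (simp add: field_simps)
qed

lemma flat_nonneg: "flat m t \<ge> 0"
  by (simp add: flat_def)

text \<open>With s = 1/t this says s^(m+1) \<le> (m+1)! e^s. It gives both the differentiability at 0 and, for
m = 2, an explicit bound for the derivative on t \<le> 1.\<close>

lemma flat_le: "flat m t \<le> fact (Suc m) * \<bar>t\<bar>"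
proof (cases "t > 0")
  case True
  have "(1 / t) ^ Suc m \<le> fact (Suc m) * exp (1 / t)"
    using True by (intro power_le_fact_exp) simp
  then have "(1 / t) ^ Suc m * t * exp (- (1 / t)) \<le> fact (Suc m) * exp (1 / t) * t * exp (- (1 / t))"
    using True by (intro mult_right_mono) auto
  moreover have "(1 / t) ^ Suc m * t = (1 / t) ^ m" using True by simp
  moreover have "fact (Suc m) * exp (1 / t) * t * exp (- (1 / t)) = fact (Suc m) * t * (exp (1 / t) * exp (- (1 / t)))"
    by (simp only: mult_ac)
  moreover have "exp (1 / t) * exp (- (1 / t)) = 1" by (simp flip: exp_add)
  ultimately have "(1 / t) ^ m * exp (- (1 / t)) \<le> fact (Suc m) * t" by (simp only: mult_1_right)
  then show ?thesis using True unfolding flat_def by simp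
next
  case False
  have "0 \<le> fact (Suc m) * \<bar>t\<bar>" by (intro mult_nonneg_nonneg) auto
  with False show ?thesis unfolding flat_def by simp
qed

lemma flat_has_derivative:
  "(flat m has_real_derivative flat (m + 2) t - real m * flat (m + 1) t) (at t)"
proof -
  consider "t > 0" | "t < 0" | "t = 0" by linarith
  then show ?thesis
  proof cases
    case 1
    have d1: "((\<lambda>t. 1 / t) has_real_derivative - (1 / t)\<^sup>2) (at t)"
      using 1 by (auto intro!: derivative_eq_intros simp: power2_eq_square field_simps)
    have "((\<lambda>t. (1 / t) ^ m * exp (- (1 / t))) has_real_derivative
        flat (m + 2) t - real m * flat (m + 1) t) (at t)"
      by (rule DERIV_cong[OF DERIV_mult[OF DERIV_power[OF d1] DERIV_fun_exp[OF DERIV_minus[OF d1]]]])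
         (use 1 in \<open>cases m; simp add: flat_def algebra_simps power2_eq_square del: power_one_over power_divide\<close>)
    then show ?thesis
      by (rule has_field_derivative_transform_within_open[where S = "{0<..}"])
         (use 1 in \<open>auto simp: flat_def\<close>)
  next
    case 2
    have "((\<lambda>t. 0) has_real_derivative 0) (at t)" by simp
    then have "(flat m has_real_derivative 0) (at t)"
      by (rule has_field_derivative_transform_within_open[where S = "{..<0}"])
         (use 2 in \<open>auto simp: flat_def\<close>)
    then show ?thesis using 2 by (simp add: flat_def)
  next
    case 3
    have "norm ((flat m (0 + h) - flat m 0) / h) \<le> fact (Suc (Suc m)) * \<bar>h\<bar>" for h
    proof -
      have "norm ((flat m (0 + h) - flat m 0) / h) = flat (Suc m) h"
        by (auto simp: flat_def field_simps)
      then show ?thesis using flat_le[of "Suc m" h] by simp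
    qed
    note quotient_le = this
    have "((\<lambda>h. (flat m (0 + h) - flat m 0) / h) \<longlongrightarrow> 0) (at 0)"
    proof (rule Lim_null_comparison[OF always_eventually])
      show "\<forall>h. norm ((flat m (0 + h) - flat m 0) / h) \<le> fact (Suc (Suc m)) * \<bar>h\<bar>"
        using quotient_le by blast
      have "((\<lambda>h::real. fact (Suc (Suc m)) * \<bar>h\<bar>) \<longlongrightarrow> fact (Suc (Suc m)) * \<bar>0\<bar>) (at 0)"
        by (intro tendsto_intros)
      then show "((\<lambda>h::real. fact (Suc (Suc m)) * \<bar>h\<bar>) \<longlongrightarrow> 0) (at 0)"
        by (simp only: abs_zero mult_zero_right)
    qed
    then show ?thesis using 3 by (simp add: DERIV_def flat_def)
  qed
qed

lemma flat_continuous: "continuous_on UNIV (flat m)"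
  using flat_has_derivative by (intro continuous_at_imp_continuous_on) (auto intro: DERIV_isCont)

lemma partial_deriv_eq:
  "(f has_derivative f') (at x) \<Longrightarrow> partial_deriv i f x = f' (axis i 1)"
  by (simp add: partial_deriv_def frechet_derivative_at[symmetric])

lemma C_k_SucI:
  assumes "\<And>x. (f has_derivative f' x) (at x)" "\<And>i. C_k k (\<lambda>x. f' x (axis i 1))"
  shows "C_k (Suc k) f"
proof -
  have "partial_deriv i f = (\<lambda>x. f' x (axis i 1))" for i
    using assms(1) by (auto intro!: ext partial_deriv_eq)
  then show ?thesis using assms by (auto simp: differentiable_def)
qed

lemma C_k_SucD: "C_k (Suc k) f \<Longrightarrow> C_k k f"
proof (induction k arbitrary: f)
  case 0
  then have "f differentiable_on UNIV" by (auto simp: differentiable_on_def intro: differentiable_at_withinI)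
  then show ?case by (simp add: differentiable_imp_continuous_on)
qed auto

lemma C_k_const: "C_k k (\<lambda>x. c)"
proof (induction k arbitrary: c)
  case (Suc k)
  then show ?case by (intro C_k_SucI[where f' = "\<lambda>_ _. 0"]) auto
qed simp

lemma C_k_add: "C_k k f \<Longrightarrow> C_k k g \<Longrightarrow> C_k k (\<lambda>x. f x + g x)"
proof (induction k arbitrary: f g)
  case (Suc k)
  show ?case
  proof (rule C_k_SucI)
    show "((\<lambda>x. f x + g x) has_derivative (\<lambda>h. frechet_derivative f (at x) h + frechet_derivative g (at x) h)) (at x)" for x
      using Suc.prems by (intro has_derivative_add) (auto simp: frechet_derivative_works[symmetric])
    show "C_k k (\<lambda>x. frechet_derivative f (at x) (axis i 1) + frechet_derivative g (at x) (axis i 1))" for i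
      using Suc by (auto simp: partial_deriv_def[abs_def])
  qed
qed (auto intro: continuous_intros)

lemma C_k_mult: "C_k k f \<Longrightarrow> C_k k g \<Longrightarrow> C_k k (\<lambda>x. f x * g x)"
proof (induction k arbitrary: f g)
  case (Suc k)
  show ?case
  proof (rule C_k_SucI)
    show "((\<lambda>x. f x * g x) has_derivative
        (\<lambda>h. f x * frechet_derivative g (at x) h + frechet_derivative f (at x) h * g x)) (at x)" for x
      using Suc.prems by (intro has_derivative_mult) (auto simp: frechet_derivative_works[symmetric])
    have "C_k k f" "C_k k g" using Suc.prems by (auto dest: C_k_SucD simp del: C_k.simps)
    then show "C_k k (\<lambda>x. f x * frechet_derivative g (at x) (axis i 1) + frechet_derivative f (at x) (axis i 1) * g x)" for i
      using Suc by (intro C_k_add Suc.IH) (auto simp: partial_deriv_def[abs_def])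
  qed
qed (auto intro: continuous_intros)

lemma C_k_coord: "C_k k (\<lambda>y::real^'n::finite. y $ j)"
proof (cases k)
  case (Suc l)
  have "C_k (Suc l) (\<lambda>y::real^'n. y $ j)"
  proof (rule C_k_SucI)
    show "((\<lambda>y::real^'n. y $ j) has_derivative (\<lambda>h. h $ j)) (at x)" for x
      by (rule bounded_linear_imp_has_derivative) (rule bounded_linear_vec_nth)
  qed (rule C_k_const)
  then show ?thesis using Suc by simp
qed (auto intro: continuous_intros)

lemma quadratic_has_derivative:
  "((\<lambda>y. 1 - c * ((x - y) \<bullet> (x - y))) has_derivative (\<lambda>h. 2 * c * ((x - y) \<bullet> h))) (at y)"
  for x :: "'a::real_inner"
  by (rule derivative_eq_intros refl)+ (auto simp: fun_eq_iff inner_commute)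

text \<open>The family indexed by m is closed under partial derivatives up to polynomial factors, so the
induction on k needs the statement for all m at once.\<close>

lemma C_k_flat_quadratic:
  fixes x :: "real^'n::finite"
  shows "C_k k (\<lambda>y. flat m (1 - c * ((x - y) \<bullet> (x - y))))"
proof (induction k arbitrary: m)
  case 0
  have "continuous_on UNIV (\<lambda>y. flat m (1 - c * ((x - y) \<bullet> (x - y))))"
    by (rule continuous_on_compose2[OF flat_continuous]) (auto intro!: continuous_intros)
  then show ?case by simp
next
  case (Suc k)
  let ?q = "\<lambda>y. 1 - c * ((x - y) \<bullet> (x - y))"
  show ?case
  proof (rule C_k_SucI)
    show "((\<lambda>y. flat m (?q y)) has_derivative
       (\<lambda>h. (2 * c * ((x - y) \<bullet> h)) * (flat (m + 2) (?q y) - real m * flat (m + 1) (?q y)))) (at y)" for y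
      using has_derivative_compose[OF quadratic_has_derivative flat_has_derivative[unfolded has_field_derivative_def]]
      by (simp add: mult.commute)
    have "(\<lambda>y. (2 * c * ((x - y) \<bullet> axis i 1)) * (flat (m + 2) (?q y) - real m * flat (m + 1) (?q y)))
       = (\<lambda>y. (2 * c * x $ i + (- 2 * c) * y $ i) * (flat (m + 2) (?q y) + (- real m) * flat (m + 1) (?q y)))" for i
      by (auto simp: fun_eq_iff inner_axis algebra_simps)
    moreover have "C_k k (\<lambda>y. (2 * c * x $ i + (- 2 * c) * y $ i) * (flat (m + 2) (?q y) + (- real m) * flat (m + 1) (?q y)))" for i
      by (intro C_k_mult C_k_add C_k_const C_k_coord Suc)
    ultimately show "C_k k (\<lambda>y. (2 * c * ((x - y) \<bullet> axis i 1)) * (flat (m + 2) (?q y) - real m * flat (m + 1) (?q y)))" for i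
      by simp
  qed
qed

definition bump :: "real \<Rightarrow> 'a::real_inner \<Rightarrow> real" where
  "bump r z = flat 0 (1 - r\<^sup>2 * (z \<bullet> z))"

lemma bump_nonneg: "bump r z \<ge> 0" and bump_minus: "bump r (- z) = bump r z"
  and bump_0: "bump r 0 = exp (-1)"
  by (auto simp: bump_def flat_nonneg) (simp add: flat_def)

lemma bump_eq_0:
  assumes "r > 0" "norm z \<ge> 1 / r"
  shows "bump r z = 0"
proof -
  have "1 \<le> r * norm z" using assms by (simp add: field_simps)
  then have "1\<^sup>2 \<le> (r * norm z)\<^sup>2" by (intro power_mono) auto
  then have "1 - r\<^sup>2 * (z \<bullet> z) \<le> 0" by (simp add: power_mult_distrib dot_square_norm)
  then show ?thesis by (simp add: bump_def flat_def)
qed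

text \<open>The derivative at y is -2 r^2 y flat 2 (1 - r^2 |y|^2), which vanishes unless r |y| \<le> 1; there
flat 2 is at most 3! = 6.\<close>

lemma bump_lipschitz:
  fixes z w :: "'a::real_inner"
  assumes r: "r > 0"
  shows "\<bar>bump r z - bump r w\<bar> \<le> 12 * r * norm (z - w)"
proof -
  let ?q = "\<lambda>y::'a. 1 - r\<^sup>2 * ((0 - y) \<bullet> (0 - y))"
  have d: "(bump r has_derivative (\<lambda>h. (2 * r\<^sup>2 * ((0 - y) \<bullet> h)) * flat 2 (?q y))) (at y)" for y :: 'a
    using has_derivative_compose[OF quadratic_has_derivative[of "r\<^sup>2" 0 y] flat_has_derivative[unfolded has_field_derivative_def, of 0]]
    by (simp add: mult.commute bump_def[abs_def] numeral_2_eq_2)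
  have "onorm (\<lambda>h. (2 * r\<^sup>2 * ((0 - y) \<bullet> h)) * flat 2 (?q y)) \<le> 12 * r" for y :: 'a
  proof (rule onorm_bound)
    show "0 \<le> 12 * r" using r by simp
    fix h
    show "norm ((2 * r\<^sup>2 * ((0 - y) \<bullet> h)) * flat 2 (?q y)) \<le> 12 * r * norm h"
    proof (cases "?q y > 0")
      case True
      have "(r * norm y)\<^sup>2 \<le> 1\<^sup>2" using True by (simp add: power_mult_distrib dot_square_norm)
      then have ry: "r * norm y \<le> 1" by (rule power2_le_imp_le) simp
      have "flat 2 (?q y) \<le> fact (Suc 2) * \<bar>?q y\<bar>" by (rule flat_le)
      also have "\<dots> \<le> 6" using True by (simp add: fact_numeral)
      finally have f6: "flat 2 (?q y) \<le> 6" .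
      have "norm ((2 * r\<^sup>2 * ((0 - y) \<bullet> h)) * flat 2 (?q y)) = 2 * r\<^sup>2 * \<bar>y \<bullet> h\<bar> * flat 2 (?q y)"
        using flat_nonneg by (simp add: abs_mult)
      also have "\<dots> \<le> 2 * r\<^sup>2 * (norm y * norm h) * 6"
        using f6 flat_nonneg by (intro mult_mono mult_left_mono Cauchy_Schwarz_ineq2) auto
      also have "\<dots> = 12 * r * ((r * norm y) * norm h)" by (simp add: power2_eq_square)
      also have "\<dots> \<le> 12 * r * (1 * norm h)"
        using ry r by (intro mult_left_mono mult_right_mono) auto
      finally show ?thesis by simp
    next
      case False
      then show ?thesis using r by (simp add: flat_def)
    qed
  qed
  then have "norm (bump r z - bump r w) \<le> 12 * r * norm (z - w)"
    using d by (intro differentiable_bound[where S = UNIV and f = "bump r"]) (auto intro: has_derivative_at_withinI)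
  then show ?thesis by simp
qed

lemma bump_continuous: "continuous_on UNIV (bump r :: 'a::real_inner \<Rightarrow> real)"
  unfolding bump_def[abs_def]
  by (rule continuous_on_compose2[OF flat_continuous]) (auto intro!: continuous_intros)

text \<open>Evenness is included so that mollification preserves oddness, and the Lipschitz bound so that
mollifications of locally integrable functions are Lipschitz on balls.\<close>

definition mollifier :: "real \<Rightarrow> (real^'n::finite \<Rightarrow> real) \<Rightarrow> bool" where
  "mollifier \<delta> \<rho> \<longleftrightarrow> continuous_on UNIV \<rho> \<and> (\<forall>z. \<rho> z \<ge> 0) \<and> (\<forall>z. \<rho> (- z) = \<rho> z) \<and>
     (\<forall>z. norm z > \<delta> \<longrightarrow> \<rho> z = 0) \<and> integrable lborel \<rho> \<and> (LINT z|lborel. \<rho> z) = 1 \<and>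
     (\<exists>K\<ge>0. \<forall>z w. \<bar>\<rho> z - \<rho> w\<bar> \<le> K * norm (z - w)) \<and> (\<forall>x. test_function (\<lambda>y. \<rho> (x - y)))"

text \<open>Normalise a bump; its integral is positive because it is continuous and nonzero at the origin.\<close>

lemma mollifier_exists:
  assumes "\<delta> > 0"
  shows "\<exists>\<rho> :: real^'n::finite \<Rightarrow> real. mollifier \<delta> \<rho>"
proof -
  define r where "r = 1 / \<delta>"
  have r: "r > 0" "1 / r = \<delta>" using assms by (auto simp: r_def)
  define c where "c = (LINT z|lborel. bump r (z :: real^'n))"
  have supp: "bump r z = 0" if "norm z \<ge> \<delta>" for z :: "real^'n"
    using bump_eq_0[OF r(1)] r(2) that by simp
  have int: "integrable lborel (bump r :: real^'n \<Rightarrow> real)"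
  proof -
    have "integrable lborel (\<lambda>x::real^'n. indicator (cball 0 \<delta>) x *\<^sub>R bump r x)"
      using borel_integrable_compact[of "cball 0 \<delta>" "bump r"] continuous_on_subset[OF bump_continuous]
      by (auto simp: set_integrable_def)
    also have "(\<lambda>x::real^'n. indicator (cball 0 \<delta>) x *\<^sub>R bump r x) = bump r"
      using supp by (auto simp: fun_eq_iff indicator_def)
    finally show ?thesis .
  qed
  have "c \<noteq> 0"
  proof
    assume "c = 0"
    then have "AE z in lborel. bump r (z :: real^'n) = 0"
      using integral_nonneg_eq_0_iff_AE[OF int] bump_nonneg by (auto simp: c_def)
    moreover have o: "open {z :: real^'n. bump r z \<noteq> 0}"
      by (intro open_Collect_neq bump_continuous continuous_on_const)
    ultimately have "{z :: real^'n. bump r z \<noteq> 0} \<in> null_sets lborel"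
      by (subst AE_iff_null_sets) auto
    then have "negligible {z :: real^'n. bump r z \<noteq> 0}"
      by (simp add: negligible_iff_null_sets null_sets_completionI)
    moreover have "0 \<in> {z :: real^'n. bump r z \<noteq> 0}" by (simp add: bump_0)
    ultimately show False using open_not_negligible[OF o] by blast
  qed
  moreover have "c \<ge> 0" unfolding c_def by (intro integral_nonneg_AE) (simp add: bump_nonneg)
  ultimately have c: "c > 0" by simp
  define \<rho> where "\<rho> z = 1 / c * bump r (z :: real^'n)" for z
  have "mollifier \<delta> \<rho>"
    unfolding mollifier_def
  proof (intro conjI allI impI)
    show "continuous_on UNIV \<rho>" unfolding \<rho>_def by (intro continuous_intros bump_continuous)
    show "\<rho> z \<ge> 0" for z using c by (simp add: \<rho>_def bump_nonneg)
    show "\<rho> (- z) = \<rho> z" for z by (simp add: \<rho>_def bump_minus)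
    show "\<rho> z = 0" if "norm z > \<delta>" for z using supp that by (simp add: \<rho>_def)
    show "integrable lborel \<rho>" unfolding \<rho>_def by (intro integrable_mult_right int)
    show "(LINT z|lborel. \<rho> z) = 1" using c by (simp add: \<rho>_def c_def[symmetric])
    show "\<exists>K\<ge>0. \<forall>z w. \<bar>\<rho> z - \<rho> w\<bar> \<le> K * norm (z - w)"
    proof (intro exI[of _ "1 / c * (12 * r)"] conjI allI)
      show "0 \<le> 1 / c * (12 * r)" using c r by simp
      fix z w
      have "\<bar>\<rho> z - \<rho> w\<bar> = 1 / c * \<bar>bump r z - bump r w\<bar>"
        using c by (simp add: \<rho>_def abs_mult flip: right_diff_distrib diff_divide_distrib)
      also have "\<dots> \<le> 1 / c * (12 * r * norm (z - w))"
        using c bump_lipschitz[OF r(1)] by (intro mult_left_mono) auto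
      finally show "\<bar>\<rho> z - \<rho> w\<bar> \<le> 1 / c * (12 * r) * norm (z - w)" by (simp add: mult.assoc)
    qed
    fix x
    show "test_function (\<lambda>y. \<rho> (x - y))"
      unfolding test_function_def
    proof (intro conjI allI)
      show "C_k k (\<lambda>y. \<rho> (x - y))" for k
        unfolding \<rho>_def bump_def by (intro C_k_mult C_k_const C_k_flat_quadratic)
      have "{y. \<rho> (x - y) \<noteq> 0} \<subseteq> cball x \<delta>"
      proof
        fix y assume "y \<in> {y. \<rho> (x - y) \<noteq> 0}"
        then have "\<not> norm (x - y) \<ge> \<delta>" using supp[of "x - y"] by (auto simp: \<rho>_def)
        then show "y \<in> cball x \<delta>" by (simp add: dist_norm)
      qed
      then have "bounded {y. \<rho> (x - y) \<noteq> 0}" by (rule bounded_subset[OF bounded_cball])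
      then show "compact (closure {y. \<rho> (x - y) \<noteq> 0})" by simp
    qed
  qed
  then show ?thesis by blast
qed

section \<open>Mollification\<close>

definition locally_L1 :: "(real^'n::finite \<Rightarrow> 'b::euclidean_space) \<Rightarrow> bool" where
  "locally_L1 f \<longleftrightarrow> f \<in> borel_measurable borel \<and> (\<forall>R. set_integrable lborel (cball 0 R) f)"

definition mollify :: "(real^'n::finite \<Rightarrow> real) \<Rightarrow> (real^'n \<Rightarrow> 'b::euclidean_space) \<Rightarrow> real^'n \<Rightarrow> 'b" where
  "mollify \<rho> f x = (LINT y|lborel. \<rho> (x - y) *\<^sub>R f y)"

lemma mollifier_bounded:
  assumes "mollifier \<delta> \<rho>"
  obtains A where "\<And>z. \<rho> z \<le> A" "A \<ge> 0"
proof -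
  have "compact (\<rho> ` cball 0 \<delta>)"
    using assms by (intro compact_continuous_image) (auto simp: mollifier_def intro: continuous_on_subset)
  then have "bounded (\<rho> ` cball 0 \<delta>)" by (rule compact_imp_bounded)
  then obtain A where A: "\<And>z. z \<in> cball 0 \<delta> \<Longrightarrow> norm (\<rho> z) \<le> A"
    unfolding bounded_iff by blast
  have "\<rho> z \<le> max A 0" for z
  proof (cases "norm z \<le> \<delta>")
    case True then show ?thesis using A[of z] by auto
  next
    case False then show ?thesis using assms by (auto simp: mollifier_def)
  qed
  then show ?thesis by (intro that[of "max A 0"]) auto
qed

lemma mollifier_measurable: "mollifier \<delta> \<rho> \<Longrightarrow> \<rho> \<in> borel_measurable borel"
  by (auto simp: mollifier_def intro: borel_measurable_continuous_onI)

lemma mollify_integrable: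
  fixes f :: "real^'n::finite \<Rightarrow> 'b::euclidean_space"
  assumes \<rho>: "mollifier \<delta> \<rho>" and f: "locally_L1 f"
  shows "integrable lborel (\<lambda>y. \<rho> (x - y) *\<^sub>R f y)"
proof -
  obtain A where A: "\<And>z. \<rho> z \<le> A" "A \<ge> 0" using mollifier_bounded[OF \<rho>] by blast
  have [measurable]: "f \<in> borel_measurable borel" "\<rho> \<in> borel_measurable borel"
    using f mollifier_measurable[OF \<rho>] by (auto simp: locally_L1_def)
  have "integrable lborel (\<lambda>y. A *\<^sub>R (indicator (cball 0 (norm x + \<delta>)) y *\<^sub>R f y))"
    using f by (intro integrable_scaleR_right) (auto simp: locally_L1_def set_integrable_def)
  then show ?thesis
  proof (rule Bochner_Integration.integrable_bound)
    have "norm (\<rho> (x - y) *\<^sub>R f y) \<le> norm (A *\<^sub>R (indicator (cball 0 (norm x + \<delta>)) y *\<^sub>R f y))" for y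
    proof (cases "norm y \<le> norm x + \<delta>")
      case True
      have "\<bar>\<rho> (x - y)\<bar> \<le> A" using A(1)[of "x - y"] \<rho> by (simp add: mollifier_def)
      then show ?thesis using True A(2) by (simp add: mult_right_mono)
    next
      case False
      have "norm y - norm x \<le> norm (x - y)" by (metis norm_minus_commute norm_triangle_ineq2)
      then have "\<rho> (x - y) = 0" using False \<rho> by (auto simp: mollifier_def)
      then show ?thesis by simp
    qed
    then show "AE y in lborel. norm (\<rho> (x - y) *\<^sub>R f y) \<le> norm (A *\<^sub>R (indicator (cball 0 (norm x + \<delta>)) y *\<^sub>R f y))"
      by simp
  qed measurable
qed

lemma mollifier_diff_bound:
  assumes K: "K \<ge> 0" "\<And>z w. \<bar>\<rho> z - \<rho> w\<bar> \<le> K * norm (z - w)" and \<rho>: "mollifier \<delta> \<rho>"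
    and R: "norm x \<le> R" "norm x' \<le> R"
  shows "\<bar>\<rho> (x - y) - \<rho> (x' - y)\<bar> \<le> K * norm (x - x') * indicator (cball 0 (R + \<delta>)) y"
proof (cases "norm y \<le> R + \<delta>")
  case True
  then show ?thesis using K(2)[of "x - y" "x' - y"] by simp
next
  case False
  have "norm y - norm x \<le> norm (x - y)" "norm y - norm x' \<le> norm (x' - y)"
    by (metis norm_minus_commute norm_triangle_ineq2)+
  then have "\<rho> (x - y) = 0" "\<rho> (x' - y) = 0" using False R \<rho> by (auto simp: mollifier_def)
  then show ?thesis using False by simp
qed

lemma mollify_lipschitz:
  fixes f :: "real^'n::finite \<Rightarrow> 'b::euclidean_space"
  assumes \<rho>: "mollifier \<delta> \<rho>" and f: "locally_L1 f"
  shows "\<exists>K\<ge>0. \<forall>x x'. norm x \<le> R \<longrightarrow> norm x' \<le> R \<longrightarrow>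
           norm (mollify \<rho> f x - mollify \<rho> f x') \<le> K * norm (x - x')"
proof -
  obtain K where K: "K \<ge> 0" "\<And>z w. \<bar>\<rho> z - \<rho> w\<bar> \<le> K * norm (z - w)"
    using \<rho> unfolding mollifier_def by metis
  let ?I = "\<lambda>y. indicator (cball 0 (R + \<delta>)) y *\<^sub>R f y"
  have i: "integrable lborel ?I" using f by (auto simp: locally_L1_def set_integrable_def)
  show ?thesis
  proof (intro exI[of _ "K * (LINT y|lborel. norm (?I y))"] conjI allI impI)
    show "0 \<le> K * (LINT y|lborel. norm (?I y))" using K by simp
    fix x x' :: "real^'n" assume R: "norm x \<le> R" "norm x' \<le> R"
    have "mollify \<rho> f x - mollify \<rho> f x' = (LINT y|lborel. (\<rho> (x - y) - \<rho> (x' - y)) *\<^sub>R f y)"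
      unfolding mollify_def scaleR_diff_left
      by (rule Bochner_Integration.integral_diff[symmetric]) (rule mollify_integrable[OF \<rho> f])+
    also have "norm \<dots> \<le> (LINT y|lborel. K * norm (x - x') * norm (?I y))"
    proof (rule Bochner_Integration.integral_norm_bound_integral)
      show "integrable lborel (\<lambda>y. (\<rho> (x - y) - \<rho> (x' - y)) *\<^sub>R f y)"
        unfolding scaleR_diff_left
        by (intro Bochner_Integration.integrable_diff mollify_integrable[OF \<rho> f])
      show "integrable lborel (\<lambda>y. K * norm (x - x') * norm (?I y))"
        by (intro integrable_mult_right integrable_norm i)
      show "norm ((\<rho> (x - y) - \<rho> (x' - y)) *\<^sub>R f y) \<le> K * norm (x - x') * norm (?I y)" for y
        using mult_right_mono[OF mollifier_diff_bound[OF K \<rho> R, of y] norm_ge_zero[of "f y"]]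
        by (simp add: mult.assoc)
    qed
    also have "\<dots> = K * norm (x - x') * (LINT y|lborel. norm (?I y))"
      by (rule integral_mult_right_zero)
    finally show "norm (mollify \<rho> f x - mollify \<rho> f x') \<le> K * (LINT y|lborel. norm (?I y)) * norm (x - x')"
      by (simp only: mult_ac)
  qed
qed

lemma mollify_continuous:
  fixes f :: "real^'n::finite \<Rightarrow> 'b::euclidean_space"
  assumes \<rho>: "mollifier \<delta> \<rho>" and f: "locally_L1 f"
  shows "continuous_on UNIV (mollify \<rho> f)"
proof (intro continuous_at_imp_continuous_on ballI)
  fix x :: "real^'n"
  obtain K where K: "K \<ge> 0" "\<And>y y'. norm y \<le> norm x + 1 \<Longrightarrow> norm y' \<le> norm x + 1 \<Longrightarrow>
       norm (mollify \<rho> f y - mollify \<rho> f y') \<le> K * norm (y - y')"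
    using mollify_lipschitz[OF \<rho> f, of "norm x + 1"] by blast
  have "continuous_on (ball x 1) (mollify \<rho> f)"
  proof (rule lipschitz_on_continuous_on[of K], rule lipschitz_onI)
    fix y y' assume "y \<in> ball x 1" "y' \<in> ball x 1"
    then have "norm y \<le> norm x + 1" "norm y' \<le> norm x + 1"
      using norm_triangle_ineq2[of y x] norm_triangle_ineq2[of y' x] by (auto simp: dist_norm norm_minus_commute)
    then show "dist (mollify \<rho> f y) (mollify \<rho> f y') \<le> K * dist y y'" using K by (simp add: dist_norm)
  qed (rule K)
  then show "isCont (mollify \<rho> f) x" by (simp add: continuous_on_eq_continuous_at)
qed

lemma mollify_odd:
  fixes f :: "real^'n::finite \<Rightarrow> 'b::euclidean_space"
  assumes \<rho>: "mollifier \<delta> \<rho>" and f: "locally_L1 f" and odd: "AE y in lborel. f (- y) = - f y"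
  shows "mollify \<rho> f (- x) = - mollify \<rho> f x"
proof -
  have [measurable]: "f \<in> borel_measurable borel" "\<rho> \<in> borel_measurable borel"
    using f mollifier_measurable[OF \<rho>] by (auto simp: locally_L1_def)
  have "mollify \<rho> f (- x) = (LINT y|distr lborel borel uminus. \<rho> (- x - y) *\<^sub>R f y)"
    by (simp add: mollify_def lborel_distr_minus)
  also have "\<dots> = (LINT y|lborel. \<rho> (- x - - y) *\<^sub>R f (- y))"
    by (subst integral_distr) auto
  also have "\<dots> = (LINT y|lborel. - (\<rho> (x - y) *\<^sub>R f y))"
  proof (rule integral_cong_AE)
    have "\<rho> (- x - - y) = \<rho> (x - y)" for y
    proof -
      have "\<rho> (- (x - y)) = \<rho> (x - y)" using \<rho> unfolding mollifier_def by blast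
      moreover have "- x - - y = - (x - y)" by simp
      ultimately show ?thesis by (simp only:)
    qed
    then show "AE y in lborel. \<rho> (- x - - y) *\<^sub>R f (- y) = - (\<rho> (x - y) *\<^sub>R f y)"
      using odd by (auto elim!: eventually_mono)
  qed measurable
  finally show ?thesis by (simp add: mollify_def)
qed

text \<open>By dominated convergence the derivative falls on the kernel. The kernel y \<mapsto> \<rho> (x - y)
is a test function, and its derivative in y is minus its derivative in x, so the weak gradient
identity moves the derivative from the kernel to u.\<close>

lemma mollify_has_partials:
  fixes u :: "real^'n::finite \<Rightarrow> 'b::euclidean_space" and g :: "real^'n \<Rightarrow> 'b^'n"
  assumes \<rho>: "mollifier \<delta> \<rho>" and u: "locally_L1 u" and g: "locally_L1 g"
    and weak: "\<And>\<phi> i. test_function \<phi> \<Longrightarrow>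
      (LINT x|lborel. partial_deriv i \<phi> x *\<^sub>R u x) = - (LINT x|lborel. \<phi> x *\<^sub>R (g x $ i))"
  shows "has_partials (mollify \<rho> u) (mollify \<rho> g)"
  unfolding has_partials_def
proof (intro allI)
  fix x :: "real^'n" and j :: 'n
  define e where "e = (axis j 1 :: real^'n)"
  have e1: "norm e = 1" by (simp add: e_def)
  define \<phi> where "\<phi> y = \<rho> (x - y)" for y
  have \<phi>: "test_function \<phi>" using \<rho> by (simp add: mollifier_def \<phi>_def[abs_def])
  then have "C_k (Suc 0) \<phi>" unfolding test_function_def by blast
  then have diff: "\<phi> differentiable at y" for y by simp
  obtain K where K: "K \<ge> 0" "\<And>z w. \<bar>\<rho> z - \<rho> w\<bar> \<le> K * norm (z - w)"
    using \<rho> unfolding mollifier_def by metis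
  have [measurable]: "u \<in> borel_measurable borel" "\<rho> \<in> borel_measurable borel"
    using u mollifier_measurable[OF \<rho>] by (auto simp: locally_L1_def)
  have lim: "((\<lambda>s. (\<rho> (x + s *\<^sub>R e - y) - \<rho> (x - y)) / s) \<longlongrightarrow> - partial_deriv j \<phi> y) (at 0)" for y
  proof -
    have "(\<phi> has_derivative frechet_derivative \<phi> (at y)) (at y)"
      using diff by (simp add: frechet_derivative_works)
    then have "(\<phi> has_derivative frechet_derivative \<phi> (at y)) (at (y + 0 *\<^sub>R (- e)))" by simp
    moreover have "((\<lambda>s. y + s *\<^sub>R (- e)) has_vector_derivative - e) (at 0)"
      by (auto intro!: derivative_eq_intros)
    ultimately have "((\<phi> \<circ> (\<lambda>s. y + s *\<^sub>R (- e))) has_vector_derivative frechet_derivative \<phi> (at y) (- e)) (at 0)"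
      by (intro vector_derivative_diff_chain_within[where S = UNIV, simplified])
         (auto intro: has_derivative_at_withinI)
    moreover have "frechet_derivative \<phi> (at y) (- e) = - partial_deriv j \<phi> y"
      using linear_frechet_derivative[OF diff] by (simp add: partial_deriv_def e_def linear_neg)
    ultimately show ?thesis
      by (simp add: has_vector_derivative_iff_quotient o_def \<phi>_def algebra_simps divide_inverse)
  qed
  have "((\<lambda>s. (mollify \<rho> u (x + s *\<^sub>R e) - mollify \<rho> u x) /\<^sub>R s) \<longlongrightarrow>
      (LINT y|lborel. - partial_deriv j \<phi> y *\<^sub>R u y)) (at 0)"
    unfolding tendsto_at_iff_sequentially
  proof (intro allI impI)
    fix S :: "nat \<Rightarrow> real" assume S: "\<forall>i. S i \<in> UNIV - {0}" "S \<longlonglongrightarrow> 0"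
    \<comment> \<open>A bound B for the steps keeps all shifted kernels in one ball, on which u is integrable.\<close>
    obtain B where B: "\<And>k. norm (S k) \<le> B" using convergent_imp_Bseq[OF convergentI[OF S(2)]]
      by (auto simp: Bseq_def)
    have B0: "B \<ge> 0" using B[of 0] norm_ge_zero order.trans by blast
    define q where "q k y = ((\<rho> (x + S k *\<^sub>R e - y) - \<rho> (x - y)) / S k) *\<^sub>R u y" for k y
    let ?I = "\<lambda>y. indicator (cball 0 (norm x + B + \<delta>)) y *\<^sub>R u y"
    have iI: "integrable lborel (\<lambda>y. K * norm (?I y))"
      using u by (intro integrable_mult_right integrable_norm) (auto simp: locally_L1_def set_integrable_def)
    have Fr: "S k \<noteq> 0" for k using S(1) by auto
    have conv: "(\<lambda>k. q k y) \<longlonglongrightarrow> - partial_deriv j \<phi> y *\<^sub>R u y" for y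
    proof -
      have "filterlim S (at 0) sequentially" using S by (auto simp: filterlim_at)
      from filterlim_compose[OF lim[of y] this] show ?thesis
        unfolding q_def by (intro tendsto_scaleR tendsto_const) simp
    qed
    have dom: "norm (q k y) \<le> K * norm (?I y)" for k y
    proof -
      have "norm (x + S k *\<^sub>R e) \<le> norm x + B"
        using norm_triangle_ineq[of x "S k *\<^sub>R e"] B[of k] e1 by simp
      then have "\<bar>\<rho> (x + S k *\<^sub>R e - y) - \<rho> (x - y)\<bar> \<le>
          K * norm (x + S k *\<^sub>R e - x) * indicator (cball 0 (norm x + B + \<delta>)) y"
        using B0 by (intro mollifier_diff_bound[OF K \<rho>]) auto
      then have "\<bar>(\<rho> (x + S k *\<^sub>R e - y) - \<rho> (x - y)) / S k\<bar> \<le> K * indicator (cball 0 (norm x + B + \<delta>)) y"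
        using Fr[of k] e1 by (simp add: abs_divide field_simps)
      from mult_right_mono[OF this norm_ge_zero[of "u y"]] show ?thesis
        by (simp add: q_def mult.assoc)
    qed
    have qm[measurable]: "q k \<in> borel_measurable lborel" for k unfolding q_def by measurable
    have "(\<lambda>y. - partial_deriv j \<phi> y *\<^sub>R u y) \<in> borel_measurable lborel"
      by (rule borel_measurable_LIMSEQ_metric[OF qm conv])
    then have "(\<lambda>k. LINT y|lborel. q k y) \<longlonglongrightarrow> (LINT y|lborel. - partial_deriv j \<phi> y *\<^sub>R u y)"
      by (rule integral_dominated_convergence[OF _ _ iI]) (use conv dom in auto)
    moreover have "(LINT y|lborel. q k y) = (mollify \<rho> u (x + S k *\<^sub>R e) - mollify \<rho> u x) /\<^sub>R S k" for k
    proof -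
      have "(LINT y|lborel. q k y) = (LINT y|lborel. (\<rho> (x + S k *\<^sub>R e - y) *\<^sub>R u y - \<rho> (x - y) *\<^sub>R u y) /\<^sub>R S k)"
        by (intro Bochner_Integration.integral_cong) (auto simp: q_def divide_inverse scaleR_diff_left algebra_simps)
      also have "\<dots> = (mollify \<rho> u (x + S k *\<^sub>R e) - mollify \<rho> u x) /\<^sub>R S k"
        unfolding mollify_def
        by (simp add: Bochner_Integration.integral_diff mollify_integrable[OF \<rho> u])
      finally show ?thesis .
    qed
    ultimately show "((\<lambda>s. (mollify \<rho> u (x + s *\<^sub>R e) - mollify \<rho> u x) /\<^sub>R s) \<circ> S)
        \<longlonglongrightarrow> (LINT y|lborel. - partial_deriv j \<phi> y *\<^sub>R u y)"
      by (simp add: o_def)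
  qed
  moreover have "(LINT y|lborel. - partial_deriv j \<phi> y *\<^sub>R u y) = mollify \<rho> g x $ j"
  proof -
    have "(LINT y|lborel. - partial_deriv j \<phi> y *\<^sub>R u y) = (LINT y|lborel. \<phi> y *\<^sub>R (g y $ j))"
      using weak[OF \<phi>, of j] by simp
    also have "\<dots> = (LINT y|lborel. (\<phi> y *\<^sub>R g y) $ j)" by simp
    also have "\<dots> = mollify \<rho> g x $ j"
      unfolding mollify_def \<phi>_def
      by (rule integral_bounded_linear[OF bounded_linear_vec_nth mollify_integrable[OF \<rho> g]])
    finally show ?thesis .
  qed
  ultimately show "((\<lambda>t. mollify \<rho> u (x + t *\<^sub>R axis j 1)) has_vector_derivative mollify \<rho> g x $ j) (at 0)"
    by (simp add: has_vector_derivative_iff_quotient e_def)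
qed

lemma mollifier_nn_integral_shift:
  assumes \<rho>: "mollifier \<delta> \<rho>"
  shows "(\<integral>\<^sup>+ x. ennreal (\<rho> (x - y)) \<partial>lborel) = 1"
proof -
  have [measurable]: "\<rho> \<in> borel_measurable borel" by (rule mollifier_measurable[OF \<rho>])
  have "(\<integral>\<^sup>+ x. ennreal (\<rho> (x - y)) \<partial>lborel) = (\<integral>\<^sup>+ x. ennreal (\<rho> x) \<partial>distr lborel borel ((+) (- y)))"
    by (subst nn_integral_distr) auto
  also have "\<dots> = (\<integral>\<^sup>+ x. ennreal (\<rho> x) \<partial>lborel)" by (simp only: lborel_distr_plus)
  also have "\<dots> = ennreal (LINT x|lborel. \<rho> x)"
    using \<rho> by (intro nn_integral_eq_integral) (auto simp: mollifier_def)
  finally show ?thesis using \<rho> by (simp add: mollifier_def)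
qed

lemma mollifier_flip_sign: "mollifier \<delta> \<rho> \<Longrightarrow> \<rho> (x - y) = \<rho> (y - x)"
  unfolding mollifier_def by (metis minus_diff_eq)

lemma mollifier_integral:
  assumes \<rho>: "mollifier \<delta> \<rho>"
  shows "integrable lborel (\<lambda>y. \<rho> (x - y))" "(LINT y|lborel. \<rho> (x - y)) = 1"
proof -
  have [measurable]: "\<rho> \<in> borel_measurable borel" by (rule mollifier_measurable[OF \<rho>])
  have nn: "\<rho> z \<ge> 0" for z using \<rho> by (simp add: mollifier_def)
  have 1: "(\<integral>\<^sup>+ y. ennreal (\<rho> (x - y)) \<partial>lborel) = ennreal 1"
    using mollifier_nn_integral_shift[OF \<rho>, of x] by (simp add: mollifier_flip_sign[OF \<rho>, of x])
  then show "integrable lborel (\<lambda>y. \<rho> (x - y))"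
    by (intro integrableI_nn_integral_finite[OF _ _ 1]) (auto simp: nn)
  show "(LINT y|lborel. \<rho> (x - y)) = 1"
    by (rule integral_eq_nn_integral[THEN trans]) (auto simp: nn 1)
qed

text \<open>Jensen's inequality for the probability density y \<mapsto> \<rho> (x - y): integrate the tangent inequality
of t \<mapsto> t^p at the mean value s of |f|.\<close>

lemma mollify_norm_powr_le:
  fixes f :: "real^'n::finite \<Rightarrow> 'b::euclidean_space"
  assumes \<rho>: "mollifier \<delta> \<rho>" and f: "locally_L1 f" and p: "p \<ge> 1"
  shows "ennreal (norm (mollify \<rho> f x) powr p) \<le> (\<integral>\<^sup>+ y. ennreal (\<rho> (x - y) * norm (f y) powr p) \<partial>lborel)"
proof (cases "(\<integral>\<^sup>+ y. ennreal (\<rho> (x - y) * norm (f y) powr p) \<partial>lborel) = \<infinity>")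
  case False
  have [measurable]: "f \<in> borel_measurable borel" "\<rho> \<in> borel_measurable borel"
    using f mollifier_measurable[OF \<rho>] by (auto simp: locally_L1_def)
  have nn: "\<rho> z \<ge> 0" for z using \<rho> by (simp add: mollifier_def)
  have i: "integrable lborel (\<lambda>y. \<rho> (x - y) * norm (f y) powr p)"
    using False by (intro integrableI_nonneg) (auto simp: nn less_top)
  define s where "s = (LINT y|lborel. \<rho> (x - y) * norm (f y))"
  have i1: "integrable lborel (\<lambda>y. \<rho> (x - y) * norm (f y))"
    using integrable_norm[OF mollify_integrable[OF \<rho> f, of x]] by (simp add: nn)
  have s0: "s \<ge> 0" unfolding s_def by (intro integral_nonneg_AE) (simp add: nn)
  have "norm (mollify \<rho> f x) \<le> (LINT y|lborel. norm (\<rho> (x - y) *\<^sub>R f y))"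
    unfolding mollify_def by (rule integral_norm_bound)
  then have ms: "norm (mollify \<rho> f x) \<le> s" by (simp add: s_def nn)
  have "(LINT y|lborel. s powr p * \<rho> (x - y) + p * s powr (p - 1) * (\<rho> (x - y) * norm (f y) - s * \<rho> (x - y)))
      \<le> (LINT y|lborel. \<rho> (x - y) * norm (f y) powr p)"
  proof (rule integral_mono[OF _ i])
    show "integrable lborel (\<lambda>y. s powr p * \<rho> (x - y) + p * s powr (p - 1) * (\<rho> (x - y) * norm (f y) - s * \<rho> (x - y)))"
      by (intro Bochner_Integration.integrable_add Bochner_Integration.integrable_diff integrable_mult_right
          mollifier_integral[OF \<rho>] i1)
    fix y
    show "s powr p * \<rho> (x - y) + p * s powr (p - 1) * (\<rho> (x - y) * norm (f y) - s * \<rho> (x - y))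
        \<le> \<rho> (x - y) * norm (f y) powr p"
      using mult_left_mono[OF powr_above_tangent[OF p s0 norm_ge_zero[of "f y"]] nn[of "x - y"]]
      by (simp add: algebra_simps)
  qed
  also have "(LINT y|lborel. s powr p * \<rho> (x - y) + p * s powr (p - 1) * (\<rho> (x - y) * norm (f y) - s * \<rho> (x - y)))
     = s powr p * 1 + p * s powr (p - 1) * (s - s * 1)"
    by (simp add: Bochner_Integration.integral_add Bochner_Integration.integral_diff mollifier_integral[OF \<rho>] i1 flip: s_def)
  finally have "s powr p \<le> (LINT y|lborel. \<rho> (x - y) * norm (f y) powr p)" by simp
  moreover have "norm (mollify \<rho> f x) powr p \<le> s powr p" using ms p by (intro powr_mono2) auto
  ultimately have "norm (mollify \<rho> f x) powr p \<le> (LINT y|lborel. \<rho> (x - y) * norm (f y) powr p)" by linarith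
  then show ?thesis using i by (subst nn_integral_eq_integral) (auto simp: nn ennreal_leI)
qed simp

text \<open>Integrate \<open>mollify_norm_powr_le\<close> in x and exchange the integrals.\<close>

lemma mollify_nn_integral_powr_le:
  fixes f :: "real^'n::finite \<Rightarrow> 'b::euclidean_space"
  assumes \<rho>: "mollifier \<delta> \<rho>" and f: "locally_L1 f" and p: "p \<ge> 1"
  shows "(\<integral>\<^sup>+ x. ennreal (norm (mollify \<rho> f x) powr p) \<partial>lborel) \<le> (\<integral>\<^sup>+ y. ennreal (norm (f y) powr p) \<partial>lborel)"
proof -
  have [measurable]: "f \<in> borel_measurable borel" "\<rho> \<in> borel_measurable borel"
    using f mollifier_measurable[OF \<rho>] by (auto simp: locally_L1_def)
  have nn: "\<rho> z \<ge> 0" for z using \<rho> by (simp add: mollifier_def)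
  have "(\<integral>\<^sup>+ x. ennreal (norm (mollify \<rho> f x) powr p) \<partial>lborel)
     \<le> (\<integral>\<^sup>+ x. \<integral>\<^sup>+ y. ennreal (\<rho> (x - y) * norm (f y) powr p) \<partial>lborel \<partial>lborel)"
    by (intro nn_integral_mono mollify_norm_powr_le[OF \<rho> f p])
  also have "\<dots> = (\<integral>\<^sup>+ y. \<integral>\<^sup>+ x. ennreal (\<rho> (x - y) * norm (f y) powr p) \<partial>lborel \<partial>lborel)"
    by (rule lborel_pair.Fubini') measurable
  also have "\<dots> = (\<integral>\<^sup>+ y. (\<integral>\<^sup>+ x. ennreal (\<rho> (x - y)) \<partial>lborel) * ennreal (norm (f y) powr p) \<partial>lborel)"
    by (simp add: ennreal_mult nn nn_integral_multc)
  finally show ?thesis by (simp add: mollifier_nn_integral_shift[OF \<rho>])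
qed

lemma integrable_imp_locally_L1:
  fixes f :: "real^'n::finite \<Rightarrow> 'b::euclidean_space"
  assumes "integrable lborel f"
  shows "locally_L1 f"
  using assms borel_measurable_integrable[OF assms]
  by (auto simp: locally_L1_def set_integrable_def intro!: integrable_mult_indicator)

section \<open>Convergence of mollifications\<close>

text \<open>A measurable function is an almost everywhere limit of continuous functions h_k. Truncating h_k
at radius N in the range by \<open>cl\<close> and multiplying by the cut-off \<open>\<theta>\<close> does not change the limit
and supplies the dominating function.\<close>

lemma continuous_dense_bounded:
  fixes f :: "'a::euclidean_space \<Rightarrow> 'b::euclidean_space"
  assumes [measurable]: "f \<in> borel_measurable borel" and N: "N \<ge> (1::real)"
    and b: "\<And>x. norm (f x) \<le> N" "\<And>x. norm x > N \<Longrightarrow> f x = 0" and e: "e > 0"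
  shows "\<exists>c. continuous_on UNIV c \<and> (\<forall>x. norm x > N + 1 \<longrightarrow> c x = 0) \<and> (LINT x|lborel. norm (f x - c x)) < e"
proof -
  have "f \<in> borel_measurable lebesgue" by (rule measurable_completion) simp
  then have "f measurable_on UNIV" by (simp add: measurable_on_iff_borel_measurable)
  then obtain Z h where Z: "negligible Z" and hc: "\<And>k. continuous_on UNIV (h k)"
    and lim: "\<And>x. x \<notin> Z \<Longrightarrow> (\<lambda>k::nat. h k x) \<longlonglongrightarrow> f x"
    by (auto simp: measurable_on_def)
  define cl where "cl z = (1 / max 1 (norm z / N)) *\<^sub>R z" for z :: 'b
  define \<theta> where "\<theta> x = max 0 (min 1 (N + 1 - norm x))" for x :: 'a
  define c where "c k x = \<theta> x *\<^sub>R cl (h k x)" for k x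
  have clc: "continuous_on UNIV cl"
    unfolding cl_def by (intro continuous_intros) (use N in auto)
  have cln: "norm (cl z) \<le> N" for z
    using N by (auto simp: cl_def max_def field_simps)
  have clf: "cl (f x) = f x" for x
  proof -
    have "norm (f x) / N \<le> 1" using b(1)[of x] N by simp
    then have "max 1 (norm (f x) / N) = 1" by simp
    then show ?thesis by (simp add: cl_def)
  qed
  have cc: "continuous_on UNIV (c k)" for k
    unfolding c_def \<theta>_def
    by (intro continuous_intros continuous_on_compose2[OF clc hc]) auto
  have \<theta>0: "\<theta> x = 0" if "norm x > N + 1" for x using that by (simp add: \<theta>_def)
  have \<theta>1: "\<bar>\<theta> x\<bar> \<le> 1" for x by (simp add: \<theta>_def)
  have [measurable]: "c k \<in> borel_measurable borel" for k using cc by (rule borel_measurable_continuous_onI)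
  have AE: "AE x in lborel. (\<lambda>k. norm (f x - c k x)) \<longlonglongrightarrow> 0"
  proof -
    have "AE x in lebesgue. x \<notin> Z" using Z by (auto simp: negligible_iff_null_sets intro: AE_not_in)
    then have "AE x in lborel. x \<notin> Z" by (simp add: AE_completion_iff)
    then show ?thesis
    proof eventually_elim
      fix x assume "x \<notin> Z"
      have "(\<lambda>k. cl (h k x)) \<longlonglongrightarrow> cl (f x)"
        by (rule continuous_on_tendsto_compose[OF clc lim[OF \<open>x \<notin> Z\<close>]]) auto
      then have "(\<lambda>k. norm (f x - c k x)) \<longlonglongrightarrow> norm (f x - \<theta> x *\<^sub>R f x)"
        unfolding c_def clf by (intro tendsto_intros)
      moreover have "\<theta> x *\<^sub>R f x = f x"
        using b(2)[of x] by (cases "norm x > N") (auto simp: \<theta>_def)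
      ultimately show "(\<lambda>k. norm (f x - c k x)) \<longlonglongrightarrow> 0" by simp
    qed
  qed
  have dom: "norm (norm (f x - c k x)) \<le> 2 * N * indicator (cball 0 (N + 1)) x" for k x
  proof (cases "norm x > N + 1")
    case True then show ?thesis using \<theta>0 b(2)[of x] by (simp add: c_def)
  next
    case False
    have "norm (c k x) \<le> 1 * N" unfolding c_def norm_scaleR
      by (rule mult_mono) (use \<theta>1 cln in auto)
    then have "norm (f x - c k x) \<le> N + N" using b(1)[of x] norm_triangle_ineq4[of "f x" "c k x"] by linarith
    then show ?thesis using False by simp
  qed
  have int: "integrable lborel (\<lambda>x::'a. 2 * N * indicator (cball 0 (N + 1)) x)"
    using emeasure_bounded_finite[OF bounded_cball, of "0::'a" "N + 1"]
    by (intro integrable_mult_right integrable_real_indicator) (auto simp: infinity_ennreal_def)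
  have "(\<lambda>k. LINT x|lborel. norm (f x - c k x)) \<longlonglongrightarrow> (LINT x|(lborel::'a measure). 0)"
    by (rule integral_dominated_convergence[OF _ _ int AE]) (use dom in auto)
  then have "(\<lambda>k. LINT x|lborel. norm (f x - c k x)) \<longlonglongrightarrow> 0" by simp
  from order_tendstoD(2)[OF this e] obtain k where "(LINT x|lborel. norm (f x - c k x)) < e"
    by (auto simp: eventually_sequentially)
  then show ?thesis using cc \<theta>0 by (intro exI[of _ "c k"]) (auto simp: c_def)
qed

lemma continuous_dense_L1:
  fixes f :: "'a::euclidean_space \<Rightarrow> 'b::euclidean_space"
  assumes f: "integrable lborel f" and e: "e > 0"
  shows "\<exists>c R. continuous_on UNIV c \<and> (\<forall>x. norm x > R \<longrightarrow> c x = 0) \<and> (LINT x|lborel. norm (f x - c x)) < e"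
proof -
  have [measurable]: "f \<in> borel_measurable borel" using borel_measurable_integrable[OF f] by simp
  define t where "t n x = (if norm (f x) \<le> real (Suc n) \<and> norm x \<le> real (Suc n) then f x else 0)" for n x
  have [measurable]: "t n \<in> borel_measurable borel" for n unfolding t_def by measurable
  have "(\<lambda>n. LINT x|lborel. norm (f x - t n x)) \<longlonglongrightarrow> (LINT x|(lborel::'a measure). 0)"
  proof (rule integral_dominated_convergence[OF _ _ integrable_norm[OF f]])
    have "(\<lambda>n. norm (f x - t n x)) \<longlonglongrightarrow> 0" for x
    proof (rule tendsto_eventually)
      obtain m where "max (norm (f x)) (norm x) \<le> real m" using real_arch_simple by blast
      then have "norm (f x - t n x) = 0" if "n \<ge> m" for n using that by (auto simp: t_def)
      then show "\<forall>\<^sub>F n in sequentially. norm (f x - t n x) = 0" by (auto simp: eventually_sequentially)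
    qed
    then show "AE x in lborel. (\<lambda>n. norm (f x - t n x)) \<longlonglongrightarrow> 0" by simp
    show "AE x in lborel. norm (norm (f x - t n x)) \<le> norm (f x)" for n by (simp add: t_def)
  qed measurable
  then have "(\<lambda>n. LINT x|lborel. norm (f x - t n x)) \<longlonglongrightarrow> 0" by simp
  from order_tendstoD(2)[OF this, of "e / 2"] e obtain n where n: "(LINT x|lborel. norm (f x - t n x)) < e / 2"
    by (auto simp: eventually_sequentially)
  have "\<exists>c. continuous_on UNIV c \<and> (\<forall>x. norm x > real (Suc n) + 1 \<longrightarrow> c x = 0) \<and> (LINT x|lborel. norm (t n x - c x)) < e / 2"
    by (rule continuous_dense_bounded) (use e in \<open>auto simp: t_def\<close>)
  then obtain c where c: "continuous_on UNIV c" "\<And>x. norm x > real (Suc n) + 1 \<Longrightarrow> c x = 0"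
    "(LINT x|lborel. norm (t n x - c x)) < e / 2" by blast
  have ic: "integrable lborel c" using c(1,2) by (rule integrable_continuous_bounded_support)
  have it: "integrable lborel (t n)" by (rule Bochner_Integration.integrable_bound[OF f]) (auto simp: t_def)
  have "(LINT x|lborel. norm (f x - c x)) \<le> (LINT x|lborel. norm (f x - t n x) + norm (t n x - c x))"
  proof (rule integral_mono)
    show "norm (f x - c x) \<le> norm (f x - t n x) + norm (t n x - c x)" for x
      using norm_triangle_ineq[of "f x - t n x" "t n x - c x"] by simp
  qed (intro Bochner_Integration.integrable_add integrable_norm Bochner_Integration.integrable_diff f it ic)+
  also have "\<dots> = (LINT x|lborel. norm (f x - t n x)) + (LINT x|lborel. norm (t n x - c x))"
    by (intro Bochner_Integration.integral_add integrable_norm Bochner_Integration.integrable_diff f it ic)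
  also have "\<dots> < e" using n c(3) by simp
  finally show ?thesis using c(1,2) by blast
qed

lemma mollify_continuous_L1:
  fixes c :: "real^'n::finite \<Rightarrow> 'b::euclidean_space"
  assumes c: "continuous_on UNIV c" and R: "\<And>x. norm x > R \<Longrightarrow> c x = 0" and e: "e > 0"
  shows "\<exists>d>0. \<forall>\<delta> \<rho>. \<delta> < d \<longrightarrow> mollifier \<delta> \<rho> \<longrightarrow>
     (\<integral>\<^sup>+ x. ennreal (norm (mollify \<rho> c x - c x)) \<partial>lborel) \<le> ennreal e"
proof -
  define m where "m = measure lborel (cball (0::real^'n) (R + 1))"
  have fin: "emeasure lborel (cball (0::real^'n) (R + 1)) = ennreal m"
    using emeasure_bounded_finite[OF bounded_cball, of "0::real^'n" "R + 1"]
    unfolding m_def by (intro emeasure_eq_ennreal_measure) auto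
  have m0: "m \<ge> 0" by (simp add: m_def)
  define e' where "e' = e / (m + 1)"
  have e': "e' > 0" using e m0 by (simp add: e'_def)
  have ic: "integrable lborel c" using c R by (rule integrable_continuous_bounded_support)
  have "uniformly_continuous_on (cball 0 (R + 2)) c"
    by (rule compact_uniformly_continuous) (auto intro: continuous_on_subset[OF c])
  then obtain d where d: "d > 0" "\<And>x y. norm x \<le> R + 2 \<Longrightarrow> norm y \<le> R + 2 \<Longrightarrow> norm (y - x) < d \<Longrightarrow> norm (c y - c x) < e'"
    using e' unfolding uniformly_continuous_on_def dist_norm by (auto simp: norm_minus_commute)
  show ?thesis
  proof (intro exI[of _ "min d 1"] conjI allI impI)
    show "min d 1 > 0" using d by simp
    fix \<delta> \<rho> assume \<delta>: "\<delta> < min d 1" and \<rho>: "mollifier \<delta> (\<rho> :: real^'n \<Rightarrow> real)"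
    have nn: "\<rho> z \<ge> 0" for z using \<rho> by (simp add: mollifier_def)
    have L: "locally_L1 c" by (rule integrable_imp_locally_L1[OF ic])
    have pt: "norm (mollify \<rho> c x - c x) \<le> e' * indicator (cball 0 (R + 1)) x" for x
    proof -
      have "mollify \<rho> c x - c x = (LINT y|lborel. \<rho> (x - y) *\<^sub>R c y) - (LINT y|lborel. \<rho> (x - y) *\<^sub>R c x)"
        using mollifier_integral[OF \<rho>] by (simp add: mollify_def)
      also have "\<dots> = (LINT y|lborel. \<rho> (x - y) *\<^sub>R (c y - c x))"
        unfolding scaleR_diff_right
        by (intro Bochner_Integration.integral_diff[symmetric] mollify_integrable[OF \<rho> L] integrable_scaleR_left impI
             mollifier_integral[OF \<rho>])
      also have "norm \<dots> \<le> (LINT y|lborel. \<rho> (x - y) * (e' * indicator (cball 0 (R + 1)) x))"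
      proof (rule Bochner_Integration.integral_norm_bound_integral)
        show "integrable lborel (\<lambda>y. \<rho> (x - y) *\<^sub>R (c y - c x))"
          unfolding scaleR_diff_right
          by (intro Bochner_Integration.integrable_diff mollify_integrable[OF \<rho> L] integrable_scaleR_left impI
             mollifier_integral[OF \<rho>])
        show "integrable lborel (\<lambda>y. \<rho> (x - y) * (e' * indicator (cball 0 (R + 1)) x))"
          by (intro integrable_mult_left mollifier_integral[OF \<rho>])
        fix y
        show "norm (\<rho> (x - y) *\<^sub>R (c y - c x)) \<le> \<rho> (x - y) * (e' * indicator (cball 0 (R + 1)) x)"
        proof (cases "norm (x - y) \<le> \<delta>")
          case True
          have yx: "norm y \<le> norm x + norm (x - y)" "norm x \<le> norm y + norm (x - y)"
            using norm_triangle_sub[of y x] norm_triangle_sub[of x y] by (auto simp: norm_minus_commute)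
          have "norm (c y - c x) \<le> e' * indicator (cball 0 (R + 1)) x"
          proof (cases "norm x \<le> R + 1")
            case T: True
            then have "norm (c y - c x) < e'"
              using True yx \<delta> by (intro d(2)) (auto simp: norm_minus_commute)
            then show ?thesis using T by simp
          next
            case False
            then show ?thesis using R[of x] R[of y] yx True \<delta> by simp
          qed
          then show ?thesis using nn[of "x - y"] by (simp add: mult_left_mono)
        next
          case False
          then have "\<rho> (x - y) = 0" using \<rho> by (simp add: mollifier_def)
          then show ?thesis by simp
        qed
      qed
      also have "\<dots> = e' * indicator (cball 0 (R + 1)) x"
        using mollifier_integral[OF \<rho>] by simp
      finally show ?thesis .
    qed
    have "(\<integral>\<^sup>+ x. ennreal (norm (mollify \<rho> c x - c x)) \<partial>lborel) \<le> (\<integral>\<^sup>+ x. ennreal e' * indicator (cball (0::real^'n) (R + 1)) x \<partial>lborel)"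
    proof (rule nn_integral_mono)
      show "ennreal (norm (mollify \<rho> c x - c x)) \<le> ennreal e' * indicator (cball 0 (R + 1)) x" for x
        using pt[of x] by (cases "x \<in> cball 0 (R + 1)") (auto simp: ennreal_leI simp del: mem_cball_0)
    qed
    also have "\<dots> = ennreal e' * ennreal m"
      by (subst nn_integral_cmult_indicator) (simp_all add: fin)
    also have "\<dots> \<le> ennreal e"
    proof -
      have "e' * m \<le> e" using e m0 by (simp add: e'_def field_simps)
      then show ?thesis using e' m0 by (simp add: ennreal_mult'[symmetric] ennreal_leI)
    qed
    finally show "(\<integral>\<^sup>+ x. ennreal (norm (mollify \<rho> c x - c x)) \<partial>lborel) \<le> ennreal e" .
  qed
qed

text \<open>Approximate f by a continuous function with bounded support. By Jensen's inequality with exponent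
1, mollification does not increase the approximation error.\<close>

lemma mollify_tendsto_L1:
  fixes f :: "real^'n::finite \<Rightarrow> 'b::euclidean_space"
  assumes f: "integrable lborel f" and \<rho>: "\<And>n. mollifier (\<delta> n) (\<rho> n)" and \<delta>: "\<delta> \<longlonglongrightarrow> 0"
  shows "(\<lambda>n. \<integral>\<^sup>+ x. ennreal (norm (mollify (\<rho> n) f x - f x)) \<partial>lborel) \<longlonglongrightarrow> 0"
proof (rule tendsto_zero_ennreal)
  fix r :: real assume r: "r > 0"
  have [measurable]: "f \<in> borel_measurable borel" using borel_measurable_integrable[OF f] by simp
  obtain c R where c: "continuous_on UNIV c" "\<And>x. norm x > R \<Longrightarrow> c x = 0"
    and fc: "(LINT x|lborel. norm (f x - c x)) < r / 4"
    using continuous_dense_L1[OF f, of "r / 4"] r by auto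
  have [measurable]: "c \<in> borel_measurable borel" using c(1) by (rule borel_measurable_continuous_onI)
  have ic: "integrable lborel c" using c by (rule integrable_continuous_bounded_support)
  have ifc: "integrable lborel (\<lambda>x. f x - c x)" by (intro Bochner_Integration.integrable_diff f ic)
  have nfc: "(\<integral>\<^sup>+ x. ennreal (norm (f x - c x)) \<partial>lborel) \<le> ennreal (r / 4)"
    using fc by (subst nn_integral_eq_integral[OF integrable_norm[OF ifc]]) (auto intro: ennreal_leI)
  obtain d where d: "d > 0" "\<And>\<delta> \<rho>. \<delta> < d \<Longrightarrow> mollifier \<delta> \<rho> \<Longrightarrow>
     (\<integral>\<^sup>+ x. ennreal (norm (mollify \<rho> c x - c x)) \<partial>lborel) \<le> ennreal (r / 4)"
    using mollify_continuous_L1[OF c, where e = "r / 4"] r by fastforce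
  from order_tendstoD(2)[OF \<delta> d(1)]
  show "\<forall>\<^sub>F n in sequentially. (\<integral>\<^sup>+ x. ennreal (norm (mollify (\<rho> n) f x - f x)) \<partial>lborel) < ennreal r"
  proof eventually_elim
    fix n assume "\<delta> n < d"
    note \<rho>n = \<rho>[of n]
    have Lf: "locally_L1 f" and Lc: "locally_L1 c" and Lfc: "locally_L1 (\<lambda>x. f x - c x)"
      using f ic ifc by (auto intro: integrable_imp_locally_L1)
    have [measurable]: "mollify (\<rho> n) c \<in> borel_measurable borel"
      "mollify (\<rho> n) (\<lambda>x. f x - c x) \<in> borel_measurable borel"
      using mollify_continuous[OF \<rho>n Lc] mollify_continuous[OF \<rho>n Lfc]
      by (auto intro: borel_measurable_continuous_onI)
    have lin: "mollify (\<rho> n) f x - mollify (\<rho> n) c x = mollify (\<rho> n) (\<lambda>x. f x - c x) x" for x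
      unfolding mollify_def scaleR_diff_right
      by (intro Bochner_Integration.integral_diff[symmetric] mollify_integrable[OF \<rho>n] Lf Lc)
    have "norm (mollify (\<rho> n) f x - f x) \<le>
        norm (mollify (\<rho> n) (\<lambda>x. f x - c x) x) + norm (mollify (\<rho> n) c x - c x) + norm (f x - c x)" for x
    proof -
      have "mollify (\<rho> n) f x - f x = mollify (\<rho> n) (\<lambda>x. f x - c x) x + (mollify (\<rho> n) c x - c x) - (f x - c x)"
        by (simp flip: lin)
      also have "norm \<dots> \<le> norm (mollify (\<rho> n) (\<lambda>x. f x - c x) x + (mollify (\<rho> n) c x - c x)) + norm (f x - c x)"
        by (rule norm_triangle_ineq4)
      also have "\<dots> \<le> norm (mollify (\<rho> n) (\<lambda>x. f x - c x) x) + norm (mollify (\<rho> n) c x - c x) + norm (f x - c x)"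
        by (intro add_right_mono norm_triangle_ineq)
      finally show ?thesis .
    qed
    then have "(\<integral>\<^sup>+ x. ennreal (norm (mollify (\<rho> n) f x - f x)) \<partial>lborel) \<le>
       (\<integral>\<^sup>+ x. ennreal (norm (mollify (\<rho> n) (\<lambda>x. f x - c x) x)) + ennreal (norm (mollify (\<rho> n) c x - c x))
          + ennreal (norm (f x - c x)) \<partial>lborel)"
      by (intro nn_integral_mono) (simp add: ennreal_leI flip: ennreal_plus)
    also have "\<dots> = (\<integral>\<^sup>+ x. ennreal (norm (mollify (\<rho> n) (\<lambda>x. f x - c x) x)) \<partial>lborel)
        + (\<integral>\<^sup>+ x. ennreal (norm (mollify (\<rho> n) c x - c x)) \<partial>lborel) + (\<integral>\<^sup>+ x. ennreal (norm (f x - c x)) \<partial>lborel)"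
      by (simp add: nn_integral_add)
    also have "\<dots> \<le> ennreal (r / 4) + ennreal (r / 4) + ennreal (r / 4)"
    proof (intro add_mono nfc d(2)[OF \<open>\<delta> n < d\<close> \<rho>n])
      show "(\<integral>\<^sup>+ x. ennreal (norm (mollify (\<rho> n) (\<lambda>x. f x - c x) x)) \<partial>lborel) \<le> ennreal (r / 4)"
        using order.trans[OF mollify_nn_integral_powr_le[OF \<rho>n Lfc, of 1] ] nfc by simp
    qed
    also have "\<dots> = ennreal (3 * r / 4)" using r by (simp flip: ennreal_plus)
    also have "\<dots> < ennreal r" using r by (intro ennreal_lessI) auto
    finally show "(\<integral>\<^sup>+ x. ennreal (norm (mollify (\<rho> n) f x - f x)) \<partial>lborel) < ennreal r" .
  qed
qed

section \<open>Cut-off mollifications of an odd function\<close>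

text \<open>The factor e makes the value at the origin equal to 1.\<close>

definition cutoff :: "real \<Rightarrow> real^'n::finite \<Rightarrow> real" where
  "cutoff r x = exp 1 * bump r x"

definition cutoff_gradient :: "real \<Rightarrow> real^'n::finite \<Rightarrow> real^'n" where
  "cutoff_gradient r x = (- (2 * exp 1 * r\<^sup>2 * flat 2 (1 - r\<^sup>2 * (x \<bullet> x)))) *\<^sub>R x"

lemma cutoff_bounds: "0 \<le> cutoff r x" "cutoff r x \<le> 1"
proof -
  show "0 \<le> cutoff r x" by (simp add: cutoff_def bump_nonneg)
  have "flat 0 t \<le> exp (- 1)" if "t \<le> 1" for t
    using that by (auto simp: flat_def field_simps)
  then have "bump r x \<le> exp (-1)" unfolding bump_def by simp
  then have "exp 1 * bump r x \<le> exp 1 * exp (-1)" by (rule mult_left_mono) simp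
  then show "cutoff r x \<le> 1" by (simp add: cutoff_def flip: exp_add)
qed

lemma cutoff_line_derivative:
  "((\<lambda>t. cutoff r (x + t *\<^sub>R axis j 1)) has_real_derivative cutoff_gradient r x $ j) (at 0)"
proof -
  have "((\<lambda>t. 1 - r\<^sup>2 * ((x + t *\<^sub>R axis j 1) \<bullet> (x + t *\<^sub>R axis j 1))) has_real_derivative 0 - r\<^sup>2 * (2 * x $ j)) (at 0)"
    by (intro DERIV_diff DERIV_const DERIV_cmult inner_self_line_derivative)
  from DERIV_chain2[OF flat_has_derivative this, of 0]
  have "((\<lambda>t. bump r (x + t *\<^sub>R axis j 1)) has_real_derivative flat 2 (1 - r\<^sup>2 * (x \<bullet> x)) * (0 - r\<^sup>2 * (2 * x $ j))) (at 0)"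
    by (simp add: bump_def numeral_2_eq_2)
  from DERIV_cmult[OF this, of "exp 1"] show ?thesis
    by (simp add: cutoff_def cutoff_gradient_def mult_ac)
qed

lemma cutoff_gradient_eq_0:
  assumes "r > 0" "norm x \<ge> 1 / r"
  shows "cutoff_gradient r x = 0"
proof -
  have "1 \<le> r * norm x" using assms by (simp add: field_simps)
  then have "1\<^sup>2 \<le> (r * norm x)\<^sup>2" by (intro power_mono) auto
  then have "1 - r\<^sup>2 * (x \<bullet> x) \<le> 0" by (simp add: power_mult_distrib dot_square_norm)
  then show ?thesis by (simp add: cutoff_gradient_def flat_def)
qed

lemma norm_cutoff_gradient_le:
  assumes r: "r > 0"
  shows "norm (cutoff_gradient r x) \<le> 36 * r"
proof (cases "norm x \<ge> 1 / r")
  case False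
  then have rx: "r * norm x \<le> 1" using r by (simp add: field_simps)
  have "(r * norm x)\<^sup>2 \<le> 1\<^sup>2" using rx r by (intro power_mono) auto
  then have q: "0 \<le> 1 - r\<^sup>2 * (x \<bullet> x)" "1 - r\<^sup>2 * (x \<bullet> x) \<le> 1"
    by (simp_all add: power_mult_distrib dot_square_norm)
  have "flat 2 (1 - r\<^sup>2 * (x \<bullet> x)) \<le> fact (Suc 2) * \<bar>1 - r\<^sup>2 * (x \<bullet> x)\<bar>" by (rule flat_le)
  also have "\<dots> \<le> 6" using q by (simp add: fact_numeral)
  finally have f6: "flat 2 (1 - r\<^sup>2 * (x \<bullet> x)) \<le> 6" .
  have "norm (cutoff_gradient r x) = 2 * exp 1 * r\<^sup>2 * flat 2 (1 - r\<^sup>2 * (x \<bullet> x)) * norm x"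
    using flat_nonneg by (simp add: cutoff_gradient_def abs_mult)
  also have "\<dots> = 2 * r * (exp 1 * flat 2 (1 - r\<^sup>2 * (x \<bullet> x)) * (r * norm x))"
    by (simp add: power2_eq_square)
  also have "\<dots> \<le> 2 * r * (3 * 6 * 1)"
  proof (intro mult_left_mono mult_mono)
    show "exp 1 \<le> (3::real)" by (rule exp_le)
  qed (use r rx f6 flat_nonneg in auto)
  finally show ?thesis by simp
qed (use r in \<open>simp add: cutoff_gradient_eq_0\<close>)

text \<open>The term d\<chi> u in the gradient of a product \<chi> u is such a vector.\<close>

lemma norm_outer_product: "norm (\<chi> j. a $ j *\<^sub>R z) = norm a * norm z"
  for a :: "real^'n::finite" and z :: "'b::real_normed_vector"
proof (rule power2_eq_imp_eq)
  show "(norm (\<chi> j. a $ j *\<^sub>R z))\<^sup>2 = (norm a * norm z)\<^sup>2"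
    by (simp add: norm_vec_power2 power_mult_distrib sum_distrib_right)
qed auto

text \<open>A mollification of an odd function vanishes at the origin, so its Lipschitz bound on a ball is
the required bound by M |x|; the other bounds hold because a continuous function is bounded on
a compact set.\<close>

lemma cutoff_mollify_odd_admissible:
  fixes u :: "real^'n::finite \<Rightarrow> 'b::euclidean_space" and g :: "real^'n \<Rightarrow> 'b^'n"
  assumes \<rho>: "mollifier \<delta> \<rho>" and u: "locally_L1 u" and g: "locally_L1 g"
    and weak: "\<And>\<phi> i. test_function \<phi> \<Longrightarrow>
      (LINT x|lborel. partial_deriv i \<phi> x *\<^sub>R u x) = - (LINT x|lborel. \<phi> x *\<^sub>R (g x $ i))"
    and odd: "AE y in lborel. u (- y) = - u y" and r: "r > 0"
  shows "\<exists>M. odd_admissible M (1 / r) (\<lambda>x. cutoff r x *\<^sub>R mollify \<rho> u x)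
     (\<lambda>x. cutoff r x *\<^sub>R mollify \<rho> g x + (\<chi> j. cutoff_gradient r x $ j *\<^sub>R mollify \<rho> u x))"
proof -
  let ?w = "\<lambda>x. cutoff r x *\<^sub>R mollify \<rho> u x"
  let ?dw = "\<lambda>x. cutoff r x *\<^sub>R mollify \<rho> g x + (\<chi> j. cutoff_gradient r x $ j *\<^sub>R mollify \<rho> u x)"
  have cu: "continuous_on UNIV (mollify \<rho> u)" and cg: "continuous_on UNIV (mollify \<rho> g)"
    by (rule mollify_continuous[OF \<rho>], fact)+
  have cc: "continuous_on UNIV (cutoff r :: real^'n \<Rightarrow> real)"
    unfolding cutoff_def by (intro continuous_intros bump_continuous)
  have cd: "continuous_on UNIV (cutoff_gradient r :: real^'n \<Rightarrow> _)"
    unfolding cutoff_gradient_def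
    by (intro continuous_intros continuous_on_compose2[OF flat_continuous]) auto
  have c0: "cutoff r x = 0" if "norm x \<ge> 1 / r" for x
    using bump_eq_0[OF r that] by (simp add: cutoff_def)
  have cdw: "continuous_on UNIV ?dw"
    by (intro continuous_on_add continuous_on_scaleR cc cg continuous_on_vec_lambda cu continuous_on_component cd)
  have "bounded (?dw ` cball 0 (1 / r))"
    by (intro compact_imp_bounded compact_continuous_image continuous_on_subset[OF cdw]) auto
  then obtain M1 where M1: "\<And>x. x \<in> cball 0 (1 / r) \<Longrightarrow> norm (?dw x) \<le> M1"
    unfolding bounded_iff by blast
  obtain K where K: "K \<ge> 0" "\<And>x x'. norm x \<le> 1 / r \<Longrightarrow> norm x' \<le> 1 / r \<Longrightarrow>
      norm (mollify \<rho> u x - mollify \<rho> u x') \<le> K * norm (x - x')"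
    using mollify_lipschitz[OF \<rho> u, of "1 / r"] by blast
  have mo: "mollify \<rho> u (- x) = - mollify \<rho> u x" for x by (rule mollify_odd[OF \<rho> u odd])
  have m0: "mollify \<rho> u 0 = 0"
  proof -
    have "mollify \<rho> u 0 + mollify \<rho> u 0 = 0" using mo[of 0] by (simp add: eq_neg_iff_add_eq_0)
    then show ?thesis by (simp flip: scaleR_2)
  qed
  define M where "M = max (max M1 0) K"
  have dw0: "?dw x = 0" if "norm x > 1 / r" for x
    using c0[of x] cutoff_gradient_eq_0[OF r, of x] that by (simp add: vec_eq_iff)
  have "norm (?w x) \<le> M * norm x" for x
  proof (cases "norm x \<le> 1 / r")
    case True
    have "norm (?w x) = cutoff r x * norm (mollify \<rho> u x)" using cutoff_bounds(1)[of r x] by simp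
    also have "\<dots> \<le> 1 * (K * norm x)"
      using K(2)[OF True, of 0] r m0 cutoff_bounds[of r x] by (intro mult_mono) auto
    also have "\<dots> \<le> M * norm x" by (simp add: M_def mult_right_mono)
    finally show ?thesis .
  next
    case False then show ?thesis using c0[of x] by (simp add: M_def)
  qed
  moreover have "norm (?dw x) \<le> M" for x
    using M1[of x] dw0[of x] by (cases "norm x \<le> 1 / r") (auto simp: M_def)
  moreover have "has_partials ?w ?dw"
    unfolding has_partials_def
  proof (intro allI)
    fix x j
    have "((\<lambda>t. mollify \<rho> u (x + t *\<^sub>R axis j 1)) has_vector_derivative mollify \<rho> g x $ j) (at 0)"
      using mollify_has_partials[OF \<rho> u g weak] by (simp add: has_partials_def)
    from has_vector_derivative_scaleR[OF cutoff_line_derivative this]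
    show "((\<lambda>t. ?w (x + t *\<^sub>R axis j 1)) has_vector_derivative ?dw x $ j) (at 0)" by simp
  qed
  moreover have "?w (- x) = - ?w x" for x
    by (simp add: mo cutoff_def bump_minus)
  moreover have "continuous_on UNIV ?w" by (intro continuous_intros cc cu)
  moreover have "?dw \<in> borel_measurable borel" using cdw by (rule borel_measurable_continuous_onI)
  moreover have "?w x = 0" if "norm x > 1 / r" for x using c0[of x] that by simp
  ultimately show ?thesis unfolding odd_admissible_def by blast
qed

text \<open>The gradient of the approximation is at most |\<rho> * g| + 36 r |\<rho> * u| in norm. Split its p-th power by
\<open>powr_add_le_weighted\<close> and remove the mollification by Jensen's inequality. Tying r to l by
r \<le> 2 l makes the error term a multiple of l, since l^(1-p) l^p = l.\<close>

lemma cutoff_mollify_hardy: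
  fixes u :: "real^'n::finite \<Rightarrow> 'b::euclidean_space" and g :: "real^'n \<Rightarrow> 'b^'n"
  assumes \<rho>: "mollifier \<delta> \<rho>" and u: "locally_L1 u" and g: "locally_L1 g"
    and weak: "\<And>\<phi> i. test_function \<phi> \<Longrightarrow>
      (LINT x|lborel. partial_deriv i \<phi> x *\<^sub>R u x) = - (LINT x|lborel. \<phi> x *\<^sub>R (g x $ i))"
    and odd: "AE y in lborel. u (- y) = - u y" and p: "p \<ge> 2" and l: "0 < l" "l < 1" and r: "0 < r" "r \<le> 2 * l"
    and A: "(\<integral>\<^sup>+ x. ennreal (norm (u x) powr p) \<partial>lborel) = ennreal A" "A \<ge> 0"
    and G: "(\<integral>\<^sup>+ x. ennreal (norm (g x) powr p) \<partial>lborel) = ennreal G" "G \<ge> 0"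
  shows "ennreal (D_H CARD('n) p) * (\<integral>\<^sup>+ x. ennreal (norm (cutoff r x *\<^sub>R mollify \<rho> u x) powr p / norm x powr p) \<partial>lborel)
     \<le> ennreal ((1 - l) powr (1 - p) * G + l * 72 powr p * A)"
proof -
  let ?w = "\<lambda>x. cutoff r x *\<^sub>R mollify \<rho> u x"
  let ?dw = "\<lambda>x. cutoff r x *\<^sub>R mollify \<rho> g x + (\<chi> j. cutoff_gradient r x $ j *\<^sub>R mollify \<rho> u x)"
  have [measurable]: "mollify \<rho> u \<in> borel_measurable borel" "mollify \<rho> g \<in> borel_measurable borel"
    using mollify_continuous[OF \<rho> u] mollify_continuous[OF \<rho> g] by (auto intro: borel_measurable_continuous_onI)
  obtain M where "odd_admissible M (1 / r) ?w ?dw"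
    using cutoff_mollify_odd_admissible[OF \<rho> u g weak odd r(1)] by blast
  then have "ennreal (D_H CARD('n) p) * (\<integral>\<^sup>+ x. ennreal (norm (?w x) powr p / norm x powr p) \<partial>lborel)
     \<le> (\<integral>\<^sup>+ x. ennreal (norm (?dw x) powr p) \<partial>lborel)"
    by (rule smooth_odd_hardy[OF _ p])
  also have "\<dots> \<le> (\<integral>\<^sup>+ x. ennreal ((1 - l) powr (1 - p)) * ennreal (norm (mollify \<rho> g x) powr p)
        + ennreal (l * 72 powr p) * ennreal (norm (mollify \<rho> u x) powr p) \<partial>lborel)"
  proof (rule nn_integral_mono)
    fix x
    have "norm (?dw x) \<le> norm (cutoff r x *\<^sub>R mollify \<rho> g x) + norm (\<chi> j. cutoff_gradient r x $ j *\<^sub>R mollify \<rho> u x)"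
      by (rule norm_triangle_ineq)
    also have "\<dots> \<le> norm (mollify \<rho> g x) + 72 * l * norm (mollify \<rho> u x)"
    proof (rule add_mono)
      show "norm (cutoff r x *\<^sub>R mollify \<rho> g x) \<le> norm (mollify \<rho> g x)"
        using cutoff_bounds[of r x] by (simp add: mult_left_le_one_le)
      have "norm (cutoff_gradient r x) \<le> 72 * l" using norm_cutoff_gradient_le[OF r(1), of x] r(2) by linarith
      then show "norm (\<chi> j. cutoff_gradient r x $ j *\<^sub>R mollify \<rho> u x) \<le> 72 * l * norm (mollify \<rho> u x)"
        unfolding norm_outer_product by (rule mult_right_mono) simp
    qed
    finally have "norm (?dw x) powr p \<le> (norm (mollify \<rho> g x) + 72 * l * norm (mollify \<rho> u x)) powr p"
      using p by (intro powr_mono2) auto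
    also have "\<dots> \<le> (1 - l) powr (1 - p) * norm (mollify \<rho> g x) powr p
        + l powr (1 - p) * (72 * l * norm (mollify \<rho> u x)) powr p"
      using p l by (intro powr_add_le_weighted) auto
    also have "l powr (1 - p) * (72 * l * norm (mollify \<rho> u x)) powr p
        = l powr (1 - p) * l powr p * (72 powr p * norm (mollify \<rho> u x) powr p)"
      using l by (simp add: powr_mult mult_ac)
    also have "l powr (1 - p) * l powr p = l" using l by (simp flip: powr_add)
    finally show "ennreal (norm (?dw x) powr p) \<le> ennreal ((1 - l) powr (1 - p)) * ennreal (norm (mollify \<rho> g x) powr p)
        + ennreal (l * 72 powr p) * ennreal (norm (mollify \<rho> u x) powr p)"
      using l by (simp add: ennreal_leI mult.assoc flip: ennreal_mult' ennreal_plus)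
  qed
  also have "\<dots> = ennreal ((1 - l) powr (1 - p)) * (\<integral>\<^sup>+ x. ennreal (norm (mollify \<rho> g x) powr p) \<partial>lborel)
        + ennreal (l * 72 powr p) * (\<integral>\<^sup>+ x. ennreal (norm (mollify \<rho> u x) powr p) \<partial>lborel)"
    by (simp add: nn_integral_add nn_integral_cmult)
  also have "\<dots> \<le> ennreal ((1 - l) powr (1 - p)) * ennreal G + ennreal (l * 72 powr p) * ennreal A"
    unfolding A(1)[symmetric] G(1)[symmetric]
    using p by (intro add_mono mult_left_mono mollify_nn_integral_powr_le[OF \<rho>] u g) auto
  also have "\<dots> = ennreal ((1 - l) powr (1 - p) * G + l * 72 powr p * A)"
    using l A(2) G(2) by (simp add: ennreal_mult' ennreal_plus)
  finally show ?thesis .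
qed

text \<open>On the ball of radius R the mollifications depend only on the values of u in the ball of radius
R + 1, where u is integrable; mean convergence there has an almost everywhere convergent
subsequence.\<close>

lemma mollify_AE_subsequence:
  fixes u :: "real^'n::finite \<Rightarrow> 'b::euclidean_space"
  assumes u: "locally_L1 u" and \<rho>: "\<And>n. mollifier (\<delta> n) (\<rho> n)" and \<delta>: "\<delta> \<longlonglongrightarrow> 0" "\<And>n. \<delta> n \<le> 1"
  shows "\<exists>s::nat \<Rightarrow> nat. strict_mono s \<and>
     (AE x in lborel. norm x \<le> R \<longrightarrow> (\<lambda>k. mollify (\<rho> (s k)) u x) \<longlonglongrightarrow> u x)"
proof -
  define f where "f x = indicator (cball 0 (R + 1)) x *\<^sub>R u x" for x
  have f: "integrable lborel f" using u by (auto simp: locally_L1_def set_integrable_def f_def[abs_def])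
  have Lf: "locally_L1 f" by (rule integrable_imp_locally_L1[OF f])
  have [measurable]: "mollify (\<rho> n) f \<in> borel_measurable borel" for n
    using mollify_continuous[OF \<rho> Lf] by (rule borel_measurable_continuous_onI)
  have im: "integrable lborel (mollify (\<rho> n) f)" for n
  proof (rule integrableI_bounded)
    have "(\<integral>\<^sup>+ x. ennreal (norm (mollify (\<rho> n) f x)) \<partial>lborel) \<le> (\<integral>\<^sup>+ x. ennreal (norm (f x)) \<partial>lborel)"
      using mollify_nn_integral_powr_le[OF \<rho> Lf, of 1] by simp
    also have "\<dots> < \<infinity>" using f by (simp add: integrable_iff_bounded)
    finally show "(\<integral>\<^sup>+ x. ennreal (norm (mollify (\<rho> n) f x)) \<partial>lborel) < \<infinity>" .
  qed simp
  have iz: "integrable lborel (\<lambda>x. mollify (\<rho> n) f x - f x)" for n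
    by (intro Bochner_Integration.integrable_diff im f)
  have "(\<lambda>n. ennreal (LINT x|lborel. norm (mollify (\<rho> n) f x - f x))) \<longlonglongrightarrow> ennreal 0"
    using mollify_tendsto_L1[OF f \<rho> \<delta>(1)]
    by (simp add: nn_integral_eq_integral[OF integrable_norm[OF iz]])
  then have "(\<lambda>n. LINT x|lborel. norm (mollify (\<rho> n) f x - f x)) \<longlonglongrightarrow> 0"
    by (subst (asm) tendsto_ennreal_iff) auto
  from tendsto_L1_AE_subseq[OF iz this] obtain s where s: "strict_mono s"
    "AE x in lborel. (\<lambda>n. mollify (\<rho> (s n)) f x - f x) \<longlonglongrightarrow> 0" by blast
  have eq: "mollify (\<rho> n) f x = mollify (\<rho> n) u x" if x: "norm x \<le> R" for n x
    unfolding mollify_def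
  proof (rule Bochner_Integration.integral_cong[OF refl])
    fix y
    show "\<rho> n (x - y) *\<^sub>R f y = \<rho> n (x - y) *\<^sub>R u y"
    proof (cases "norm y \<le> R + 1")
      case False
      have "norm y \<le> norm x + norm (x - y)" using norm_triangle_sub[of y x] by (simp add: norm_minus_commute)
      then have "norm (x - y) > \<delta> n" using False x \<delta>(2)[of n] by linarith
      then have "\<rho> n (x - y) = 0" using \<rho>[of n] by (simp add: mollifier_def)
      then show ?thesis by simp
    qed (simp add: f_def)
  qed
  from s(2) have "AE x in lborel. norm x \<le> R \<longrightarrow> (\<lambda>k. mollify (\<rho> (s k)) u x) \<longlonglongrightarrow> u x"
  proof eventually_elim
    fix x assume l: "(\<lambda>n. mollify (\<rho> (s n)) f x - f x) \<longlonglongrightarrow> 0"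
    show "norm x \<le> R \<longrightarrow> (\<lambda>k. mollify (\<rho> (s k)) u x) \<longlonglongrightarrow> u x"
    proof
      assume x: "norm x \<le> R"
      then have "f x = u x" by (simp add: f_def)
      with l show "(\<lambda>k. mollify (\<rho> (s k)) u x) \<longlonglongrightarrow> u x"
        unfolding eq[OF x] by (simp add: LIM_zero_iff)
    qed
  qed
  with s(1) show ?thesis by blast
qed

lemma cutoff_tendsto_1:
  assumes "r \<longlonglongrightarrow> 0"
  shows "(\<lambda>k. cutoff (r k) x) \<longlonglongrightarrow> 1"
proof -
  have "(\<lambda>k. 1 - (r k)\<^sup>2 * (x \<bullet> x)) \<longlonglongrightarrow> 1 - 0\<^sup>2 * (x \<bullet> x)"
    by (intro tendsto_intros assms)
  then have "(\<lambda>k. flat 0 (1 - (r k)\<^sup>2 * (x \<bullet> x))) \<longlonglongrightarrow> flat 0 (1 - 0\<^sup>2 * (x \<bullet> x))"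
    by (rule continuous_on_tendsto_compose[OF flat_continuous]) auto
  then have "(\<lambda>k. exp 1 * flat 0 (1 - (r k)\<^sup>2 * (x \<bullet> x))) \<longlonglongrightarrow> exp 1 * flat 0 (1 - 0\<^sup>2 * (x \<bullet> x))"
    by (rule tendsto_mult_left)
  then show ?thesis by (simp add: cutoff_def[abs_def] bump_def flat_def flip: exp_add)
qed

text \<open>Fatou's lemma along the subsequence of \<open>mollify_AE_subsequence\<close>. That subsequence depends on R, which
is why the estimate is first proved on a ball.\<close>

lemma odd_hardy_ball:
  fixes u :: "real^'n::finite \<Rightarrow> 'b::euclidean_space" and g :: "real^'n \<Rightarrow> 'b^'n"
  assumes u: "locally_L1 u" and g: "locally_L1 g"
    and weak: "\<And>\<phi> i. test_function \<phi> \<Longrightarrow>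
      (LINT x|lborel. partial_deriv i \<phi> x *\<^sub>R u x) = - (LINT x|lborel. \<phi> x *\<^sub>R (g x $ i))"
    and odd: "AE y in lborel. u (- y) = - u y" and p: "p \<ge> 2"
    and A: "(\<integral>\<^sup>+ x. ennreal (norm (u x) powr p) \<partial>lborel) = ennreal A" "A \<ge> 0"
    and G: "(\<integral>\<^sup>+ x. ennreal (norm (g x) powr p) \<partial>lborel) = ennreal G" "G \<ge> 0"
  shows "(\<integral>\<^sup>+ x. ennreal (D_H CARD('n) p * (norm (u x) powr p / norm x powr p)) * indicator (cball 0 R) x \<partial>lborel) \<le> ennreal G"
proof -
  define \<delta> where "\<delta> n = 1 / real (Suc n)" for n
  have \<delta>: "\<delta> n > 0" "\<delta> n \<le> 1" for n by (auto simp: \<delta>_def)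
  have \<delta>0: "\<delta> \<longlonglongrightarrow> 0" unfolding \<delta>_def using LIMSEQ_inverse_real_of_nat by (simp add: inverse_eq_divide)
  have "\<forall>n. \<exists>\<rho> :: real^'n \<Rightarrow> real. mollifier (\<delta> n) \<rho>" using mollifier_exists \<delta>(1) by blast
  then obtain \<rho> :: "nat \<Rightarrow> real^'n \<Rightarrow> real" where \<rho>: "\<And>n. mollifier (\<delta> n) (\<rho> n)" by metis
  obtain s :: "nat \<Rightarrow> nat" where s: "strict_mono s"
    "AE x in lborel. norm x \<le> R \<longrightarrow> (\<lambda>k. mollify (\<rho> (s k)) u x) \<longlonglongrightarrow> u x"
    using mollify_AE_subsequence[OF u \<rho> \<delta>0 \<delta>(2), of R] by blast
  \<comment> \<open>Both l and the error tend to 0, and the coefficient (1 - l)^(1-p) of the main term tends to 1.\<close>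
  define l where "l n = 1 / real (n + 2)" for n
  have l: "0 < l n" "l n < 1" "\<delta> n \<le> 2 * l n" for n
    by (auto simp: l_def \<delta>_def field_simps)
  have l0: "l \<longlonglongrightarrow> 0"
    unfolding l_def using LIMSEQ_ignore_initial_segment[OF LIMSEQ_inverse_real_of_nat, of 1]
    by (simp add: inverse_eq_divide add.commute)
  define w where "w k x = cutoff (\<delta> (s k)) x *\<^sub>R mollify (\<rho> (s k)) u x" for k x
  define F where "F k x = ennreal (D_H CARD('n) p * (norm (w k x) powr p / norm x powr p))" for k x
  have [measurable]: "cutoff r \<in> borel_measurable borel" for r
    unfolding cutoff_def[abs_def]
    by (intro borel_measurable_continuous_onI continuous_intros bump_continuous)
  have [measurable]: "mollify (\<rho> n) u \<in> borel_measurable borel" for n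
    using mollify_continuous[OF \<rho> u] by (rule borel_measurable_continuous_onI)
  have [measurable]: "w k \<in> borel_measurable borel" for k unfolding w_def by measurable
  have [measurable]: "F k \<in> borel_measurable borel" for k unfolding F_def by measurable
  have D0: "D_H CARD('n) p \<ge> 0" by (simp add: D_H_def)
  define b where "b n = (1 - l n) powr (1 - p) * G + l n * 72 powr p * A" for n
  have Fb: "(\<integral>\<^sup>+ x. F k x \<partial>lborel) \<le> ennreal (b (s k))" for k
  proof -
    have "(\<integral>\<^sup>+ x. F k x \<partial>lborel) = ennreal (D_H CARD('n) p) * (\<integral>\<^sup>+ x. ennreal (norm (w k x) powr p / norm x powr p) \<partial>lborel)"
      unfolding F_def ennreal_mult'[OF D0] by (rule nn_integral_cmult) measurable
    also have "\<dots> \<le> ennreal (b (s k))"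
      unfolding w_def b_def
      by (rule cutoff_mollify_hardy[OF \<rho> u g weak odd p l(1,2) \<delta>(1) l(3) A G])
    finally show ?thesis .
  qed
  have "b \<longlonglongrightarrow> (1 - 0) powr (1 - p) * G + 0 * 72 powr p * A"
    unfolding b_def by (intro tendsto_intros l0) auto
  then have "(\<lambda>k. b (s k)) \<longlonglongrightarrow> G"
    using LIMSEQ_subseq_LIMSEQ[OF _ s(1), of b] by (simp add: o_def)
  then have bs: "(\<lambda>k. ennreal (b (s k))) \<longlonglongrightarrow> ennreal G" by (rule tendsto_ennrealI)
  have \<delta>s: "(\<lambda>k. \<delta> (s k)) \<longlonglongrightarrow> 0" using LIMSEQ_subseq_LIMSEQ[OF \<delta>0 s(1)] by (simp add: o_def)
  have "(\<integral>\<^sup>+ x. ennreal (D_H CARD('n) p * (norm (u x) powr p / norm x powr p)) * indicator (cball 0 R) x \<partial>lborel)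
      \<le> (\<integral>\<^sup>+ x. liminf (\<lambda>k. F k x) \<partial>lborel)"
    using s(2)
  proof (intro nn_integral_mono_AE, eventually_elim)
    fix x assume lim: "norm x \<le> R \<longrightarrow> (\<lambda>k. mollify (\<rho> (s k)) u x) \<longlonglongrightarrow> u x"
    show "ennreal (D_H CARD('n) p * (norm (u x) powr p / norm x powr p)) * indicator (cball 0 R) x \<le> liminf (\<lambda>k. F k x)"
    proof (cases "norm x \<le> R")
      case True
      have "(\<lambda>k. w k x) \<longlonglongrightarrow> 1 *\<^sub>R u x"
        unfolding w_def using True lim by (intro tendsto_scaleR cutoff_tendsto_1 \<delta>s) auto
      then have "(\<lambda>k. norm (w k x)) \<longlonglongrightarrow> norm (u x)" using tendsto_norm by fastforce
      then have "(\<lambda>k. norm (w k x) powr p) \<longlonglongrightarrow> norm (u x) powr p"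
        using p by (intro tendsto_powr2) auto
      then have "(\<lambda>k. F k x) \<longlonglongrightarrow> ennreal (D_H CARD('n) p * (norm (u x) powr p / norm x powr p))"
        unfolding F_def divide_inverse by (intro tendsto_ennrealI tendsto_mult tendsto_const)
      then have "liminf (\<lambda>k. F k x) = ennreal (D_H CARD('n) p * (norm (u x) powr p / norm x powr p))"
        by (intro lim_imp_Liminf) auto
      then show ?thesis using True by simp
    qed simp
  qed
  also have "\<dots> \<le> liminf (\<lambda>k. \<integral>\<^sup>+ x. F k x \<partial>lborel)"
    by (rule nn_integral_liminf) simp
  also have "\<dots> \<le> liminf (\<lambda>k. ennreal (b (s k)))"
    by (rule Liminf_mono) (simp add: Fb)
  also have "\<dots> = ennreal G" using bs by (intro lim_imp_Liminf) auto
  finally show ?thesis .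
qed

lemma odd_hardy_lborel:
  fixes u :: "real^'n::finite \<Rightarrow> 'b::euclidean_space" and g :: "real^'n \<Rightarrow> 'b^'n"
  assumes u: "locally_L1 u" and g: "locally_L1 g"
    and weak: "\<And>\<phi> i. test_function \<phi> \<Longrightarrow>
      (LINT x|lborel. partial_deriv i \<phi> x *\<^sub>R u x) = - (LINT x|lborel. \<phi> x *\<^sub>R (g x $ i))"
    and odd: "AE y in lborel. u (- y) = - u y" and p: "p \<ge> 2"
    and A: "(\<integral>\<^sup>+ x. ennreal (norm (u x) powr p) \<partial>lborel) < \<infinity>"
  shows "ennreal (D_H CARD('n) p) * (\<integral>\<^sup>+ x. ennreal (norm (u x) powr p / norm x powr p) \<partial>lborel)
    \<le> (\<integral>\<^sup>+ x. ennreal (norm (g x) powr p) \<partial>lborel)"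
proof (cases "(\<integral>\<^sup>+ x. ennreal (norm (g x) powr p) \<partial>lborel) = \<infinity>")
  case False
  then obtain G where G: "(\<integral>\<^sup>+ x. ennreal (norm (g x) powr p) \<partial>lborel) = ennreal G" "G \<ge> 0"
    by (metis ennreal_cases infinity_ennreal_def)
  obtain A where A: "(\<integral>\<^sup>+ x. ennreal (norm (u x) powr p) \<partial>lborel) = ennreal A" "A \<ge> 0"
    using A by (metis ennreal_cases infinity_ennreal_def less_irrefl)
  have [measurable]: "u \<in> borel_measurable borel" using u by (simp add: locally_L1_def)
  define h where "h x = ennreal (D_H CARD('n) p * (norm (u x) powr p / norm x powr p))" for x
  have [measurable]: "h \<in> borel_measurable borel" unfolding h_def by measurable
  have "ennreal (D_H CARD('n) p) * (\<integral>\<^sup>+ x. ennreal (norm (u x) powr p / norm x powr p) \<partial>lborel) = (\<integral>\<^sup>+ x. h x \<partial>lborel)"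
  proof -
    have "D_H CARD('n) p \<ge> 0" by (simp add: D_H_def)
    then show ?thesis unfolding h_def ennreal_mult'[OF \<open>D_H CARD('n) p \<ge> 0\<close>]
      by (intro nn_integral_cmult[symmetric]) measurable
  qed
  also have "\<dots> \<le> (\<integral>\<^sup>+ x. liminf (\<lambda>N. h x * indicator (cball 0 (real N)) x) \<partial>lborel)"
  proof (rule nn_integral_mono)
    fix x :: "real^'n"
    obtain m where "norm x \<le> real m" using real_arch_simple by blast
    then have "h x \<le> h x * indicator (cball 0 (real N)) x" if "N \<ge> m" for N
      using that by simp
    then have "\<forall>\<^sub>F N in sequentially. h x \<le> h x * indicator (cball 0 (real N)) x"
      by (auto simp: eventually_sequentially)
    then show "h x \<le> liminf (\<lambda>N. h x * indicator (cball 0 (real N)) x)" by (rule Liminf_bounded)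
  qed
  also have "\<dots> \<le> liminf (\<lambda>N. \<integral>\<^sup>+ x. h x * indicator (cball 0 (real N)) x \<partial>lborel)"
    by (intro nn_integral_liminf borel_measurable_times_ennreal borel_measurable_indicator) auto
  also have "\<dots> \<le> liminf (\<lambda>N. ennreal G)"
    unfolding h_def by (intro Liminf_mono always_eventually allI odd_hardy_ball[OF u g weak odd p A G])
  also have "\<dots> = ennreal G" by (simp add: Liminf_const)
  finally show ?thesis by (simp add: G)
qed simp

section \<open>Passing from Lebesgue to Borel measurability\<close>

text \<open>A Borel representative allows the use of the product measure and of compositions with
translations and reflections.\<close>

lemma lebesgue_measurable_ex_borel:
  fixes f :: "'a::euclidean_space \<Rightarrow> 'b::euclidean_space"
  assumes f: "f \<in> borel_measurable lebesgue"
  shows "\<exists>f'\<in>borel_measurable borel. AE x in lborel. f x = f' x"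
proof -
  have "\<exists>h\<in>borel_measurable lborel. AE x in lborel. f x \<bullet> b = h x" for b
    by (intro completion_ex_borel_measurable_real measurable_compose[OF f]) auto
  then obtain h where h: "\<And>b. h b \<in> borel_measurable lborel" "\<And>b. AE x in lborel. f x \<bullet> b = h b x"
    by metis
  have [measurable]: "h b \<in> borel_measurable borel" for b using h(1)[of b] by simp
  have "AE x in lborel. \<forall>b\<in>Basis. f x \<bullet> b = h b x" using h(2) by (intro AE_finite_allI) auto
  then have "AE x in lborel. f x = (\<Sum>b\<in>Basis. h b x *\<^sub>R b)"
  proof eventually_elim
    fix x assume "\<forall>b\<in>Basis. f x \<bullet> b = h b x"
    then have "(\<Sum>b\<in>Basis. h b x *\<^sub>R b) = (\<Sum>b\<in>Basis. (f x \<bullet> b) *\<^sub>R b)" by (intro sum.cong) auto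
    then show "f x = (\<Sum>b\<in>Basis. h b x *\<^sub>R b)" by (simp add: euclidean_representation)
  qed
  moreover have "(\<lambda>x. \<Sum>b\<in>Basis. h b x *\<^sub>R b) \<in> borel_measurable borel"
    using h(1) by (intro borel_measurable_sum borel_measurable_scaleR) auto
  ultimately show ?thesis by (rule bexI)
qed

lemma locally_integrable_measurable:
  fixes f :: "real^'n::finite \<Rightarrow> 'b::euclidean_space"
  assumes "locally_integrable f"
  shows "f \<in> borel_measurable lebesgue"
proof (rule borel_measurable_LIMSEQ_metric)
  show "(\<lambda>x. indicator (cball 0 (real n)) x *\<^sub>R f x) \<in> borel_measurable lebesgue" for n
    using assms by (auto simp: locally_integrable_def set_integrable_def intro: borel_measurable_integrable)
  fix x :: "real^'n"
  obtain m where m: "norm x \<le> real m" using real_arch_simple by blast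
  show "(\<lambda>n. indicator (cball 0 (real n)) x *\<^sub>R f x) \<longlonglongrightarrow> f x"
    by (rule tendsto_eventually) (use m in \<open>auto simp: eventually_sequentially intro!: exI[of _ m]\<close>)
qed

lemma locally_integrable_imp_locally_L1:
  fixes f :: "real^'n::finite \<Rightarrow> 'b::euclidean_space"
  assumes f: "locally_integrable f" and [measurable]: "f' \<in> borel_measurable borel"
    and eq: "AE x in lborel. f x = f' x"
  shows "locally_L1 f'"
  unfolding locally_L1_def
proof (intro conjI allI)
  fix R
  have fm: "f \<in> borel_measurable lebesgue" by (rule locally_integrable_measurable[OF f])
  have m': "(\<lambda>x. indicator (cball 0 R) x *\<^sub>R f' x) \<in> borel_measurable lborel"
    using assms(2) by (intro borel_measurable_scaleR borel_measurable_indicator) auto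
  have "set_integrable lebesgue (cball 0 R) f" using f by (auto simp: locally_integrable_def)
  then have i: "integrable lebesgue (\<lambda>x. indicator (cball 0 R) x *\<^sub>R f x)" by (simp add: set_integrable_def)
  have "AE x in lebesgue. indicator (cball 0 R) x *\<^sub>R f x = indicator (cball 0 R) x *\<^sub>R f' x"
    using AE_completion[OF eq] by eventually_elim simp
  then have "integrable lebesgue (\<lambda>x. indicator (cball 0 R) x *\<^sub>R f' x)"
    by (rule Bochner_Integration.integrable_cong_AE_imp[OF i measurable_completion[OF m']])
  then show "set_integrable lborel (cball 0 R) f'"
    using integrable_completion[OF m'] by (simp add: set_integrable_def)
qed fact

lemma integral_lebesgue_eq_lborel:
  fixes f :: "'a::euclidean_space \<Rightarrow> 'b::euclidean_space" and h :: "'a \<Rightarrow> real"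
  assumes [measurable]: "f \<in> borel_measurable lebesgue" "f' \<in> borel_measurable borel" "h \<in> borel_measurable borel"
    and eq: "AE x in lborel. f x = f' x"
  shows "(LINT x|lebesgue. h x *\<^sub>R f x) = (LINT x|lborel. h x *\<^sub>R f' x)"
proof -
  have h: "h \<in> borel_measurable lebesgue" and f': "f' \<in> borel_measurable lebesgue"
    by (rule measurable_completion; simp)+
  have "(LINT x|lebesgue. h x *\<^sub>R f x) = (LINT x|lebesgue. h x *\<^sub>R f' x)"
  proof (rule integral_cong_AE)
    show "AE x in lebesgue. h x *\<^sub>R f x = h x *\<^sub>R f' x"
      using AE_completion[OF eq] by eventually_elim simp
  qed (use h f' assms(1) in \<open>auto intro: borel_measurable_scaleR\<close>)
  also have "\<dots> = (LINT x|lborel. h x *\<^sub>R f' x)" by (rule integral_completion) measurable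
  finally show ?thesis .
qed

lemma AE_lborel_minus:
  assumes "AE x in lborel. P (x :: real^'n::finite)"
  shows "AE x in lborel. P (- x)"
proof -
  obtain N where N: "{x \<in> space lborel. \<not> P x} \<subseteq> N" "emeasure lborel N = 0" "N \<in> sets lborel"
    using AE_E[OF assms] by blast
  then have "N \<in> null_sets lborel" by auto
  then have "AE x in lborel. x \<notin> N" by (rule AE_not_in)
  then have "AE x in distr lborel borel uminus. x \<notin> N" by (simp only: lborel_distr_minus)
  then have "AE x in lborel. - x \<notin> N"
    using N(3) by (subst (asm) AE_distr_iff) auto
  then show ?thesis using N(1) by (auto elim!: eventually_mono)
qed

theorem theorem3:
  fixes p :: real
    and u :: "real^'n::finite \<Rightarrow> 'b::{real_normed_field, euclidean_space}"
    and g :: "real^'n \<Rightarrow> 'b^'n"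
  assumes "p \<ge> 2"
    and "u \<in> sobolev_W1_odd p"
    and "has_weak_gradient u g"
  shows "(\<integral>\<^sup>+ x. ennreal (norm (g x) powr p) \<partial>lebesgue)
         \<ge> ennreal (D_H CARD('n) p) *
             (\<integral>\<^sup>+ x. ennreal (norm (u x) powr p / norm x powr p) \<partial>lebesgue)"
proof -
  have lu: "locally_integrable u" and lg: "locally_integrable g"
    and weak: "\<And>\<phi> i. test_function \<phi> \<Longrightarrow>
        (LINT x|lebesgue. partial_deriv i \<phi> x *\<^sub>R u x) = - (LINT x|lebesgue. \<phi> x *\<^sub>R (g x $ i))"
    using assms(3) by (auto simp: has_weak_gradient_def)
  have int: "integrable lebesgue (\<lambda>x. norm (u x) powr p)" and odd: "AE x in lebesgue. u (- x) = - u x"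
    using assms(2) by (auto simp: sobolev_W1_odd_def sobolev_W1_def Lp_def)
  have um: "u \<in> borel_measurable lebesgue" and gm: "g \<in> borel_measurable lebesgue"
    using lu lg by (auto intro: locally_integrable_measurable)
  obtain u' where u'[measurable]: "u' \<in> borel_measurable borel" and equ: "AE x in lborel. u x = u' x"
    using lebesgue_measurable_ex_borel[OF um] by blast
  obtain g' where g'[measurable]: "g' \<in> borel_measurable borel" and eqg: "AE x in lborel. g x = g' x"
    using lebesgue_measurable_ex_borel[OF gm] by blast
  have Lu: "locally_L1 u'" by (rule locally_integrable_imp_locally_L1[OF lu u' equ])
  have Lg: "locally_L1 g'" by (rule locally_integrable_imp_locally_L1[OF lg g' eqg])
  have weak': "(LINT x|lborel. partial_deriv i \<phi> x *\<^sub>R u' x) = - (LINT x|lborel. \<phi> x *\<^sub>R (g' x $ i))"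
    if \<phi>: "test_function \<phi>" for \<phi> i
  proof -
    have 1: "C_k 0 \<phi>" "C_k (Suc 0) \<phi>" using \<phi> unfolding test_function_def by blast+
    then have [measurable]: "\<phi> \<in> borel_measurable borel" "partial_deriv i \<phi> \<in> borel_measurable borel"
      by (auto intro: borel_measurable_continuous_onI)
    have nth: "(\<lambda>y::'b^'n. y $ i) \<in> borel_measurable borel"
      by (intro borel_measurable_continuous_onI continuous_intros)
    have "(LINT x|lebesgue. partial_deriv i \<phi> x *\<^sub>R u x) = (LINT x|lborel. partial_deriv i \<phi> x *\<^sub>R u' x)"
      by (rule integral_lebesgue_eq_lborel[OF um]) (use equ in auto)
    moreover have "(LINT x|lebesgue. \<phi> x *\<^sub>R (g x $ i)) = (LINT x|lborel. \<phi> x *\<^sub>R (g' x $ i))"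
    proof (rule integral_lebesgue_eq_lborel)
      show "(\<lambda>x. g x $ i) \<in> borel_measurable lebesgue" by (rule measurable_compose[OF gm nth])
      show "(\<lambda>x. g' x $ i) \<in> borel_measurable borel" by (rule measurable_compose[OF g' nth])
    qed (use eqg in \<open>auto elim!: eventually_mono\<close>)
    ultimately show ?thesis using weak[OF \<phi>, of i] by simp
  qed
  have odd': "AE x in lborel. u' (- x) = - u' x"
  proof -
    have "AE x in lborel. u (- x) = - u x" using odd by (simp add: AE_completion_iff)
    moreover have "AE x in lborel. u (- x) = u' (- x)" by (rule AE_lborel_minus[OF equ])
    ultimately show ?thesis using equ by eventually_elim simp
  qed
  have Iu: "(\<integral>\<^sup>+ x. ennreal (norm (u x) powr p) \<partial>lborel) = (\<integral>\<^sup>+ x. ennreal (norm (u' x) powr p) \<partial>lborel)"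
    by (rule nn_integral_cong_AE) (use equ in \<open>auto elim!: eventually_mono\<close>)
  have "(\<integral>\<^sup>+ x. ennreal (norm (u x) powr p) \<partial>lebesgue) < \<infinity>"
    using int by (simp add: integrable_iff_bounded)
  then have fin: "(\<integral>\<^sup>+ x. ennreal (norm (u' x) powr p) \<partial>lborel) < \<infinity>"
    by (simp add: nn_integral_completion Iu)
  have "ennreal (D_H CARD('n) p) * (\<integral>\<^sup>+ x. ennreal (norm (u' x) powr p / norm x powr p) \<partial>lborel)
      \<le> (\<integral>\<^sup>+ x. ennreal (norm (g' x) powr p) \<partial>lborel)"
    by (rule odd_hardy_lborel[OF Lu Lg weak' odd' assms(1) fin])
  moreover have "(\<integral>\<^sup>+ x. ennreal (norm (u x) powr p / norm x powr p) \<partial>lborel)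
      = (\<integral>\<^sup>+ x. ennreal (norm (u' x) powr p / norm x powr p) \<partial>lborel)"
    by (rule nn_integral_cong_AE) (use equ in \<open>auto elim!: eventually_mono\<close>)
  moreover have "(\<integral>\<^sup>+ x. ennreal (norm (g x) powr p) \<partial>lborel) = (\<integral>\<^sup>+ x. ennreal (norm (g' x) powr p) \<partial>lborel)"
    by (rule nn_integral_cong_AE) (use eqg in \<open>auto elim!: eventually_mono\<close>)
  ultimately show ?thesis by (simp only: nn_integral_completion)
qed

end
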